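(* Let $a\ge0$ and let $(q,r)$ be $a$-admissible. There is $C(a,r)>0$ such that for every $F\in\mathbb S^+$, the function $T_a(F)(x)=\int_{\mathbb R}S_a(-t)\big(F(\cdot,t)\big)(x)\,dt$ satisfies $$\|T_a(F)\|_{L^2_a}\le C(a,r)\|F\|_{L^{q'}_tL^{r'}_a}.$$
   Context: $\mathbb R^+=(0,\infty)$, $d\omega_a(x)=x^a\,dx$, $L^r_a=L^r(\mathbb R^+,d\omega_a)$, $\|u\|_{L^q_tL^r_a}=(\int_{\mathbb R}\|u(\cdot,t)\|_{L^r_a}^q\,dt)^{1/q}$; primes denote conjugate exponents. A pair $(q,r)$ is $a$-admissible if $r>2$, additionally $r<\frac{2(a+1)}{a-1}$ when $a>1$, and $\frac2q=(a+1)(\frac12-\frac1r)$. $\mathbb S^+$ is the set of $F\in C^\infty(\mathbb R^+\times\mathbb R;\mathbb C)$ with $\sup_{k+\ell\le p}\sup_{(x,t)}(1+x^2+t^2)^{p/2}|(x^{-1}\partial_x)^k\partial_t^\ell F(x,t)|<\infty$ for every $p\in\mathbb N_0$. Kernel: for $x,y>0$, $S_a(x,y,t)=\frac{e^{-i(a+1)\pi/4}}{(2|t|)^{(a+1)/2}}\big(\frac{xy}{2|t|}\big)^{\frac{1-a}2}J_{\frac{a-1}2}\big(\frac{xy}{2|t|}\big)e^{i\frac{x^2+y^2}{4|t|}}$ if $t>0$, its analogue with $e^{i(a+1)\pi/4}$ and $e^{-i\frac{x^2+y^2}{4|t|}}$ if $t<0$ ($J_\nu$ Bessel function of the first kind);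 $S_a(t)\varphi(x)=\int_0^\infty S_a(x,y,t)\varphi(y)\,d\omega_a(y)$, $S_a(0)=\mathrm{Id}$. *)

theory Defs
  imports "HOL-Analysis.Analysis"
begin

text \<open>Bessel function of the first kind of real order nu (nu > -1), for z > 0.\<close>
definition besselJ :: "real \<Rightarrow> real \<Rightarrow> real" where
  "besselJ nu z = (\<Sum>k. (-1) ^ k / (fact k * Gamma (real k + nu + 1)) * (z / 2) powr (2 * real k + nu))"

text \<open>The kernel S_a(x,y,t) for x, y > 0, t \<noteq> 0.\<close>
definition Sker :: "real \<Rightarrow> real \<Rightarrow> real \<Rightarrow> real \<Rightarrow> complex" where
  "Sker a x y t =
     (if t > 0 then
        exp (- \<i> * of_real ((a + 1) * pi / 4)) / of_real ((2 * \<bar>t\<bar>) powr ((a + 1) / 2))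
        * of_real ((x * y / (2 * \<bar>t\<bar>)) powr ((1 - a) / 2) * besselJ ((a - 1) / 2) (x * y / (2 * \<bar>t\<bar>)))
        * exp (\<i> * of_real ((x\<^sup>2 + y\<^sup>2) / (4 * \<bar>t\<bar>)))
      else
        exp (\<i> * of_real ((a + 1) * pi / 4)) / of_real ((2 * \<bar>t\<bar>) powr ((a + 1) / 2))
        * of_real ((x * y / (2 * \<bar>t\<bar>)) powr ((1 - a) / 2) * besselJ ((a - 1) / 2) (x * y / (2 * \<bar>t\<bar>)))
        * exp (- \<i> * of_real ((x\<^sup>2 + y\<^sup>2) / (4 * \<bar>t\<bar>))))"

definition Sop :: "real \<Rightarrow> real \<Rightarrow> (real \<Rightarrow> complex) \<Rightarrow> real \<Rightarrow> complex" where
  "Sop a t \<phi> x = (if t = 0 then \<phi> x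
     else (LINT y:{0<..}|lborel. Sker a x y t * \<phi> y * of_real (y powr a)))"

definition Top :: "real \<Rightarrow> (real \<Rightarrow> real \<Rightarrow> complex) \<Rightarrow> real \<Rightarrow> complex" where
  "Top a F x = (LINT t|lborel. Sop a (- t) (\<lambda>y. F y t) x)"

text \<open>Powers on [0,infty] (infty^p = infty), for p > 0.\<close>
definition enn_powr :: "ennreal \<Rightarrow> real \<Rightarrow> ennreal" where
  "enn_powr u p = (if u = \<infinity> then \<infinity> else ennreal (enn2real u powr p))"

definition wLnorm :: "real \<Rightarrow> real \<Rightarrow> (real \<Rightarrow> complex) \<Rightarrow> ennreal" where
  "wLnorm a r u = enn_powr (\<integral>\<^sup>+ x\<in>{0<..}. ennreal (norm (u x) powr r * x powr a) \<partial>lborel) (1 / r)"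

definition mixnorm :: "real \<Rightarrow> real \<Rightarrow> real \<Rightarrow> (real \<Rightarrow> real \<Rightarrow> complex) \<Rightarrow> ennreal" where
  "mixnorm a q r F = enn_powr (\<integral>\<^sup>+ t. enn_powr (wLnorm a r (\<lambda>x. F x t)) q \<partial>lborel) (1 / q)"

definition conj_exp :: "real \<Rightarrow> real" where
  "conj_exp p = p / (p - 1)"

definition admissible :: "real \<Rightarrow> real \<Rightarrow> real \<Rightarrow> bool" where
  "admissible a q r \<longleftrightarrow> r > 2 \<and> (a > 1 \<longrightarrow> r < 2 * (a + 1) / (a - 1))
     \<and> 2 / q = (a + 1) * (1 / 2 - 1 / r)"

definition pd :: "bool \<Rightarrow> (real \<times> real \<Rightarrow> complex) \<Rightarrow> real \<times> real \<Rightarrow> complex" where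
  "pd d G p = (if d then vector_derivative (\<lambda>s. G (s, snd p)) (at (fst p))
               else vector_derivative (\<lambda>s. G (fst p, s)) (at (snd p)))"

fun iter_pd :: "bool list \<Rightarrow> (real \<times> real \<Rightarrow> complex) \<Rightarrow> real \<times> real \<Rightarrow> complex" where
  "iter_pd [] G = G"
| "iter_pd (d # ds) G = pd d (iter_pd ds G)"

definition C_infty_on :: "(real \<times> real) set \<Rightarrow> (real \<times> real \<Rightarrow> complex) \<Rightarrow> bool" where
  "C_infty_on U G \<longleftrightarrow> (\<forall>ds. continuous_on U (iter_pd ds G)
     \<and> (\<forall>p\<in>U. (\<lambda>s. iter_pd ds G (s, snd p)) differentiable (at (fst p))
              \<and> (\<lambda>s. iter_pd ds G (fst p, s)) differentiable (at (snd p))))"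

definition Dxw :: "(real \<times> real \<Rightarrow> complex) \<Rightarrow> real \<times> real \<Rightarrow> complex" where
  "Dxw G p = (1 / fst p) *\<^sub>R pd True G p"

definition Splus :: "(real \<Rightarrow> real \<Rightarrow> complex) set" where
  "Splus = {F. C_infty_on ({0<..} \<times> UNIV) (case_prod F) \<and>
     (\<forall>p::nat. \<exists>M. \<forall>k l. k + l \<le> p \<longrightarrow> (\<forall>x>0. \<forall>t.
        (1 + x\<^sup>2 + t\<^sup>2) powr (real p / 2) * norm ((Dxw ^^ k) ((pd False ^^ l) (case_prod F)) (x, t)) \<le> M))}"

end

theory Submission
  imports Defs
begin

text \<open>By the \<open>TT\<^sup>*\<close> method, \<open>\<parallel>T\<^sub>a F\<parallel>\<^sup>2\<close> is the double time integral of the pairings of \<open>S\<^sub>a(-t) F(t)\<close> and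
  \<open>S\<^sub>a(-\<tau>) F(\<tau>)\<close>, that is of \<open>F(t)\<close> and \<open>S\<^sub>a(t-\<tau>) F(\<tau>)\<close>. The latter are bounded by interpolating the \<open>L\<^sup>2\<close> bound
  with the dispersive bound \<open>|S\<^sub>a(x,y,t)| \<le> K |t| powr (-(a+1)/2)\<close> (Marcinkiewicz), and the time integrals are
  summed by the Hardy--Littlewood--Sobolev inequality with exponent \<open>2/q < 1\<close>.
  The dispersive bound comes from an energy that is monotone along the Bessel equation. Unitarity and the
  group law are read off from the explicit action of \<open>S\<^sub>a(t)\<close> on Gaussians \<open>exp(-c y\<^sup>2)\<close>, whose span is dense in
  \<open>L\<^sup>1 \<inter> L\<^sup>2\<close> by the Weierstrass theorem in the variable \<open>exp(-y\<^sup>2)\<close>.\<close>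

section \<open>The Bessel kernel\<close>

text \<open>The number \<open>s = (a + 1) / 2\<close> governs everything: the Bessel order is
  \<open>s - 1\<close>, the decay rate is \<open>|t| powr (-s)\<close>, and \<open>a \<ge> 0\<close>
  says that the order is at least -1/2, the range in which the energy is monotone. Interpolating at
  \<open>r\<close> turns the rate into \<open>s * (1 - 2/r)\<close>, which admissibility makes equal
  to \<open>2/q\<close>; the conditions on \<open>r\<close> place it strictly between 0 and 1. The
  obstacle is the group law. At a fixed time the kernel is not integrable in \<open>y\<close>
  against \<open>y powr a\<close>, so two propagators cannot be composed by exchanging kernel
  integrals. On a Gaussian every integral converges absolutely and has a closed form; what remains
  delicate is the branch of complex powers, hence the insistence on positive real parts. Since 2 < r
  < infinity lies inside the interpolation range, an argument on level sets suffices; its constant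
  blows up as r tends to 2, which is harmless for a constant that may depend on r. The working class
  of functions requires continuity on the open half-line, so that Weierstrass approximation applies
  directly; the price is that every truncation must be continuous too.\<close>

definition bphi_coeff :: "real \<Rightarrow> nat \<Rightarrow> real" where
  "bphi_coeff nu k = (-1) ^ k / (fact k * Gamma (real k + nu + 1))"

text \<open>At \<open>w = z^2 / 4\<close> this is \<open>(z/2) powr (-nu) * besselJ nu z\<close>, an
  entire function of \<open>w\<close> (the Bessel-Clifford function at \<open>-w\<close>). Dividing
  out the power removes the singularity at \<open>z = 0\<close>, and in the kernel each term of the
  series becomes an even monomial in \<open>y\<close>, whose Gaussian integral is a Gamma
  value.\<close>

definition bphi :: "real \<Rightarrow> real \<Rightarrow> real" where
  "bphi nu w = (\<Sum>k. bphi_coeff nu k * w ^ k)"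

text \<open>The functional equation of Gamma as a recursion. It drives the ratio test, and it is the
  differential equation of \<open>bphi\<close> read coefficient by coefficient.\<close>

lemma bphi_coeff_Suc:
  assumes "nu > -1"
  shows "real (Suc k) * (real k + nu + 1) * bphi_coeff nu (Suc k) = - bphi_coeff nu k"
proof -
  have pos: "real k + nu + 1 > 0" using assms by simp
  have "Gamma (real (Suc k) + nu + 1) = (real k + nu + 1) * Gamma (real k + nu + 1)"
  proof -
    have "real k + nu + 1 \<notin> \<int>\<^sub>\<le>\<^sub>0" using pos by (auto dest: nonpos_Ints_nonpos)
    from Gamma_plus1[OF this] show ?thesis by (simp add: add_ac)
  qed
  moreover have "Gamma (real k + nu + 1) > 0" using pos by (simp add: Gamma_real_pos)
  ultimately show ?thesis using pos
    by (simp add: bphi_coeff_def divide_simps)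
qed

lemma summable_bphi:
  assumes "nu > -1"
  shows "summable (\<lambda>k. bphi_coeff nu k * w ^ k)"
proof (rule summable_norm_cancel)
  \<comment> \<open>Beyond \<open>N\<close> both \<open>k \<ge> 2 * |w|\<close> and
    \<open>k + nu + 1 \<ge> 1\<close> hold, so by the recursion the ratio of consecutive terms is at
    most \<open>|w| / (k + 1) \<le> 1/2\<close>.\<close>
  define N where "N = nat \<lceil>2 * \<bar>w\<bar> + 1\<rceil> + nat \<lceil>\<bar>nu\<bar> + 1\<rceil>"
  have "summable (\<lambda>k. \<bar>bphi_coeff nu k * w ^ k\<bar>)"
  proof (rule summable_ratio_test)
    show "(1/2 :: real) < 1" by simp
    fix k assume k: "k \<ge> N"
    have k1: "real k \<ge> 2 * \<bar>w\<bar>" "real k \<ge> \<bar>nu\<bar>" using k unfolding N_def by linarith+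
    have p: "real k + nu + 1 \<ge> 1" using k1 by linarith
    have "real (Suc k) * (real k + nu + 1) * \<bar>bphi_coeff nu (Suc k)\<bar> = \<bar>bphi_coeff nu k\<bar>"
      using arg_cong[OF bphi_coeff_Suc[OF assms, of k], of abs] p
      by (simp add: abs_mult)
    hence "\<bar>bphi_coeff nu k\<bar> \<ge> real (Suc k) * 1 * \<bar>bphi_coeff nu (Suc k)\<bar>"
      using mult_right_mono[OF mult_left_mono[OF p, of "real (Suc k)"], of "\<bar>bphi_coeff nu (Suc k)\<bar>"]
      by simp
    moreover have "2 * \<bar>w\<bar> * \<bar>bphi_coeff nu (Suc k)\<bar> \<le> real (Suc k) * \<bar>bphi_coeff nu (Suc k)\<bar>"
      using k1 by (intro mult_right_mono) auto
    ultimately have "2 * \<bar>w\<bar> * \<bar>bphi_coeff nu (Suc k)\<bar> \<le> \<bar>bphi_coeff nu k\<bar>" by simp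
    hence "2 * \<bar>w\<bar> * \<bar>bphi_coeff nu (Suc k)\<bar> * \<bar>w\<bar>^k \<le> \<bar>bphi_coeff nu k\<bar> * \<bar>w\<bar>^k"
      by (intro mult_right_mono) auto
    thus "norm \<bar>bphi_coeff nu (Suc k) * w ^ Suc k\<bar> \<le> 1/2 * norm \<bar>bphi_coeff nu k * w ^ k\<bar>"
      by (simp add: abs_mult power_abs mult_ac)
  qed
  thus "summable (\<lambda>k. norm (bphi_coeff nu k * w ^ k))" by simp
qed

lemma bphi_0: "bphi nu 0 = 1 / Gamma (nu + 1)"
  using suminf_finite[of "{0}" "\<lambda>k. bphi_coeff nu k * 0 ^ k"] 
  by (simp add: bphi_def bphi_coeff_def)

text \<open>The function \<open>\<phi>(w) = \<Sum> (-w)^k / (k! \<Gamma>(k+\<nu>+1))\<close> solves \<open>w\<phi>'' + (\<nu>+1)\<phi>' + \<phi> = 0\<close>, so the energy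
  \<open>w\<phi>'\<^sup>2 + \<phi>\<^sup>2\<close> has derivative \<open>-(2\<nu>+1)\<phi>'\<^sup>2\<close>, which is nonpositive exactly when \<open>\<nu> \<ge> -1/2\<close>.\<close>
lemma bphi_bound:
  assumes nu: "nu \<ge> -1/2" and w: "w \<ge> 0"
  shows "\<bar>bphi nu w\<bar> \<le> 1 / Gamma (nu + 1)"
proof -
  have nu1: "nu > -1" using nu by simp
  define c where "c = bphi_coeff nu"
  define f1 where "f1 = (\<lambda>x. \<Sum>k. diffs c k * x ^ k)"
  define f2 where "f2 = (\<lambda>x. \<Sum>k. diffs (diffs c) k * x ^ k)"
  have s0: "summable (\<lambda>k. c k * x ^ k)" for x using summable_bphi[OF nu1] by (simp add: c_def)
  have s1: "summable (\<lambda>k. diffs c k * x ^ k)" for x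
    by (rule termdiff_converges_all) (use s0 in auto)
  have s2: "summable (\<lambda>k. diffs (diffs c) k * x ^ k)" for x
    by (rule termdiff_converges_all) (use s1 in auto)
  have d0: "(bphi nu has_real_derivative f1 x) (at x)" for x
    unfolding bphi_def f1_def c_def[symmetric]
    by (rule termdiffs_strong_converges_everywhere) (use s0 in auto)
  have d1: "(f1 has_real_derivative f2 x) (at x)" for x
    unfolding f1_def f2_def
    by (rule termdiffs_strong_converges_everywhere) (use s1 in auto)
  have ode: "x * f2 x + (nu + 1) * f1 x + bphi nu x = 0" for x
  proof -
    have "(\<lambda>k. diffs (diffs c) k * x ^ k) sums f2 x" using s2 by (simp add: f2_def summable_sums)
    hence "(\<lambda>k. x * (diffs (diffs c) k * x ^ k)) sums (x * f2 x)" by (rule sums_mult)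
    hence "(\<lambda>k. real (Suc k) * diffs c (Suc k) * x ^ Suc k) sums (x * f2 x)"
      by (simp add: diffs_def mult_ac)
    hence A: "(\<lambda>k. real k * diffs c k * x ^ k) sums (x * f2 x)"
      by (subst (asm) sums_Suc_iff) simp
    have B: "(\<lambda>k. (nu + 1) * (diffs c k * x ^ k)) sums ((nu + 1) * f1 x)"
      using s1 by (intro sums_mult) (simp add: f1_def summable_sums)
    have C: "(\<lambda>k. c k * x ^ k) sums bphi nu x"
      using s0 by (simp add: bphi_def c_def summable_sums)
    have "(\<lambda>k. real k * diffs c k * x ^ k + (nu + 1) * (diffs c k * x ^ k) + c k * x ^ k)
            sums (x * f2 x + (nu + 1) * f1 x + bphi nu x)"
      by (intro sums_add A B C)
    moreover have "real k * diffs c k * x ^ k + (nu + 1) * (diffs c k * x ^ k) + c k * x ^ k = 0" for k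
    proof -
      have "real k * diffs c k * x ^ k + (nu + 1) * (diffs c k * x ^ k) + c k * x ^ k
          = (real (Suc k) * (real k + nu + 1) * c (Suc k) + c k) * x ^ k"
        by (simp add: diffs_def algebra_simps)
      thus ?thesis using bphi_coeff_Suc[OF nu1, of k] by (simp add: c_def)
    qed
    ultimately show ?thesis by (simp add: sums_iff)
  qed
  define E where "E = (\<lambda>x. x * (f1 x)\<^sup>2 + (bphi nu x)\<^sup>2)"
  have "E w \<le> E 0"
  proof (rule DERIV_nonpos_imp_nonincreasing[OF w])
    fix x :: real assume "0 \<le> x"
    have "(E has_real_derivative ((f1 x)\<^sup>2 + x * (2 * f1 x * f2 x) + 2 * bphi nu x * f1 x)) (at x)"
      unfolding E_def by (rule derivative_eq_intros d0 d1 refl | simp)+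
    moreover have "(f1 x)\<^sup>2 + x * (2 * f1 x * f2 x) + 2 * bphi nu x * f1 x = - (2 * nu + 1) * (f1 x)\<^sup>2"
      using ode[of x] by algebra
    moreover have "- (2 * nu + 1) * (f1 x)\<^sup>2 \<le> 0"
      using nu by (intro mult_nonpos_nonneg) auto
    ultimately show "\<exists>y. (E has_real_derivative y) (at x) \<and> y \<le> 0" by metis
  qed
  hence "(bphi nu w)\<^sup>2 \<le> (1 / Gamma (nu + 1))\<^sup>2"
    using w by (simp add: E_def bphi_0) (smt (verit) mult_nonneg_nonneg zero_le_power2)
  moreover have "1 / Gamma (nu + 1) \<ge> 0" using nu1 Gamma_real_pos[of "nu+1"] by (simp add: less_imp_le)
  ultimately show ?thesis by (simp add: abs_le_square_iff[symmetric])
qed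

lemma besselJ_bphi:
  assumes that: "nu > -1" and "z > 0"
  shows "z powr (- nu) * besselJ nu z = 2 powr (- nu) * bphi nu (z\<^sup>2 / 4)"
proof -
  have z2: "(z / 2) powr (2 * real k + nu) = (z/2) powr nu * (z\<^sup>2/4) ^ k" for k
  proof -
    have "(z/2) powr (2 * real k) = (z\<^sup>2/4) ^ k"
      using assms powr_realpow[of "z/2" "2*k"] by (simp add: power_mult power_divide)
    thus ?thesis by (simp add: powr_add)
  qed
  have "besselJ nu z = (\<Sum>k. (z/2) powr nu * (bphi_coeff nu k * (z\<^sup>2/4) ^ k))"
    unfolding besselJ_def z2 bphi_coeff_def by (simp only: mult_ac)
  also have "\<dots> = (z/2) powr nu * bphi nu (z\<^sup>2/4)"
    unfolding bphi_def by (rule suminf_mult) (rule summable_bphi[OF that])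
  finally show ?thesis using assms
    by (simp add: powr_divide powr_minus field_simps)
qed

section \<open>Complex Gaussian integrals\<close>

text \<open>A density on the whole line rather than a measure on a subspace: functions stay total
  and measurability remains plain Borel measurability. It is used mostly with the weight exponent
  written as \<open>2 * s - 1\<close>.\<close>

definition halfline_measure :: "real \<Rightarrow> real measure" where
  "halfline_measure a = density lborel (\<lambda>x. ennreal (indicator {0<..} x * x powr a))"

lemma sets_halfline [measurable_cong, simp]: "sets (halfline_measure a) = sets borel"
  and space_halfline [simp]: "space (halfline_measure a) = UNIV"
  by (simp_all add: halfline_measure_def)

lemma measurable_halfline [simp]: "borel_measurable (halfline_measure a) = borel_measurable borel"
  by (simp add: measurable_def)

lemma sigma_finite_halfline: "sigma_finite_measure (halfline_measure a)"
  unfolding halfline_measure_def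
  by (subst sigma_finite_measure.sigma_finite_iff_density_finite[OF lborel.sigma_finite_measure_axioms]) auto

lemma AE_halfline_pos: "AE x in halfline_measure a. x > 0"
  unfolding halfline_measure_def by (subst AE_density) (auto simp: indicator_def split: if_splits)

lemma nn_integral_halfline:
  assumes [measurable]: "f \<in> borel_measurable borel"
  shows "(\<integral>\<^sup>+x. f x \<partial>halfline_measure a) = (\<integral>\<^sup>+x\<in>{0<..}. f x * ennreal (x powr a) \<partial>lborel)"
  unfolding halfline_measure_def
  by (subst nn_integral_density) (auto intro!: nn_integral_cong simp: indicator_def mult.commute)

lemma integral_halfline:
  fixes f :: "real \<Rightarrow> complex"
  assumes [measurable]: "f \<in> borel_measurable borel"
  shows "(\<integral>x. f x \<partial>halfline_measure a) = (LINT x:{0<..}|lborel. f x * of_real (x powr a))"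
  unfolding halfline_measure_def set_lebesgue_integral_def
  by (subst integral_density) (auto intro!: Bochner_Integration.integral_cong simp: indicator_def scaleR_conv_of_real)

text \<open>Substitute \<open>u = c * x^2\<close> in Euler's integral for Gamma: the weight
  \<open>x powr (2 * s - 1)\<close> is the one for which \<open>x powr (2 * s - 1) dx\<close>
  becomes a multiple of \<open>u powr (s - 1) du\<close>.\<close>

lemma nn_integral_gaussian:
  fixes s c :: real
  assumes s: "s > 0" and c: "c > 0"
  shows "(\<integral>\<^sup>+x. ennreal (exp (- (c * x\<^sup>2))) \<partial>halfline_measure (2 * s - 1)) = ennreal (Gamma s / 2 * c powr (-s))"
proof -
  define g where "g = (\<lambda>u. u powr (s - 1) / exp u :: real)"
  define k where "k = (\<lambda>x. c * x\<^sup>2 :: real)"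
  have img: "k ` {0<..} = {0<..}"
  proof -
    have "u \<in> k ` {0<..}" if "u > 0" for u
      using that c by (intro image_eqI[of _ _ "sqrt (u / c)"]) (auto simp: k_def)
    thus ?thesis using c by (auto simp: k_def)
  qed
  have inj: "inj_on k {0<..}" using c by (auto simp: inj_on_def k_def power2_eq_iff)
  have deriv: "(k has_field_derivative 2 * c * x) (at x within {0<..})" for x
    unfolding k_def by (auto intro!: derivative_eq_intros)
  have gpos: "(g has_integral Gamma s) {0<..}"
    using Gamma_integral_real[OF s] unfolding g_def
    by (rule has_integral_spike_set_eq[THEN iffD1, rotated 2])
       (auto intro!: negligible_subset[OF negligible_sing[of 0]])
  have "g absolutely_integrable_on {0<..}"
    using gpos by (intro nonnegative_absolutely_integrable_1) (auto simp: g_def)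
  hence "g absolutely_integrable_on k ` {0<..} \<and> integral (k ` {0<..}) g = Gamma s"
    using gpos by (auto simp: img integral_unique)
  hence ai: "(\<lambda>x. \<bar>2 * c * x\<bar> *\<^sub>R g (k x)) absolutely_integrable_on {0<..}"
     and ie: "integral {0<..} (\<lambda>x. \<bar>2 * c * x\<bar> *\<^sub>R g (k x)) = Gamma s"
    using has_absolute_integral_change_of_variables_real[of "{0<..}" k "\<lambda>x. 2 * c * x" g "Gamma s"] deriv inj
    by auto
  have "((\<lambda>x. \<bar>2 * c * x\<bar> *\<^sub>R g (k x)) has_integral Gamma s) {0<..}"
    using ai ie by (metis has_integral_integral set_lebesgue_integral_eq_integral(1))
  hence "((\<lambda>x. (1 / (2 * c powr s)) * (\<bar>2 * c * x\<bar> *\<^sub>R g (k x))) has_integral (1 / (2 * c powr s)) * Gamma s) {0<..}"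
    by (rule has_integral_mult_right)
  also have "?this \<longleftrightarrow> ((\<lambda>x. exp (- (c * x\<^sup>2)) * x powr (2 * s - 1)) has_integral (1 / (2 * c powr s)) * Gamma s) {0<..}"
  proof (rule has_integral_cong)
    fix x :: real assume "x \<in> {0<..}"
    hence x: "x > 0" by simp
    have "(c * x\<^sup>2) powr (s - 1) = c powr s / c * (x powr (2 * s - 1) / x)"
    proof -
      have "x\<^sup>2 = x powr 2" using x by simp
      hence "(x\<^sup>2) powr (s - 1) = x powr (2 * s - 1 - 1)"
        by (simp add: powr_powr algebra_simps del: powr_numeral)
      also have "\<dots> = x powr (2 * s - 1) / x" using x by (simp only: powr_diff) simp
      finally have "(x\<^sup>2) powr (s - 1) = x powr (2 * s - 1) / x" .
      moreover have "(c * x\<^sup>2) powr (s - 1) = c powr s / c * (x\<^sup>2) powr (s - 1)"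
        using c x by (simp add: powr_mult powr_diff del: powr_numeral)
      ultimately show ?thesis by simp
    qed
    thus "(1 / (2 * c powr s)) * (\<bar>2 * c * x\<bar> *\<^sub>R g (k x)) = exp (- (c * x\<^sup>2)) * x powr (2 * s - 1)"
      using x c by (simp add: g_def k_def exp_minus field_simps)
  qed
  finally have "((\<lambda>x. if x \<in> {0<..} then exp (- (c * x\<^sup>2)) * x powr (2 * s - 1) else 0) has_integral (1 / (2 * c powr s)) * Gamma s) UNIV"
    by (subst has_integral_restrict_UNIV)
  hence "(\<integral>\<^sup>+x. ennreal (if x \<in> {0<..} then exp (- (c * x\<^sup>2)) * x powr (2 * s - 1) else 0) \<partial>lborel) = ennreal ((1 / (2 * c powr s)) * Gamma s)"
    by (intro nn_integral_has_integral_lborel) auto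
  also have "(1 / (2 * c powr s)) * Gamma s = Gamma s / 2 * c powr (-s)"
    by (simp add: powr_minus field_simps)
  also have "(\<integral>\<^sup>+x. ennreal (if x \<in> {0<..} then exp (- (c * x\<^sup>2)) * x powr (2 * s - 1) else 0) \<partial>lborel)
      = (\<integral>\<^sup>+x. ennreal (exp (- (c * x\<^sup>2))) \<partial>halfline_measure (2 * s - 1))"
    by (subst nn_integral_halfline) (auto simp: indicator_def ennreal_mult' intro!: nn_integral_cong)
  finally show ?thesis .
qed

text \<open>An even power of \<open>x\<close> is absorbed into the weight, so that Gaussian moments
  are plain Gaussian integrals with \<open>s\<close> replaced by \<open>s + k\<close>. No
  integrability is assumed, since the two integrands against Lebesgue measure coincide
  pointwise.\<close>

lemma integral_halfline_power:
  fixes f :: "real \<Rightarrow> complex"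
  assumes [measurable]: "f \<in> borel_measurable borel"
  shows "integral\<^sup>L (halfline_measure (a + 2 * real k)) f = integral\<^sup>L (halfline_measure a) (\<lambda>x. of_real (x ^ (2 * k)) * f x)"
proof -
  have eq: "(indicator {0<..} x * x powr (a + 2 * real k)) *\<^sub>R f x =
     (indicator {0<..} x * x powr a) *\<^sub>R (of_real (x ^ (2 * k)) * f x)" for x
    using powr_realpow[of x "2 * k"]
    by (auto simp: indicator_def powr_add scaleR_conv_of_real)
  show ?thesis
    unfolding halfline_measure_def by (subst (1 2) integral_density) (auto simp: eq)
qed

lemma nn_integral_power_gaussian:
  fixes s c :: real
  assumes s: "s > 0" and c: "c > 0"
  shows "(\<integral>\<^sup>+x. ennreal (x ^ (2 * k) * exp (- (c * x\<^sup>2))) \<partial>halfline_measure (2 * s - 1))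
          = ennreal (Gamma (s + real k) / 2 * c powr (- (s + real k)))"
proof -
  have "(\<integral>\<^sup>+x. ennreal (x ^ (2 * k) * exp (- (c * x\<^sup>2))) \<partial>halfline_measure (2 * s - 1))
      = (\<integral>\<^sup>+x. ennreal (exp (- (c * x\<^sup>2))) \<partial>halfline_measure (2 * (s + real k) - 1))"
  proof (subst (1 2) nn_integral_halfline)
    have "ennreal (x ^ (2 * k) * exp (- (c * x\<^sup>2))) * ennreal (x powr (2 * s - 1)) * indicator {0<..} x
        = ennreal (exp (- (c * x\<^sup>2))) * ennreal (x powr (2 * (s + real k) - 1)) * indicator {0<..} x" for x :: real
    proof (cases "x > 0")
      case True
      have "2 * (s + real k) - 1 = real (2 * k) + (2 * s - 1)" by simp
      hence "x powr (2 * (s + real k) - 1) = x ^ (2 * k) * x powr (2 * s - 1)"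
        using True by (simp only: powr_add powr_realpow)
      thus ?thesis using True by (simp add: ennreal_mult'[symmetric] mult_ac)
    qed simp
    thus "(\<integral>\<^sup>+x\<in>{0<..}. ennreal (x ^ (2 * k) * exp (- (c * x\<^sup>2))) * ennreal (x powr (2 * s - 1)) \<partial>lborel)
      = (\<integral>\<^sup>+x\<in>{0<..}. ennreal (exp (- (c * x\<^sup>2))) * ennreal (x powr (2 * (s + real k) - 1)) \<partial>lborel)"
      by simp
  qed auto
  also have "\<dots> = ennreal (Gamma (s + real k) / 2 * c powr (- (s + real k)))"
    using assms by (intro nn_integral_gaussian) auto
  finally show ?thesis .
qed

lemma
  fixes s c :: real
  assumes s: "s > 0" and c: "c > 0"
  shows integrable_power_gaussian:
      "integrable (halfline_measure (2 * s - 1)) (\<lambda>x. x ^ (2 * k) * exp (- (c * x\<^sup>2)))"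
    and integral_power_gaussian:
      "(\<integral>x. x ^ (2 * k) * exp (- (c * x\<^sup>2)) \<partial>halfline_measure (2 * s - 1))
          = Gamma (s + real k) / 2 * c powr (- (s + real k))"
proof -
  have "Gamma (s + real k) > 0" using s by (intro Gamma_real_pos) auto
  hence "0 \<le> Gamma (s + real k) / 2 * c powr (- (s + real k))" by simp
  moreover have "0 \<le> x ^ (2 * k)" for x :: real by (simp add: power_mult)
  ultimately have "integrable (halfline_measure (2 * s - 1)) (\<lambda>x. x ^ (2 * k) * exp (- (c * x\<^sup>2))) \<and> 
     (\<integral>x. x ^ (2 * k) * exp (- (c * x\<^sup>2)) \<partial>halfline_measure (2 * s - 1))
          = Gamma (s + real k) / 2 * c powr (- (s + real k))"
    using nn_integral_power_gaussian[OF assms, of k]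
    by (subst nn_integral_eq_integrable[symmetric]) auto
  thus "integrable (halfline_measure (2 * s - 1)) (\<lambda>x. x ^ (2 * k) * exp (- (c * x\<^sup>2)))"
    and "(\<integral>x. x ^ (2 * k) * exp (- (c * x\<^sup>2)) \<partial>halfline_measure (2 * s - 1))
          = Gamma (s + real k) / 2 * c powr (- (s + real k))" by auto
qed

lemma integrable_complex_gaussian:
  fixes s :: real and w :: complex
  assumes s: "s > 0" and w: "Re w > 0"
  shows "integrable (halfline_measure (2 * s - 1)) (\<lambda>x. of_real (x ^ (2 * k)) * exp (- (w * of_real (x\<^sup>2))))"
proof (rule Bochner_Integration.integrable_bound[OF integrable_power_gaussian[OF s w, of k]])
  show "AE x in halfline_measure (2 * s - 1). norm (of_real (x ^ (2 * k)) * exp (- (w * of_real (x\<^sup>2)))) 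
      \<le> norm (x ^ (2 * k) * exp (- (Re w * x\<^sup>2)))"
    by (simp add: norm_mult norm_power power_mult)
qed auto

text \<open>Analytic continuation in \<open>w\<close>, carried out by a series: write
  \<open>w = c + d\<close> with \<open>c\<close> real, expand \<open>exp (- d * x^2)\<close> and
  integrate term by term. The moments assemble into the binomial series of
  \<open>(1 + d/c) powr (-s)\<close>, which delivers the principal branch directly.\<close>

lemma integral_complex_gaussian_0:
  fixes s :: real and w :: complex
  assumes s: "s > 0" and w: "Re w > 0"
  shows "(\<integral>x. exp (- (w * of_real (x\<^sup>2))) \<partial>halfline_measure (2 * s - 1))
          = of_real (Gamma s / 2) * w powr (- of_real s)"
proof -
  define M where "M = halfline_measure (2 * s - 1)"
  \<comment> \<open>Expanding about a real \<open>c > |w|\<^sup>2 / (2 Re w)\<close> suffices for every \<open>w\<close>, because then \<open>|w - c| < c\<close>.\<close>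
  define c where "c = (norm w)\<^sup>2 / Re w"
  have w0: "norm w > 0" using w by auto
  have c: "c > 0" using w w0 by (simp add: c_def)
  define d where "d = w - of_real c"
  have "(norm d)\<^sup>2 = (norm w)\<^sup>2 - 2 * c * Re w + c\<^sup>2"
    unfolding d_def cmod_power2 by (simp add: power2_eq_square algebra_simps)
  also have "\<dots> < c\<^sup>2" using w w0 by (simp add: c_def)
  finally have d: "norm d < c" using c by (rule power2_less_imp_less[OF _ less_imp_le])
  define f where "f = (\<lambda>(k::nat) (x::real). ((-d) ^ k / fact k) * of_real (x ^ (2 * k) * exp (- (c * x\<^sup>2))))"
  have Gp: "Gamma (s + real k) * c powr (- (s + real k)) = Gamma s * c powr (-s) * (pochhammer s k * (1 / c) ^ k)" for k
  proof -
    have "pochhammer s k = Gamma (s + real k) / Gamma s"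
      using s by (intro pochhammer_Gamma) (auto dest: nonpos_Ints_nonpos)
    moreover have "Gamma s > 0" using s by (rule Gamma_real_pos)
    moreover have "c powr (- (s + real k)) = c powr (-s) * (1/c) ^ k"
      using c by (simp add: powr_diff powr_realpow power_divide)
    ultimately show ?thesis by (simp add: field_simps)
  qed
  have f_int: "integrable M (f k)" for k
    unfolding f_def M_def by (intro integrable_mult_right integrable_of_real integrable_power_gaussian s c)
  have gb: "(of_real (-s) gchoose k) * z ^ k = pochhammer (of_real s) k * (- z) ^ k / fact k" for k and z :: complex
    by (simp add: gbinomial_pochhammer power_minus[of z] mult_ac)
  have f_val: "integral\<^sup>L M (f k) = of_real (Gamma s / 2 * c powr (-s)) * ((of_real (-s) gchoose k) * (d / of_real c) ^ k)" for k
  proof -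
    have "integral\<^sup>L M (f k) = ((-d) ^ k / fact k) * of_real (Gamma (s + real k) / 2 * c powr (- (s + real k)))"
      unfolding f_def M_def
      by (simp only: integral_mult_right_zero integral_complex_of_real integral_power_gaussian[OF s c])
    also have "Gamma (s + real k) / 2 * c powr (- (s + real k)) = Gamma s / 2 * c powr (-s) * (pochhammer s k * (1 / c) ^ k)"
      using Gp[of k] by simp
    finally show ?thesis
      unfolding gb by (simp add: pochhammer_of_real power_divide power_minus[of "d / of_real c"] power_minus[of d] mult_ac)
  qed
  have norm_f: "norm (f k x) = (norm d ^ k / fact k) * (x ^ (2 * k) * exp (- (c * x\<^sup>2)))" for k x
    by (simp add: f_def norm_mult norm_divide norm_power power_mult)
  have norm_int: "(\<integral>x. norm (f k x) \<partial>M) = Gamma s / 2 * c powr (-s) * (pochhammer s k * (norm d / c) ^ k / fact k)" for k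
    unfolding norm_f M_def
    by (simp only: integral_mult_right_zero integral_power_gaussian[OF s c])
       (use Gp[of k] in \<open>simp add: power_divide field_simps\<close>)
  \<comment> \<open>The integrals of the moduli form, up to a constant, the binomial series of
    \<open>(1 - |d|/c) powr (-s)\<close>, all of whose terms are nonnegative; this is where
    \<open>|d| < c\<close> is needed.\<close>
  have summ: "summable (\<lambda>k. \<integral>x. norm (f k x) \<partial>M)"
    unfolding norm_int
  proof (intro summable_mult)
    have "norm (- of_real (norm d / c) :: complex) < 1" using d c by (simp add: norm_divide)
    from sums_summable[OF gen_binomial_complex[OF this, of "of_real (-s)"]]
    have "summable (\<lambda>k. complex_of_real (pochhammer s k * (norm d / c) ^ k / fact k))"
      unfolding gb by (simp add: pochhammer_of_real)
    thus "summable (\<lambda>k. pochhammer s k * (norm d / c) ^ k / fact k)"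
      by (simp only: summable_complex_of_real)
  qed
  have f_sums: "(\<lambda>k. f k x) sums exp (- (w * of_real (x\<^sup>2)))" for x
  proof -
    have "(\<lambda>k. (- (d * of_real (x\<^sup>2))) ^ k /\<^sub>R fact k) sums exp (- (d * of_real (x\<^sup>2)))" by (rule exp_converges)
    hence "(\<lambda>k. of_real (exp (- (c * x\<^sup>2))) * ((- (d * of_real (x\<^sup>2))) ^ k /\<^sub>R fact k)) sums
        (of_real (exp (- (c * x\<^sup>2))) * exp (- (d * of_real (x\<^sup>2))))" by (rule sums_mult)
    also have "of_real (exp (- (c * x\<^sup>2))) * exp (- (d * of_real (x\<^sup>2))) = exp (- (w * of_real (x\<^sup>2)))"
      by (simp add: exp_of_real[symmetric] exp_add[symmetric] d_def algebra_simps)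
    also have "(\<lambda>k. of_real (exp (- (c * x\<^sup>2))) * ((- (d * of_real (x\<^sup>2))) ^ k /\<^sub>R fact k)) = (\<lambda>k. f k x)"
    proof
      fix k
      have "(- (d * of_real (x\<^sup>2))) ^ k = (- d) ^ k * of_real (x ^ (2 * k))"
        unfolding mult_minus_left[symmetric] power_mult_distrib by (simp add: power_mult)
      thus "of_real (exp (- (c * x\<^sup>2))) * ((- (d * of_real (x\<^sup>2))) ^ k /\<^sub>R fact k) = f k x"
        by (simp add: f_def scaleR_conv_of_real divide_inverse mult_ac)
    qed
    finally show ?thesis .
  qed
  have "summable (\<lambda>k. norm (f k x))" for x
  proof -
    have "summable (\<lambda>k. (norm d * x\<^sup>2) ^ k /\<^sub>R fact k)" by (rule summable_exp_generic)
    hence "summable (\<lambda>k. exp (- (c * x\<^sup>2)) * ((norm d * x\<^sup>2) ^ k /\<^sub>R fact k))" by (rule summable_mult)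
    thus ?thesis unfolding norm_f
      by (simp add: power_mult_distrib power_even_eq power_commutes divide_inverse mult_ac flip: power_mult)
  qed
  hence "(\<lambda>k. integral\<^sup>L M (f k)) sums (\<integral>x. (\<Sum>k. f k x) \<partial>M)"
    by (intro sums_integral f_int summ) auto
  hence 1: "(\<lambda>k. integral\<^sup>L M (f k)) sums (\<integral>x. exp (- (w * of_real (x\<^sup>2))) \<partial>M)"
    using f_sums by (simp add: sums_iff)
  have "norm (d / of_real c) < 1" using d c by (simp add: norm_divide)
  hence 2: "(\<lambda>k. integral\<^sup>L M (f k)) sums (of_real (Gamma s / 2 * c powr (-s)) * (1 + d / of_real c) powr (of_real (-s)))"
    unfolding f_val by (intro sums_mult gen_binomial_complex)
  \<comment> \<open>A positive real factor does not change the argument, so it may be moved under a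
    principal power.\<close>
  have "of_real (c powr (-s)) * (1 + d / of_real c) powr (of_real (-s)) = (of_real c * (1 + d / of_real c)) powr (of_real (-s))"
    using c by (subst powr_times_real_left) (auto simp: powr_of_real[symmetric])
  also have "of_real c * (1 + d / of_real c) = w" using c by (simp add: d_def field_simps)
  finally show ?thesis using sums_unique2[OF 1 2] by (simp add: M_def)
qed

lemma integral_complex_gaussian:
  fixes s :: real and w :: complex
  assumes s: "s > 0" and w: "Re w > 0"
  shows "(\<integral>x. of_real (x ^ (2 * k)) * exp (- (w * of_real (x\<^sup>2))) \<partial>halfline_measure (2 * s - 1))
          = of_real (Gamma (s + real k) / 2) * w powr (- of_real (s + real k))"
  using integral_complex_gaussian_0[of "s + real k" w] assms
    integral_halfline_power[of "\<lambda>x. exp (- (w * of_real (x\<^sup>2)))" "2 * s - 1" k]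
  by (simp add: algebra_simps)

section \<open>The propagator and its action on Gaussians\<close>

lemma bphi_measurable [measurable]: "bphi nu \<in> borel_measurable borel"
  unfolding bphi_def by measurable

text \<open>The two sign cases of the kernel merge through \<open>sgn t\<close> in the constant
  phase and the signed \<open>t\<close> in the quadratic phase. The Bessel factor is replaced by the
  entire function \<open>bphi\<close>, so nothing singular happens at
  \<open>x * y = 0\<close>.\<close>

definition bkernel :: "real \<Rightarrow> real \<Rightarrow> real \<Rightarrow> real \<Rightarrow> complex" where
  "bkernel s t x y = cis (- (sgn t * s * pi / 2))
     * of_real (2 powr (1 - s) / (2 * \<bar>t\<bar>) powr s * bphi (s - 1) (x\<^sup>2 * y\<^sup>2 / (16 * t\<^sup>2)))
     * cis ((x\<^sup>2 + y\<^sup>2) / (4 * t))"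

lemma bkernel_measurable [measurable]:
  assumes [measurable]: "f \<in> borel_measurable N" "g \<in> borel_measurable N" "h \<in> borel_measurable N"
  shows "(\<lambda>z. bkernel s (f z) (g z) (h z)) \<in> borel_measurable N"
  unfolding bkernel_def cis_conv_exp sgn_real_def by measurable

text \<open>For \<open>s \<ge> 1/2\<close> and \<open>t \<noteq> 0\<close> this is the maximum of
  \<open>|t| powr s\<close> times the modulus of the kernel. It is attained where
  \<open>x * y = 0\<close>, because \<open>|bphi|\<close> is largest at 0.\<close>

definition bconst :: "real \<Rightarrow> real" where
  "bconst s = 2 powr (1 - 2 * s) / Gamma s"

lemma bconst_pos: "s > 0 \<Longrightarrow> bconst s > 0"
  by (simp add: bconst_def Gamma_real_pos)

text \<open>The phases have modulus 1, and the energy bound for \<open>bphi\<close> applies because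
  its order \<open>s - 1\<close> is at least -1/2. At \<open>t = 0\<close> both sides vanish by the
  conventions for division and \<open>powr\<close>.\<close>

lemma norm_bkernel_le:
  assumes "s \<ge> 1/2"
  shows "norm (bkernel s t x y) \<le> bconst s * \<bar>t\<bar> powr (- s)"
proof -
  have "\<bar>bphi (s - 1) (x\<^sup>2 * y\<^sup>2 / (16 * t\<^sup>2))\<bar> \<le> 1 / Gamma (s - 1 + 1)"
    using assms by (intro bphi_bound) auto
  hence "2 powr (1 - s) / (2 * \<bar>t\<bar>) powr s * \<bar>bphi (s - 1) (x\<^sup>2 * y\<^sup>2 / (16 * t\<^sup>2))\<bar>
      \<le> 2 powr (1 - s) / (2 * \<bar>t\<bar>) powr s * (1 / Gamma s)"
    by (intro mult_left_mono) auto
  also have "\<dots> = bconst s * \<bar>t\<bar> powr (- s)"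
    by (simp add: bconst_def powr_mult powr_diff powr_minus powr_add[of 2 s s, symmetric] divide_simps)
  finally show ?thesis by (simp add: bkernel_def norm_mult norm_divide)
qed

lemma Sker_eq_bkernel:
  assumes a: "a \<ge> 0" and "x > 0" "y > 0" "t \<noteq> 0"
  shows "Sker a x y t = bkernel ((a + 1) / 2) t x y"
proof -
  define z where "z = x * y / (2 * \<bar>t\<bar>)"
  have z: "z > 0" using assms by (simp add: z_def)
  have "z powr (- ((a - 1) / 2)) * besselJ ((a - 1) / 2) z = 2 powr (- ((a - 1) / 2)) * bphi ((a - 1) / 2) (z\<^sup>2 / 4)"
    by (rule besselJ_bphi) (use a z in auto)
  moreover have "- ((a - 1) / 2) = (1 - a) / 2" "- ((a - 1) / 2) = 1 - (a + 1) / 2" "(a - 1) / 2 = (a + 1) / 2 - 1"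
    by (auto simp: field_simps)
  moreover have "z\<^sup>2 / 4 = x\<^sup>2 * y\<^sup>2 / (16 * t\<^sup>2)"
    by (simp add: z_def power_divide power_mult_distrib)
  ultimately have J: "z powr ((1 - a) / 2) * besselJ ((a - 1) / 2) z
      = 2 powr (1 - (a + 1) / 2) * bphi ((a + 1) / 2 - 1) (x\<^sup>2 * y\<^sup>2 / (16 * t\<^sup>2))"
    by metis
  show ?thesis
  proof (cases "t > 0")
    case True
    have 1: "- \<i> * complex_of_real ((a + 1) * pi / 4) = \<i> * complex_of_real (- (sgn t * ((a + 1) / 2) * pi / 2))"
      using True by (simp add: field_simps)
    have 2: "Sker a x y t = exp (- \<i> * of_real ((a + 1) * pi / 4)) / of_real ((2 * \<bar>t\<bar>) powr ((a + 1) / 2))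
        * of_real (z powr ((1 - a) / 2) * besselJ ((a - 1) / 2) z)
        * exp (\<i> * of_real ((x\<^sup>2 + y\<^sup>2) / (4 * t)))"
      using True by (simp add: Sker_def z_def)
    show ?thesis
      unfolding 2 1 J bkernel_def cis_conv_exp by (simp only: of_real_mult of_real_divide times_divide_eq_left times_divide_eq_right mult.assoc)
  next
    case False
    hence t: "t < 0" using assms by simp
    have 1: "\<i> * complex_of_real ((a + 1) * pi / 4) = \<i> * complex_of_real (- (sgn t * ((a + 1) / 2) * pi / 2))"
      using t by (simp add: field_simps)
    have 2: "Sker a x y t = exp (\<i> * of_real ((a + 1) * pi / 4)) / of_real ((2 * \<bar>t\<bar>) powr ((a + 1) / 2))
        * of_real (z powr ((1 - a) / 2) * besselJ ((a - 1) / 2) z)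
        * exp (\<i> * of_real ((x\<^sup>2 + y\<^sup>2) / (4 * t)))"
      using t by (simp add: Sker_def z_def)
    show ?thesis
      unfolding 2 1 J bkernel_def cis_conv_exp by (simp only: of_real_mult of_real_divide times_divide_eq_left times_divide_eq_right mult.assoc)
  qed
qed

definition bprop :: "real \<Rightarrow> real \<Rightarrow> (real \<Rightarrow> complex) \<Rightarrow> real \<Rightarrow> complex" where
  "bprop s t f x = (if t = 0 then f x else \<integral>y. bkernel s t x y * f y \<partial>halfline_measure (2 * s - 1))"

text \<open>Nothing is known of the data at \<open>y \<le> 0\<close>, so \<open>bprop\<close>
  receives the function cut off to the half-line, which is Borel on the whole line. The kernel
  integral sees only \<open>y > 0\<close>, and for \<open>t = 0\<close> the hypothesis
  \<open>x > 0\<close> makes the cut-off invisible.\<close>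

lemma Sop_eq_bprop:
  assumes a: "a \<ge> 0" and x: "x > 0" and [measurable]: "(\<lambda>y. indicator {0<..} y *\<^sub>R f y) \<in> borel_measurable borel"
  shows "Sop a t f x = bprop ((a + 1) / 2) t (\<lambda>y. indicator {0<..} y *\<^sub>R f y) x"
proof -
  have a_eq: "2 * ((a + 1) / 2) - 1 = a" by (simp add: field_simps)
  have m: "(\<lambda>y. bkernel ((a + 1) / 2) t x y * (indicator {0<..} y *\<^sub>R f y)) \<in> borel_measurable borel"
    by measurable
  have "bprop ((a + 1) / 2) t (\<lambda>y. indicator {0<..} y *\<^sub>R f y) x = (if t = 0 then f x else
      \<integral>y. indicator {0<..} y *\<^sub>R ((bkernel ((a + 1) / 2) t x y * (indicator {0<..} y *\<^sub>R f y)) * of_real (y powr a)) \<partial>lborel)"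
    using x integral_halfline[OF m, of a]
    unfolding bprop_def a_eq by (simp add: set_lebesgue_integral_def)
  also have "\<dots> = Sop a t f x"
    unfolding Sop_def set_lebesgue_integral_def
    by (intro if_cong refl Bochner_Integration.integral_cong)
       (auto simp: Sker_eq_bkernel[OF a x] split: split_indicator)
  finally show ?thesis ..
qed

lemma integrable_bkernel_mult:
  assumes s: "s \<ge> 1/2" and f: "integrable (halfline_measure (2 * s - 1)) f"
  shows "integrable (halfline_measure (2 * s - 1)) (\<lambda>y. bkernel s t x y * f y)"
proof -
  have [measurable]: "f \<in> borel_measurable borel" using borel_measurable_integrable[OF f] by simp
  show ?thesis
  proof (rule Bochner_Integration.integrable_bound)
    show "integrable (halfline_measure (2 * s - 1)) (\<lambda>y. bconst s * \<bar>t\<bar> powr (- s) * norm (f y))"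
      by (intro integrable_mult_right integrable_norm f)
    show "AE y in halfline_measure (2 * s - 1). norm (bkernel s t x y * f y) \<le> norm (bconst s * \<bar>t\<bar> powr (- s) * norm (f y))"
      using norm_bkernel_le[OF s] bconst_pos[of s] s
      by (intro AE_I2) (auto simp: norm_mult abs_mult intro!: mult_right_mono)
  qed auto
qed

lemma bprop_add:
  assumes "s \<ge> 1/2" "integrable (halfline_measure (2 * s - 1)) f" "integrable (halfline_measure (2 * s - 1)) g"
  shows "bprop s t (\<lambda>y. f y + g y) x = bprop s t f x + bprop s t g x"
  using integrable_bkernel_mult[OF assms(1,2)] integrable_bkernel_mult[OF assms(1,3)]
  by (simp add: bprop_def distrib_left)

lemma bprop_cmult: "bprop s t (\<lambda>y. c * f y) x = c * bprop s t f x"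
  by (simp add: bprop_def mult.left_commute[of _ c])

lemma bprop_diff:
  assumes "s \<ge> 1/2" "integrable (halfline_measure (2 * s - 1)) f" "integrable (halfline_measure (2 * s - 1)) g"
  shows "bprop s t (\<lambda>y. f y - g y) x = bprop s t f x - bprop s t g x"
  using integrable_bkernel_mult[OF assms(1,2)] integrable_bkernel_mult[OF assms(1,3)]
  by (simp add: bprop_def right_diff_distrib)

lemma norm_bprop_le:
  assumes s: "s \<ge> 1/2" and t: "t \<noteq> 0" and f: "integrable (halfline_measure (2 * s - 1)) f"
  shows "norm (bprop s t f x) \<le> bconst s * \<bar>t\<bar> powr (- s) * (\<integral>y. norm (f y) \<partial>halfline_measure (2 * s - 1))"
proof -
  have "norm (bprop s t f x) \<le> (\<integral>y. norm (bkernel s t x y * f y) \<partial>halfline_measure (2 * s - 1))"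
    using t by (simp add: bprop_def)
  also have "\<dots> \<le> (\<integral>y. bconst s * \<bar>t\<bar> powr (- s) * norm (f y) \<partial>halfline_measure (2 * s - 1))"
    using norm_bkernel_le[OF s]
    by (intro integral_mono integrable_norm integrable_bkernel_mult integrable_mult_right s f)
       (auto simp: norm_mult intro!: mult_right_mono)
  finally show ?thesis by simp
qed

text \<open>The time and the function acted on may both vary with the parameter; this joint
  measurability is what the Fubini arguments in time and space rest on.\<close>

lemma bprop_measurable_pair:
  fixes h :: "real \<Rightarrow> real \<Rightarrow> complex"
  assumes [measurable]: "(\<lambda>z. h (fst z) (snd z)) \<in> borel_measurable (N \<Otimes>\<^sub>M borel)"
     "k \<in> borel_measurable N"
  shows "(\<lambda>z. bprop s (k (fst z)) (h (fst z)) (snd z)) \<in> borel_measurable (N \<Otimes>\<^sub>M borel)"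
proof -
  interpret sigma_finite_measure "halfline_measure (2 * s - 1)" by (rule sigma_finite_halfline)
  have [measurable]: "(\<lambda>z. \<integral>y. bkernel s (k (fst z)) (snd z) y * h (fst z) y \<partial>halfline_measure (2 * s - 1))
     \<in> borel_measurable (N \<Otimes>\<^sub>M borel)"
  proof (rule borel_measurable_lebesgue_integral)
    have "(\<lambda>p. (fst (fst p), snd p)) \<in> ((N \<Otimes>\<^sub>M borel) \<Otimes>\<^sub>M halfline_measure (2 * s - 1)) \<rightarrow>\<^sub>M (N \<Otimes>\<^sub>M borel)"
      by measurable
    from measurable_compose[OF this assms(1)]
    have [measurable]: "(\<lambda>p. h (fst (fst p)) (snd p)) \<in> borel_measurable ((N \<Otimes>\<^sub>M borel) \<Otimes>\<^sub>M halfline_measure (2 * s - 1))"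
      by simp
    show "(\<lambda>(z, y). bkernel s (k (fst z)) (snd z) y * h (fst z) y)
      \<in> borel_measurable ((N \<Otimes>\<^sub>M borel) \<Otimes>\<^sub>M halfline_measure (2 * s - 1))"
      unfolding split_beta by measurable
  qed
  show ?thesis unfolding bprop_def by measurable
qed

lemma bprop_measurable [measurable]:
  assumes [measurable]: "f \<in> borel_measurable borel"
  shows "bprop s t f \<in> borel_measurable borel"
proof -
  have "(\<lambda>z. bprop s t f (snd z)) \<in> borel_measurable ((borel :: real measure) \<Otimes>\<^sub>M borel)"
    using bprop_measurable_pair[of "\<lambda>_. f" borel "\<lambda>_. t" s] by simp
  from measurable_compose[OF _ this, of "\<lambda>x. (0, x)" borel] show ?thesis by simp
qed

text \<open>The two bases are related by \<open>P = A * E * Q\<close> with all four numbers in the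
  right half-plane. Their logarithms satisfy the additive relation up to
  \<open>2 * pi * n * \<i>\<close>, and four arguments of modulus below \<open>pi / 2\<close> force
  \<open>n = 0\<close>.\<close>

lemma powr_Re_pos_mult:
  assumes A: "Re A > 0" and E: "Re E > 0" and b: "b > 0" and c: "c > 0"
    and P: "Re (of_real b * E + of_real c * A) > 0"
  shows "A powr z * E powr z * (of_real b / A + of_real c / E) powr z = (of_real b * E + of_real c * A) powr z"
proof -
  let ?Q = "of_real b / A + of_real c / E" and ?P = "of_real b * E + of_real c * A"
  have nz: "A \<noteq> 0" "E \<noteq> 0" "?P \<noteq> 0" using A E P by fastforce+
  have Q: "Re ?Q > 0" using A E b c nz
    by (simp add: Re_divide) (simp add: add_pos_pos sum_power2_gt_zero_iff complex_neq_0[symmetric] complex_eq_iff)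
  hence Qnz: "?Q \<noteq> 0" by (metis less_irrefl zero_complex.sel(1))
  have "?P = A * E * ?Q" using nz by (simp add: field_simps)
  hence "exp (Ln A + Ln E + Ln ?Q) = exp (Ln ?P)" using nz Qnz by (simp add: exp_add)
  then obtain n :: int where n: "Ln A + Ln E + Ln ?Q = Ln ?P + (of_int (2 * n) * pi) * \<i>"
    by (auto simp: exp_eq)
  have "\<bar>Im (Ln A)\<bar> < pi / 2" "\<bar>Im (Ln E)\<bar> < pi / 2" "\<bar>Im (Ln ?Q)\<bar> < pi / 2" "\<bar>Im (Ln ?P)\<bar> < pi / 2"
    using A E Q P by (blast intro: Re_Ln_pos_lt_imp)+
  moreover have "Im (Ln A) + Im (Ln E) + Im (Ln ?Q) = Im (Ln ?P) + 2 * of_int n * pi"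
    using arg_cong[OF n, of Im] by simp
  ultimately have "\<bar>2 * of_int n * pi\<bar> < 2 * pi" by linarith
  hence "\<bar>of_int n :: real\<bar> < 1" by (simp add: abs_mult)
  hence "n = 0" by linarith
  hence "Ln A + Ln E + Ln ?Q = Ln ?P" using n by simp
  hence "exp (z * (Ln A + Ln E + Ln ?Q)) = exp (z * Ln ?P)" by simp
  thus ?thesis using nz Qnz by (simp add: powr_def distrib_left exp_add)
qed

text \<open>The constant phase of the kernel undoes a quarter turn. The argument of \<open>z\<close>
  is below \<open>pi / 2\<close> in modulus, so after the turn it is still within the principal
  range and the branch does not jump.\<close>

lemma powr_rotate:
  assumes z: "Re z > 0" and \<sigma>: "\<sigma> = 1 \<or> \<sigma> = (-1::real)"
  shows "cis (- (\<sigma> * s * pi / 2)) * (- \<i> * of_real \<sigma> * z) powr (- of_real s) = z powr (- of_real s)"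
proof -
  have nz: "z \<noteq> 0" using z by auto
  have im: "\<bar>Im (Ln z)\<bar> < pi / 2" using z by (rule Re_Ln_pos_lt_imp)
  have "Ln (- \<i> * of_real \<sigma> * z) = Ln z - \<i> * of_real (\<sigma> * pi / 2)"
  proof (rule Ln_unique)
    show "exp (Ln z - \<i> * of_real (\<sigma> * pi / 2)) = - \<i> * of_real \<sigma> * z"
    proof -
      have "exp (Ln z - \<i> * of_real (\<sigma> * pi / 2)) = z * exp (\<i> * of_real (- (\<sigma> * pi / 2)))"
        using exp_add[of "Ln z" "\<i> * of_real (- (\<sigma> * pi / 2))"] nz by simp
      also have "exp (\<i> * of_real (- (\<sigma> * pi / 2))) = - \<i> * of_real \<sigma>"
        unfolding cis_conv_exp[symmetric] using \<sigma> by (auto simp: complex_eq_iff)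
      finally show ?thesis by (simp add: mult_ac)
    qed
  next
    have "Im (Ln z - \<i> * of_real (\<sigma> * pi / 2)) = Im (Ln z) - \<sigma> * pi / 2" by simp
    moreover have "\<bar>\<sigma> * pi / 2\<bar> = pi / 2" using \<sigma> by auto
    ultimately show "- pi < Im (Ln z - \<i> * of_real (\<sigma> * pi / 2))" "Im (Ln z - \<i> * of_real (\<sigma> * pi / 2)) \<le> pi"
      using im by linarith+
  qed
  moreover have "- \<i> * of_real \<sigma> * z \<noteq> 0" using nz \<sigma> by auto
  ultimately have "(- \<i> * of_real \<sigma> * z) powr (- of_real s) = exp (- of_real s * (Ln z - \<i> * of_real (\<sigma> * pi / 2)))"
    by (simp only: powr_def if_False)
  also have "- of_real s * (Ln z - \<i> * of_real (\<sigma> * pi / 2)) = - of_real s * Ln z + \<i> * of_real (\<sigma> * s * pi / 2)"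
    by (simp add: algebra_simps)
  also have "exp \<dots> = z powr (- of_real s) * cis (\<sigma> * s * pi / 2)"
    using nz by (simp only: powr_def exp_add cis_conv_exp if_False)
  finally show ?thesis by (simp add: cis_mult)
qed

text \<open>For \<open>t \<noteq> 0\<close> this is Weber's exponential integral: expand
  \<open>bphi\<close> in powers of \<open>y^2\<close> and integrate against a complex Gaussian. The
  Gamma values cancel those in the coefficients of \<open>bphi\<close>, leaving an exponential
  series. The image is again a Gaussian, of complex width
  \<open>c / (1 + 4 * \<i> * t * c)\<close>.\<close>

lemma bprop_gaussian:
  assumes s: "s \<ge> 1/2" and c: "c > 0"
  shows "bprop s t (\<lambda>y. of_real (exp (- (c * y\<^sup>2)))) x
     = (1 + 4 * \<i> * of_real (t * c)) powr (- of_real s) * exp (- (of_real c / (1 + 4 * \<i> * of_real (t * c)) * of_real (x\<^sup>2)))"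
proof (cases "t = 0")
  case True
  thus ?thesis by (simp add: bprop_def flip: exp_of_real)
next
  case t: False
  define M where "M = halfline_measure (2 * s - 1)"
  \<comment> \<open>The width of the Gaussian after absorbing the \<open>y\<close>-part of the
    kernel's quadratic phase.\<close>
  define w where "w = of_real c - \<i> / of_real (4 * t)"
  define z where "z = 1 + 4 * \<i> * of_real (t * c)"
  have s0: "s > 0" using s by simp
  have w: "Re w > 0" using c by (simp add: w_def)
  have wnz: "w \<noteq> 0" using w by auto
  have znz: "z \<noteq> 0" by (auto simp: z_def complex_eq_iff)
  define u where "u = x\<^sup>2 / (16 * t\<^sup>2)"
  have u: "u \<ge> 0" by (simp add: u_def)
  define g where "g = (\<lambda>k y. of_real (bphi_coeff (s - 1) k * u ^ k) * (of_real (y ^ (2 * k)) * exp (- (w * of_real (y\<^sup>2)))))"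
  have Gp: "Gamma (s + real k) > 0" for k using s0 by (intro Gamma_real_pos) auto
  have co: "bphi_coeff (s - 1) k * Gamma (s + real k) = (-1) ^ k / fact k" for k
    using Gp[of k] by (simp add: bphi_coeff_def add_ac)
  have abs_co: "\<bar>bphi_coeff (s - 1) k\<bar> * Gamma (s + real k) = 1 / fact k" for k
    using arg_cong[OF co[of k], of abs] Gp[of k] by (simp add: abs_mult power_abs)
  have g_int: "integrable M (g k)" for k
    unfolding g_def M_def by (intro integrable_mult_right integrable_complex_gaussian s0 w)
  have wpow: "w powr (- of_real (s + real k)) = w powr (- of_real s) * (1 / w) ^ k" for k
    using wnz by (simp add: powr_diff power_divide powr_nat')
  have g_val: "integral\<^sup>L M (g k) = (w powr (- of_real s) / 2) * ((- (of_real u / w)) ^ k /\<^sub>R fact k)" for k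
  proof -
    have "integral\<^sup>L M (g k) = of_real (bphi_coeff (s - 1) k * u ^ k) * (of_real (Gamma (s + real k) / 2) * w powr (- of_real (s + real k)))"
      unfolding g_def M_def by (simp only: integral_mult_right_zero integral_complex_gaussian[OF s0 w])
    also have "\<dots> = of_real ((bphi_coeff (s - 1) k * Gamma (s + real k)) * u ^ k / 2) * w powr (- of_real (s + real k))"
      by simp
    also have "\<dots> = (w powr (- of_real s) / 2) * (((-1) ^ k * of_real u ^ k * (1 / w) ^ k) / fact k)"
      unfolding co wpow by (simp add: mult_ac)
    also have "(-1) ^ k * of_real u ^ k * (1 / w) ^ k = (- (of_real u / w)) ^ k"
      unfolding power_mult_distrib[symmetric] by simp
    finally show ?thesis by (simp add: scaleR_conv_of_real field_simps)
  qed
  have norm_g: "norm (g k y) = \<bar>bphi_coeff (s - 1) k\<bar> * u ^ k * (y ^ (2 * k) * exp (- (c * y\<^sup>2)))" for k y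
    using u by (simp add: g_def norm_mult norm_power abs_mult power_mult w_def)
  have norm_int: "(\<integral>y. norm (g k y) \<partial>M) = (c powr (-s) / 2) * ((u / c) ^ k /\<^sub>R fact k)" for k
  proof -
    have "(\<integral>y. norm (g k y) \<partial>M) = \<bar>bphi_coeff (s - 1) k\<bar> * u ^ k * (Gamma (s + real k) / 2 * c powr (- (s + real k)))"
      unfolding norm_g M_def by (simp only: integral_mult_right_zero integral_power_gaussian[OF s0 c])
    also have "\<dots> = (\<bar>bphi_coeff (s - 1) k\<bar> * Gamma (s + real k)) * u ^ k / 2 * c powr (- (s + real k))"
      by simp
    also have "c powr (- (s + real k)) = c powr (-s) * (1 / c) ^ k"
      using c by (simp add: powr_diff powr_realpow power_divide)
    finally show ?thesis unfolding abs_co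
      by (simp add: power_divide field_simps)
  qed
  \<comment> \<open>The integrals of the moduli are a multiple of the exponential series at
    \<open>u / c\<close>; no smallness condition is needed, unlike for the binomial series.\<close>
  have summ: "summable (\<lambda>k. \<integral>y. norm (g k y) \<partial>M)"
    unfolding norm_int by (intro summable_mult summable_exp_generic)
  have g_sums: "(\<lambda>k. g k y) sums (of_real (bphi (s - 1) (u * y\<^sup>2)) * exp (- (w * of_real (y\<^sup>2))))" for y
  proof -
    have "(\<lambda>k. bphi_coeff (s - 1) k * (u * y\<^sup>2) ^ k) sums bphi (s - 1) (u * y\<^sup>2)"
      unfolding bphi_def by (intro summable_sums summable_bphi) (use s in auto)
    hence "(\<lambda>k. of_real (bphi_coeff (s - 1) k * (u * y\<^sup>2) ^ k) * exp (- (w * of_real (y\<^sup>2)))) sums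
       (of_real (bphi (s - 1) (u * y\<^sup>2)) * exp (- (w * of_real (y\<^sup>2))))"
      by (intro sums_mult2 sums_of_real)
    also have "(\<lambda>k. of_real (bphi_coeff (s - 1) k * (u * y\<^sup>2) ^ k) * exp (- (w * of_real (y\<^sup>2)))) = (\<lambda>k. g k y)"
      by (simp add: g_def fun_eq_iff power_mult_distrib power_mult)
    finally show ?thesis .
  qed
  have "summable (\<lambda>k. norm (g k y))" for y
  proof -
    have "summable (\<lambda>k. norm (bphi_coeff (s - 1) k * (u * y\<^sup>2) ^ k))"
      by (intro abs_summable_in_conv_radius) 
         (use summable_bphi[of "s - 1"] s in \<open>simp add: conv_radius_inftyI''\<close>)
    hence "summable (\<lambda>k. norm (bphi_coeff (s - 1) k * (u * y\<^sup>2) ^ k) * exp (- (c * y\<^sup>2)))"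
      by (rule summable_mult2)
    thus ?thesis using u unfolding norm_g power_mult[of y 2] by (simp add: abs_mult power_mult_distrib mult_ac)
  qed
  hence "(\<lambda>k. integral\<^sup>L M (g k)) sums (\<integral>y. (\<Sum>k. g k y) \<partial>M)"
    by (intro sums_integral g_int summ) auto
  hence 1: "(\<lambda>k. integral\<^sup>L M (g k)) sums (\<integral>y. of_real (bphi (s - 1) (u * y\<^sup>2)) * exp (- (w * of_real (y\<^sup>2))) \<partial>M)"
    using g_sums by (simp add: sums_iff)
  have 2: "(\<lambda>k. integral\<^sup>L M (g k)) sums ((w powr (- of_real s) / 2) * exp (- (of_real u / w)))"
    unfolding g_val by (intro sums_mult exp_converges)
  note I = sums_unique2[OF 1 2]
  define K where "K = cis (- (sgn t * s * pi / 2)) * of_real (2 powr (1 - s) / (2 * \<bar>t\<bar>) powr s)"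
  have "bprop s t (\<lambda>y. of_real (exp (- (c * y\<^sup>2)))) x
      = (\<integral>y. (K * cis (x\<^sup>2 / (4 * t))) * (of_real (bphi (s - 1) (u * y\<^sup>2)) * exp (- (w * of_real (y\<^sup>2)))) \<partial>M)"
  proof -
    have "cis ((x\<^sup>2 + y\<^sup>2) / (4 * t)) * of_real (exp (- (c * y\<^sup>2))) = cis (x\<^sup>2 / (4 * t)) * exp (- (w * of_real (y\<^sup>2)))" for y
      using t unfolding cis_conv_exp exp_of_real[symmetric] exp_add[symmetric] w_def
      by (simp add: algebra_simps add_divide_distrib)
    hence "bkernel s t x y * of_real (exp (- (c * y\<^sup>2)))
       = (K * cis (x\<^sup>2 / (4 * t))) * (of_real (bphi (s - 1) (u * y\<^sup>2)) * exp (- (w * of_real (y\<^sup>2))))" for y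
      unfolding bkernel_def K_def u_def by (simp add: mult_ac)
    thus ?thesis using t by (simp add: bprop_def M_def)
  qed
  also have "\<dots> = (K * (w powr (- of_real s) / 2)) * (cis (x\<^sup>2 / (4 * t)) * exp (- (of_real u / w)))"
    unfolding integral_mult_right_zero I by simp
  also have "cis (x\<^sup>2 / (4 * t)) * exp (- (of_real u / w)) = exp (- (of_real c / z * of_real (x\<^sup>2)))"
  proof -
    \<comment> \<open>This relation between the widths before and after propagation lets the
      \<open>x\<close>-phase of the kernel and the exponential series combine into one real multiple
      of \<open>x^2\<close> over \<open>z\<close>.\<close>
    have wz: "w = - \<i> * z / of_real (4 * t)" using t by (simp add: w_def z_def field_simps)
    have "\<i> / of_real (4 * t) - 1 / (16 * of_real t ^ 2 * w) = - (of_real c / z)"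
    proof -
      have "1 / (16 * of_real t ^ 2 * w) = \<i> / (4 * of_real t * z)"
        using t znz unfolding wz by (simp add: field_simps power2_eq_square)
      moreover have "\<i> * z - \<i> = - of_real c * (4 * of_real t)" by (simp add: z_def algebra_simps)
      ultimately show ?thesis using t znz by (simp add: field_simps)
    qed
    hence "\<i> * of_real (x\<^sup>2 / (4 * t)) - of_real u / w = - (of_real c / z * of_real (x\<^sup>2))"
    proof -
      assume *: "\<i> / of_real (4 * t) - 1 / (16 * of_real t ^ 2 * w) = - (of_real c / z)"
      have "\<i> * of_real (x\<^sup>2 / (4 * t)) - of_real u / w
          = (\<i> / of_real (4 * t) - 1 / (16 * of_real t ^ 2 * w)) * of_real (x\<^sup>2)"
        by (simp add: u_def left_diff_distrib)
      thus ?thesis unfolding * by simp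
    qed
    thus ?thesis unfolding cis_conv_exp exp_add[symmetric] by simp
  qed
  also have "K * (w powr (- of_real s) / 2) = z powr (- of_real s)"
  proof -
    have "2 powr (1 - s) / (2 * \<bar>t\<bar>) powr s = 2 * (4 * \<bar>t\<bar>) powr (- s)"
    proof -
      have "(4 :: real) = 2 * 2" by simp
      hence "(4 * \<bar>t\<bar>) powr (- s) = (2 * (2 * \<bar>t\<bar>)) powr (- s)" by (simp only: mult.assoc)
      also have "\<dots> = 2 powr (- s) * (2 * \<bar>t\<bar>) powr (- s)" by (rule powr_mult)
      finally show ?thesis by (simp add: powr_diff powr_minus field_simps)
    qed
    note K_eq = this
    have "K * (w powr (- of_real s) / 2) = cis (- (sgn t * s * pi / 2)) * (of_real ((4 * \<bar>t\<bar>) powr (- s)) * w powr (- of_real s))"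
      unfolding K_def K_eq by simp
    also have "of_real ((4 * \<bar>t\<bar>) powr (- s)) * w powr (- of_real s) = (of_real (4 * \<bar>t\<bar>) * w) powr (- of_real s)"
      by (subst powr_times_real_left) (auto simp: powr_of_real[symmetric])
    \<comment> \<open>Here the power of \<open>|t|\<close> from the kernel normalises
      \<open>w\<close> to \<open>z\<close> turned by a right angle, and the constant phase of the
      kernel is exactly what removes that turn.\<close>
    also have "of_real (4 * \<bar>t\<bar>) * w = - \<i> * of_real (sgn t) * z"
    proof -
      have "of_real (4 * \<bar>t\<bar>) = of_real (sgn t) * (of_real (4 * t) :: complex)"
        by (simp add: sgn_if)
      thus ?thesis using t by (simp add: w_def z_def field_simps)
    qed
    also have "cis (- (sgn t * s * pi / 2)) * (- \<i> * of_real (sgn t) * z) powr (- of_real s) = z powr (- of_real s)"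
      by (rule powr_rotate) (use t in \<open>auto simp: z_def sgn_if\<close>)
    finally show ?thesis .
  qed
  finally show ?thesis by (simp add: z_def)
qed

section \<open>Finite linear combinations of Gaussians\<close>

inductive gspan :: "(real \<Rightarrow> complex) \<Rightarrow> bool" where
  gspan_zero: "gspan (\<lambda>_. 0)"
| gspan_step: "gspan f \<Longrightarrow> c > 0 \<Longrightarrow> gspan (\<lambda>y. f y + \<alpha> * of_real (exp (- (c * y\<^sup>2))))"

lemma gspan_add:
  assumes "gspan g" "gspan f"
  shows "gspan (\<lambda>y. f y + g y)"
  using assms
proof (induction rule: gspan.induct)
  case (gspan_step g c \<alpha>)
  from gspan.gspan_step[OF gspan_step.IH[OF gspan_step.prems] gspan_step.hyps(2), of \<alpha>]
  show ?case by (simp add: add_ac)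
qed simp

lemma gspan_cmult:
  assumes "gspan f"
  shows "gspan (\<lambda>y. k * f y)"
  using assms
proof (induction rule: gspan.induct)
  case (gspan_step f c \<alpha>)
  from gspan.gspan_step[OF gspan_step.IH gspan_step.hyps(2), of "k * \<alpha>"]
  show ?case by (simp add: algebra_simps)
qed (simp add: gspan_zero)

text \<open>A polynomial in \<open>exp (- y^2)\<close> is a combination of Gaussians of integer
  widths. The exponent \<open>Suc i\<close> excludes the constant term, which is not a
  Gaussian.\<close>

lemma gspan_poly:
  "gspan (\<lambda>y. \<Sum>i\<le>n::nat. of_real (a i) * of_real (exp (- (y\<^sup>2))) ^ Suc i)"
proof (induction n)
  case 0
  show ?case using gspan_step[OF gspan_zero, of 1 "of_real (a 0)"] by simp
next
  case (Suc n)
  have "exp (- (y\<^sup>2)) ^ Suc (Suc n) = exp (- (real (Suc (Suc n)) * y\<^sup>2))" for y :: real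
    unfolding exp_of_nat_mult[symmetric] by simp
  from this[symmetric] show ?case using gspan_step[OF Suc, of "real (Suc (Suc n))" "of_real (a (Suc n))"]
    by simp
qed

lemma gspan_continuous:
  assumes "gspan f"
  shows "continuous_on UNIV f"
  using assms by induction (auto intro!: continuous_intros)

lemma gspan_measurable: "gspan f \<Longrightarrow> f \<in> borel_measurable borel"
  by (intro borel_measurable_continuous_onI gspan_continuous)

text \<open>The slowest of the finitely many Gaussians dominates, so the smallest width serves as
  \<open>c\<close>.\<close>

lemma gspan_bound:
  assumes "gspan f"
  shows "\<exists>C c. c > 0 \<and> C \<ge> 0 \<and> (\<forall>y. norm (f y) \<le> C * exp (- (c * y\<^sup>2)))"
  using assms
proof (induction rule: gspan.induct)
  case gspan_zero
  show ?case by (rule exI[of _ 0], rule exI[of _ 1]) auto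
next
  case (gspan_step f d \<alpha>)
  then obtain C c where c: "c > 0" "C \<ge> 0" "\<And>y. norm (f y) \<le> C * exp (- (c * y\<^sup>2))" by auto
  have "norm (f y + \<alpha> * of_real (exp (- (d * y\<^sup>2)))) \<le> (C + norm \<alpha>) * exp (- (min c d * y\<^sup>2))" for y
  proof -
    have "norm (f y + \<alpha> * of_real (exp (- (d * y\<^sup>2)))) \<le> C * exp (- (c * y\<^sup>2)) + norm \<alpha> * exp (- (d * y\<^sup>2))"
      using c(3)[of y] norm_triangle_ineq[of "f y" "\<alpha> * of_real (exp (- (d * y\<^sup>2)))"]
      by (simp add: norm_mult)
    also have "\<dots> \<le> C * exp (- (min c d * y\<^sup>2)) + norm \<alpha> * exp (- (min c d * y\<^sup>2))"
      using c(2) by (intro add_mono mult_left_mono) (auto intro: mult_right_mono)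
    finally show ?thesis by (simp add: algebra_simps)
  qed
  thus ?case using c gspan_step.hyps
    by (intro exI[of _ "C + norm \<alpha>"] exI[of _ "min c d"]) auto
qed

lemma gspan_integrable:
  assumes s: "s > 0" and f: "gspan f"
  shows "integrable (halfline_measure (2 * s - 1)) f"
    and "integrable (halfline_measure (2 * s - 1)) (\<lambda>x. (norm (f x))\<^sup>2)"
proof -
  from gspan_bound[OF f] obtain C c where c: "c > 0" "C \<ge> 0" "\<And>y. norm (f y) \<le> C * exp (- (c * y\<^sup>2))" by auto
  have [measurable]: "f \<in> borel_measurable borel" using f by (rule gspan_measurable)
  have 1: "integrable (halfline_measure (2 * s - 1)) (\<lambda>x. K * exp (- (k * x\<^sup>2)))" if "k > 0" for k K
    using integrable_mult_right[OF integrable_power_gaussian[OF s that, of 0]] by simp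
  show "integrable (halfline_measure (2 * s - 1)) f"
    by (rule Bochner_Integration.integrable_bound[OF 1[OF c(1), of C]]) (use c in auto)
  have "(norm (f y))\<^sup>2 \<le> C\<^sup>2 * exp (- ((2 * c) * y\<^sup>2))" for y
  proof -
    have "(norm (f y))\<^sup>2 \<le> (C * exp (- (c * y\<^sup>2)))\<^sup>2" by (intro power_mono c) auto
    also have "\<dots> = C\<^sup>2 * exp (- ((2 * c) * y\<^sup>2))" by (simp add: power_mult_distrib exp_double[symmetric])
    finally show ?thesis .
  qed
  thus "integrable (halfline_measure (2 * s - 1)) (\<lambda>x. (norm (f x))\<^sup>2)"
    by (intro Bochner_Integration.integrable_bound[OF 1[of "2 * c" "C\<^sup>2"]]) (use c in auto)
qed

text \<open>A product of two propagated Gaussians is one Gaussian of width \<open>w\<close>, whose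
  integral contributes \<open>w powr (-s)\<close>. Together with the two prefactors this becomes a
  power of \<open>b * cnj D + c * A\<close>, and in this sum the times survive only in the cross
  term.\<close>

lemma bprop_gaussian_inner:
  assumes s: "s \<ge> 1/2" and b: "b > 0" and c: "c > 0"
  shows "has_bochner_integral (halfline_measure (2 * s - 1))
     (\<lambda>x. bprop s (- t) (\<lambda>y. of_real (exp (- (b * y\<^sup>2)))) x * cnj (bprop s (- \<tau>) (\<lambda>y. of_real (exp (- (c * y\<^sup>2)))) x))
     (of_real (Gamma s / 2) * (of_real (b + c) + 4 * \<i> * of_real (b * c * (\<tau> - t))) powr (- of_real s))"
proof -
  define A where "A = 1 + 4 * \<i> * complex_of_real (- t * b)"
  define D where "D = 1 + 4 * \<i> * complex_of_real (- \<tau> * c)"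
  define w where "w = of_real b / A + of_real c / cnj D"
  have s0: "s > 0" using s by simp
  have A: "Re A > 0" and D: "Re (cnj D) > 0" by (simp_all add: A_def D_def)
  have P: "of_real b * cnj D + of_real c * A = of_real (b + c) + 4 * \<i> * of_real (b * c * (\<tau> - t))"
    by (simp add: A_def D_def algebra_simps)
  have w: "Re w > 0" using A D b c
    by (simp add: w_def Re_divide A_def D_def)
       (rule add_pos_pos; rule divide_pos_pos; simp add: add_pos_nonneg)
  have "bprop s (- t) (\<lambda>y. of_real (exp (- (b * y\<^sup>2)))) x * cnj (bprop s (- \<tau>) (\<lambda>y. of_real (exp (- (c * y\<^sup>2)))) x)
     = (A powr (- of_real s) * cnj D powr (- of_real s)) * exp (- (w * of_real (x\<^sup>2)))" for x
  proof -
    have "cnj (D powr (- of_real s)) = cnj D powr (- of_real s)"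
      using D by (subst cnj_powr) auto
    moreover have "exp (- (w * of_real (x\<^sup>2))) = exp (- (of_real b / A * of_real (x\<^sup>2))) * cnj (exp (- (of_real c / D * of_real (x\<^sup>2))))"
      by (simp add: exp_cnj w_def exp_add[symmetric] distrib_right)
    ultimately show ?thesis
      unfolding bprop_gaussian[OF s b] bprop_gaussian[OF s c] A_def[symmetric] D_def[symmetric]
      by simp
  qed
  moreover have "has_bochner_integral (halfline_measure (2 * s - 1)) (\<lambda>x. exp (- (w * of_real (x\<^sup>2))))
      (of_real (Gamma s / 2) * w powr (- of_real s))"
    using integrable_complex_gaussian[OF s0 w, of 0] integral_complex_gaussian[OF s0 w, of 0]
    by (simp add: has_bochner_integral_iff)
  from has_bochner_integral_mult_right[OF this, of "A powr (- of_real s) * cnj D powr (- of_real s)"]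
  have "has_bochner_integral (halfline_measure (2 * s - 1)) (\<lambda>x. (A powr (- of_real s) * cnj D powr (- of_real s)) * exp (- (w * of_real (x\<^sup>2))))
      (of_real (Gamma s / 2) * (A powr (- of_real s) * cnj D powr (- of_real s) * w powr (- of_real s)))"
    by (simp add: mult_ac)
  moreover have "A powr (- of_real s) * cnj D powr (- of_real s) * w powr (- of_real s)
     = (of_real b * cnj D + of_real c * A) powr (- of_real s)"
    unfolding w_def by (rule powr_Re_pos_mult) (use A D b c in \<open>auto simp: P\<close>)
  ultimately show ?thesis by (simp add: P)
qed

text \<open>The value in \<open>bprop_gaussian_inner\<close> depends on \<open>\<tau> - t\<close> only: this replaces unitarity and the
  group law of the propagator.\<close>
lemma bprop_gspan_inner:
  assumes s: "s \<ge> 1/2" and f: "gspan f" and g: "gspan g"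
  shows "\<exists>I. has_bochner_integral (halfline_measure (2 * s - 1)) (\<lambda>x. bprop s (- t) f x * cnj (bprop s (- \<tau>) g x)) I
     \<and> has_bochner_integral (halfline_measure (2 * s - 1)) (\<lambda>x. f x * cnj (bprop s (t - \<tau>) g x)) I"
  using g
proof (induction rule: gspan.induct)
  case gspan_zero
  have "bprop s r (\<lambda>_. 0) x = 0" for r x by (simp add: bprop_def)
  thus ?case by auto
next
  case (gspan_step g c \<beta>)
  let ?M = "halfline_measure (2 * s - 1)"
  let ?e = "\<lambda>c y. complex_of_real (exp (- (c * y\<^sup>2)))"
  have s0: "s > 0" using s by simp
  have e_int: "integrable ?M (\<lambda>y. \<alpha> * ?e c y)" if "c > 0" for c \<alpha>
    using gspan_integrable(1)[OF s0 gspan.gspan_step[OF gspan.gspan_zero that, of \<alpha>]] by simp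
  \<comment> \<open>Sesquilinearity is used one Gaussian at a time: the outer induction builds up
    \<open>g\<close>, and for each new Gaussian an inner induction builds up
    \<open>f\<close>.\<close>
  have "\<exists>I. has_bochner_integral ?M (\<lambda>x. bprop s (- t) f x * cnj (bprop s (- \<tau>) (?e c) x)) I
     \<and> has_bochner_integral ?M (\<lambda>x. f x * cnj (bprop s (t - \<tau>) (?e c) x)) I"
    using f
  proof (induction rule: gspan.induct)
    case gspan_zero
    have "bprop s r (\<lambda>_. 0) x = 0" for r x by (simp add: bprop_def)
    thus ?case by auto
  next
    case (gspan_step f b \<alpha>)
    then obtain I where I: "has_bochner_integral ?M (\<lambda>x. bprop s (- t) f x * cnj (bprop s (- \<tau>) (?e c) x)) I"
      "has_bochner_integral ?M (\<lambda>x. f x * cnj (bprop s (t - \<tau>) (?e c) x)) I" by auto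
    define J where "J = of_real (Gamma s / 2) * (of_real (b + c) + 4 * \<i> * of_real (b * c * (\<tau> - t))) powr (- of_real s)"
    have J1: "has_bochner_integral ?M (\<lambda>x. bprop s (- t) (?e b) x * cnj (bprop s (- \<tau>) (?e c) x)) J"
      unfolding J_def by (rule bprop_gaussian_inner) (use s gspan_step \<open>c > 0\<close> in auto)
    \<comment> \<open>The times \<open>0\<close> and \<open>\<tau> - t\<close> have the same
      difference as \<open>t\<close> and \<open>\<tau>\<close>, and propagation by time 0 is the
      identity.\<close>
    have J2: "has_bochner_integral ?M (\<lambda>x. ?e b x * cnj (bprop s (t - \<tau>) (?e c) x)) J"
      using bprop_gaussian_inner[OF s gspan_step.hyps(2) \<open>c > 0\<close>, of 0 "\<tau> - t"]
      by (simp add: J_def bprop_def[of s 0])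
    have lin: "bprop s (- t) (\<lambda>y. f y + \<alpha> * ?e b y) x = bprop s (- t) f x + \<alpha> * bprop s (- t) (?e b) x" for x
      using bprop_add[OF s gspan_integrable(1)[OF s0 gspan_step.hyps(1)] e_int[OF gspan_step.hyps(2)]]
      by (simp add: bprop_cmult)
    have "has_bochner_integral ?M (\<lambda>x. bprop s (- t) (\<lambda>y. f y + \<alpha> * ?e b y) x * cnj (bprop s (- \<tau>) (?e c) x)) (I + \<alpha> * J)"
      using has_bochner_integral_add[OF I(1) has_bochner_integral_mult_right[OF J1, of \<alpha>]]
      unfolding lin by (simp add: algebra_simps)
    moreover have "has_bochner_integral ?M (\<lambda>x. (f x + \<alpha> * ?e b x) * cnj (bprop s (t - \<tau>) (?e c) x)) (I + \<alpha> * J)"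
      using has_bochner_integral_add[OF I(2) has_bochner_integral_mult_right[OF J2, of \<alpha>]]
      by (simp add: algebra_simps)
    ultimately show ?case by blast
  qed
  then obtain J where J: "has_bochner_integral ?M (\<lambda>x. bprop s (- t) f x * cnj (bprop s (- \<tau>) (?e c) x)) J"
     "has_bochner_integral ?M (\<lambda>x. f x * cnj (bprop s (t - \<tau>) (?e c) x)) J" by auto
  from gspan_step obtain I where I: "has_bochner_integral ?M (\<lambda>x. bprop s (- t) f x * cnj (bprop s (- \<tau>) g x)) I"
     "has_bochner_integral ?M (\<lambda>x. f x * cnj (bprop s (t - \<tau>) g x)) I" by auto
  have lin: "bprop s r (\<lambda>y. g y + \<beta> * ?e c y) x = bprop s r g x + \<beta> * bprop s r (?e c) x" for r x
    using bprop_add[OF s gspan_integrable(1)[OF s0 gspan_step.hyps(1)] e_int[OF gspan_step.hyps(2)]]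
    by (simp add: bprop_cmult)
  have "has_bochner_integral ?M (\<lambda>x. bprop s (- t) f x * cnj (bprop s (- \<tau>) (\<lambda>y. g y + \<beta> * ?e c y) x)) (I + cnj \<beta> * J)"
    using has_bochner_integral_add[OF I(1) has_bochner_integral_mult_right[OF J(1), of "cnj \<beta>"]]
    unfolding lin by (simp add: algebra_simps)
  moreover have "has_bochner_integral ?M (\<lambda>x. f x * cnj (bprop s (t - \<tau>) (\<lambda>y. g y + \<beta> * ?e c y) x)) (I + cnj \<beta> * J)"
    using has_bochner_integral_add[OF I(2) has_bochner_integral_mult_right[OF J(2), of "cnj \<beta>"]]
    unfolding lin by (simp add: algebra_simps)
  ultimately show ?case by blast
qed

section \<open>Density of Gaussians and the bound on square-integrable functions\<close>

text \<open>Integrability makes the kernel integral absolutely convergent, square integrability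
  gives the pairings a meaning, and continuity admits Weierstrass approximation. Continuity is asked
  on the open half-line only, so Borel measurability on the line is a separate clause.\<close>

definition bclass :: "real \<Rightarrow> (real \<Rightarrow> complex) \<Rightarrow> bool" where
  "bclass s f \<longleftrightarrow> continuous_on {0<..} f \<and> f \<in> borel_measurable borel
     \<and> integrable (halfline_measure (2 * s - 1)) f
     \<and> integrable (halfline_measure (2 * s - 1)) (\<lambda>x. (norm (f x))\<^sup>2)"

lemma norm_add_power2_le: "(norm (x + y))\<^sup>2 \<le> 2 * (norm x)\<^sup>2 + 2 * (norm (y :: 'a :: real_normed_vector))\<^sup>2"
proof -
  have "(norm (x + y))\<^sup>2 \<le> (norm x + norm y)\<^sup>2" by (intro power_mono norm_triangle_ineq) auto
  also have "\<dots> \<le> 2 * (norm x)\<^sup>2 + 2 * (norm y)\<^sup>2"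
    using sum_squares_bound[of "norm x" "norm y"] by (simp add: power2_sum)
  finally show ?thesis .
qed

lemma integrable_norm_power2_add:
  fixes f g :: "'a \<Rightarrow> complex"
  assumes [measurable]: "f \<in> borel_measurable M" "g \<in> borel_measurable M"
    and f: "integrable M (\<lambda>x. (norm (f x))\<^sup>2)" and g: "integrable M (\<lambda>x. (norm (g x))\<^sup>2)"
  shows "integrable M (\<lambda>x. (norm (f x + g x))\<^sup>2)"
    and "(\<integral>x. (norm (f x + g x))\<^sup>2 \<partial>M) \<le> 2 * (\<integral>x. (norm (f x))\<^sup>2 \<partial>M) + 2 * (\<integral>x. (norm (g x))\<^sup>2 \<partial>M)"
proof -
  have i: "integrable M (\<lambda>x. 2 * (norm (f x))\<^sup>2 + 2 * (norm (g x))\<^sup>2)"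
    using f g by auto
  show 1: "integrable M (\<lambda>x. (norm (f x + g x))\<^sup>2)"
    by (rule Bochner_Integration.integrable_bound[OF i]) (use norm_add_power2_le in \<open>auto simp: abs_of_nonneg\<close>)
  have "(\<integral>x. (norm (f x + g x))\<^sup>2 \<partial>M) \<le> (\<integral>x. 2 * (norm (f x))\<^sup>2 + 2 * (norm (g x))\<^sup>2 \<partial>M)"
    by (intro integral_mono 1 i norm_add_power2_le)
  thus "(\<integral>x. (norm (f x + g x))\<^sup>2 \<partial>M) \<le> 2 * (\<integral>x. (norm (f x))\<^sup>2 \<partial>M) + 2 * (\<integral>x. (norm (g x))\<^sup>2 \<partial>M)"
    using f g by simp
qed

lemma bclass_diff:
  assumes "bclass s f" "bclass s g"
  shows "bclass s (\<lambda>x. f x - g x)"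
  using assms integrable_norm_power2_add(1)[of f "halfline_measure (2 * s - 1)" "\<lambda>x. - g x"]
  by (auto simp: bclass_def intro: continuous_intros)

lemma gspan_imp_bclass: "s > 0 \<Longrightarrow> gspan f \<Longrightarrow> bclass s f"
  using gspan_integrable[of s f] gspan_continuous[of f] gspan_measurable[of f]
  by (auto simp: bclass_def intro: continuous_on_subset)

text \<open>In the variable \<open>u = exp (- y^2)\<close> write \<open>h = u * G\<close> with
  \<open>G\<close> continuous on the unit interval, and approximate \<open>G\<close> by a
  polynomial. The spare factor \<open>u\<close> makes the error a multiple of a Gaussian, hence
  small in L1 and L2 at once.\<close>

lemma gspan_uniform_approx_real:
  fixes h :: "real \<Rightarrow> real"
  assumes h: "continuous_on UNIV h" and n: "n > 0" and van: "\<And>y. y \<ge> n \<Longrightarrow> h y = 0" and e: "e > 0"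
  shows "\<exists>g. gspan g \<and> (\<forall>y>0. norm (of_real (h y) - g y) \<le> e * exp (- (y\<^sup>2)))"
proof -
  define \<delta> where "\<delta> = exp (- (n\<^sup>2))"
  have \<delta>: "\<delta> > 0" by (simp add: \<delta>_def)
  \<comment> \<open>The maximum keeps the logarithm and the quotient away from \<open>u = 0\<close>.
    For \<open>u \<le> \<delta>\<close> the argument of \<open>h\<close> is frozen at
    \<open>n\<close>, where \<open>h\<close> vanishes, so \<open>h = u * G\<close> holds there as
    well.\<close>
  define G where "G = (\<lambda>u. h (sqrt (- ln (max u \<delta>))) / max u \<delta>)"
  have mpos: "max u \<delta> > 0" for u using \<delta> by auto
  have "continuous_on {0..1} (\<lambda>u. sqrt (- ln (max u \<delta>)))"
    using mpos by (intro continuous_intros) (auto simp: less_imp_neq[symmetric])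
  from continuous_on_compose2[OF h this] have "continuous_on {0..1} (\<lambda>u. h (sqrt (- ln (max u \<delta>))))"
    by auto
  hence "continuous_on {0..1} G" unfolding G_def
    using mpos by (intro continuous_intros) (auto simp: less_imp_neq[symmetric])
  from Stone_Weierstrass_real_polynomial_function[OF compact_Icc this e]
  obtain p where p: "real_polynomial_function p" "\<And>u. u \<in> {0..1} \<Longrightarrow> \<bar>G u - p u\<bar> < e" by auto
  from p(1) obtain a N where pa: "p = (\<lambda>u. \<Sum>i\<le>N. a i * u ^ i)"
    unfolding real_polynomial_function_iff_sum by blast
  let ?g = "\<lambda>y. \<Sum>i\<le>N. complex_of_real (a i) * of_real (exp (- (y\<^sup>2))) ^ Suc i"
  have "norm (of_real (h y) - ?g y) \<le> e * exp (- (y\<^sup>2))" if y: "y > 0" for y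
  proof -
    define u where "u = exp (- (y\<^sup>2))"
    have u: "u \<in> {0..1}" "u > 0" by (auto simp: u_def)
    have "?g y = of_real (u * p u)"
      by (simp add: pa u_def sum_distrib_left mult_ac)
    moreover have "h y = u * G u"
    proof (cases "y \<le> n")
      case True
      hence "u \<ge> \<delta>" using y by (simp add: u_def \<delta>_def power_mono)
      hence "max u \<delta> = u" by simp
      thus ?thesis using u y unfolding G_def by (simp add: u_def)
    next
      case False
      hence "u \<le> \<delta>" using n by (simp add: u_def \<delta>_def power_mono)
      hence "max u \<delta> = \<delta>" by simp
      thus ?thesis using van False n by (simp add: G_def \<delta>_def)
    qed
    ultimately have "norm (of_real (h y) - ?g y) = u * \<bar>G u - p u\<bar>"
      using u by (simp add: abs_mult flip: of_real_diff right_diff_distrib of_real_mult)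
    also have "\<dots> \<le> u * e" using p(2)[OF u(1)] u by (intro mult_left_mono) auto
    finally show ?thesis by (simp add: u_def mult.commute)
  qed
  thus ?thesis using gspan_poly[of a N] by blast
qed

lemma gspan_uniform_approx:
  fixes h :: "real \<Rightarrow> complex"
  assumes h: "continuous_on UNIV h" and n: "n > 0" and van: "\<And>y. y \<ge> n \<Longrightarrow> h y = 0" and e: "e > 0"
  shows "\<exists>g. gspan g \<and> (\<forall>y>0. norm (h y - g y) \<le> e * exp (- (y\<^sup>2)))"
proof -
  have "\<exists>g. gspan g \<and> (\<forall>y>0. norm (of_real (Re (h y)) - g y) \<le> e / 2 * exp (- (y\<^sup>2)))"
    by (rule gspan_uniform_approx_real) (use assms in \<open>auto intro: continuous_intros\<close>)
  then obtain g1 where g1: "gspan g1" "\<And>y. y > 0 \<Longrightarrow> norm (of_real (Re (h y)) - g1 y) \<le> e / 2 * exp (- (y\<^sup>2))" by auto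
  have "\<exists>g. gspan g \<and> (\<forall>y>0. norm (of_real (Im (h y)) - g y) \<le> e / 2 * exp (- (y\<^sup>2)))"
    by (rule gspan_uniform_approx_real) (use assms in \<open>auto intro: continuous_intros\<close>)
  then obtain g2 where g2: "gspan g2" "\<And>y. y > 0 \<Longrightarrow> norm (of_real (Im (h y)) - g2 y) \<le> e / 2 * exp (- (y\<^sup>2))" by auto
  have "norm (h y - (g1 y + \<i> * g2 y)) \<le> e * exp (- (y\<^sup>2))" if "y > 0" for y
  proof -
    have "h y - (g1 y + \<i> * g2 y) = (of_real (Re (h y)) - g1 y) + \<i> * (of_real (Im (h y)) - g2 y)"
      using complex_eq[of "h y"] by (simp add: algebra_simps)
    also have "norm \<dots> \<le> norm (of_real (Re (h y)) - g1 y) + norm (\<i> * (of_real (Im (h y)) - g2 y))"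
      by (rule norm_triangle_ineq)
    also have "\<dots> \<le> e / 2 * exp (- (y\<^sup>2)) + e / 2 * exp (- (y\<^sup>2))"
      using g1(2)[OF that] g2(2)[OF that] by (simp add: norm_mult)
    finally show ?thesis by simp
  qed
  moreover have "gspan (\<lambda>y. g1 y + \<i> * g2 y)" by (intro gspan_add gspan_cmult g1 g2)
  ultimately show ?thesis by blast
qed

text \<open>Cutting \<open>f\<close> off near 0 and near infinity costs little by dominated
  convergence, and what is left extends continuously by 0 to the whole line, where the weighted
  uniform approximation is available.\<close>

lemma gspan_dense:
  assumes s: "s > 0" and f: "bclass s f" and e: "e > 0"
  shows "\<exists>g. gspan g \<and> (\<integral>x. norm (f x - g x) \<partial>halfline_measure (2 * s - 1)) < e
     \<and> (\<integral>x. (norm (f x - g x))\<^sup>2 \<partial>halfline_measure (2 * s - 1)) < e"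
proof -
  define M where "M = halfline_measure (2 * s - 1)"
  have M_sets [measurable_cong]: "sets M = sets borel" by (simp add: M_def)
  have fc: "continuous_on {0<..} f" and fm [measurable]: "f \<in> borel_measurable borel"
    and f1: "integrable M f" and f2: "integrable M (\<lambda>x. (norm (f x))\<^sup>2)"
    using f by (auto simp: bclass_def M_def)
  \<comment> \<open>A trapezoid: 0 for \<open>y \<le> 1/n\<close> and for \<open>y \<ge> n\<close>,
    and 1 on the interval from \<open>2/n\<close> to \<open>n - 1\<close> once \<open>n\<close> is
    large.\<close>
  define cut where "cut = (\<lambda>(n::nat) (y::real). max 0 (min 1 (min (real n * y - 1) (real n - y))))"
  have cut_cont: "continuous_on A (cut n)" for A n unfolding cut_def by (intro continuous_intros)
  have [measurable]: "cut n \<in> borel_measurable borel" for n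
    by (intro borel_measurable_continuous_onI cut_cont)
  have cut01: "0 \<le> cut n y" "cut n y \<le> 1" for n y by (auto simp: cut_def)
  define h where "h = (\<lambda>n y. of_real (cut n y) * f y)"
  have diff_le: "norm (f y - h n y) \<le> norm (f y)" for n y
  proof -
    have "f y - h n y = of_real (1 - cut n y) * f y" by (simp add: h_def algebra_simps)
    thus ?thesis using cut01[of n y] by (simp add: norm_mult mult_left_le_one_le del: of_real_diff)
  qed
  have lim: "(\<lambda>n. f y - h n y) \<longlonglongrightarrow> 0" if y: "y > 0" for y
  proof (rule tendsto_eventually)
    obtain N :: nat where N: "real N \<ge> max (2 / y) (1 + y)" using real_arch_simple by blast
    show "eventually (\<lambda>n. f y - h n y = 0) sequentially"
      using eventually_ge_at_top[of N]
    proof eventually_elim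
      case (elim n)
      hence "real n \<ge> 2 / y" "real n \<ge> 1 + y" using N by linarith+
      hence "real n * y \<ge> 2" using y by (simp add: field_simps)
      hence "cut n y = 1" using \<open>real n \<ge> 1 + y\<close> by (simp add: cut_def)
      thus ?case by (simp add: h_def)
    qed
  qed
  have AEpos: "AE y in M. y > 0" unfolding M_def by (rule AE_halfline_pos)
  have hm [measurable]: "h n \<in> borel_measurable borel" for n unfolding h_def by measurable
  have "(\<lambda>n. \<integral>y. norm (f y - h n y) \<partial>M) \<longlonglongrightarrow> (\<integral>y. 0 \<partial>M)"
  proof (rule integral_dominated_convergence[where w = "\<lambda>y. norm (f y)"])
    show "AE y in M. (\<lambda>n. norm (f y - h n y)) \<longlonglongrightarrow> 0"
      using AEpos by eventually_elim (intro tendsto_norm_zero lim)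
  qed (use f1 diff_le in auto)
  hence L1: "eventually (\<lambda>n. (\<integral>y. norm (f y - h n y) \<partial>M) < e / 4) sequentially"
    using e by (intro order_tendstoD(2)[of _ 0]) auto
  have "(\<lambda>n. \<integral>y. (norm (f y - h n y))\<^sup>2 \<partial>M) \<longlonglongrightarrow> (\<integral>y. 0 \<partial>M)"
  proof (rule integral_dominated_convergence[where w = "\<lambda>y. (norm (f y))\<^sup>2"])
    show "AE y in M. (\<lambda>n. (norm (f y - h n y))\<^sup>2) \<longlonglongrightarrow> 0"
      using AEpos
    proof eventually_elim
      case (elim y)
      from tendsto_power[OF tendsto_norm_zero[OF lim[OF elim]], of 2] show ?case by simp
    qed
    show "AE y in M. norm ((norm (f y - h n y))\<^sup>2) \<le> (norm (f y))\<^sup>2" for n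
      using diff_le by (auto intro!: AE_I2 power_mono)
  qed (use f2 in auto)
  hence L2: "eventually (\<lambda>n. (\<integral>y. (norm (f y - h n y))\<^sup>2 \<partial>M) < e / 4) sequentially"
    using e by (intro order_tendstoD(2)[of _ 0]) auto
  from eventually_conj[OF eventually_conj[OF L1 L2] eventually_gt_at_top[of 0]]
  obtain n where n1: "(\<integral>y. norm (f y - h n y) \<partial>M) < e / 4"
    and n2: "(\<integral>y. (norm (f y - h n y))\<^sup>2 \<partial>M) < e / 4" and n: "n > 0"
    using eventually_happens'[OF sequentially_bot] by blast
  have h0: "h n y = 0" if "y < 1 / real n" for y
    using that n by (simp add: h_def cut_def field_simps)
  \<comment> \<open>The function \<open>f\<close> may be arbitrary at \<open>y \<le> 0\<close>;
    continuity is glued from two overlapping open sets, on the left one of which \<open>h n\<close>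
    is identically 0.\<close>
  have hcont: "continuous_on UNIV (h n)"
  proof -
    have "continuous_on ({..<1 / real n} \<union> {0<..}) (h n)"
    proof (rule continuous_on_open_Un)
      show "continuous_on {..<1 / real n} (h n)"
        using continuous_on_cong[of "{..<1 / real n}" "{..<1 / real n}" "h n" "\<lambda>_. 0"] h0 by auto
      show "continuous_on {0<..} (h n)"
        unfolding h_def by (intro continuous_intros fc cut_cont)
    qed auto
    moreover have "{..<1 / real n} \<union> {0<..} = (UNIV :: real set)"
    proof -
      have "1 / real n > 0" using n by simp
      hence "x < 1 / real n \<or> x > 0" for x by linarith
      thus ?thesis by auto
    qed
    ultimately show ?thesis by simp
  qed
  define I where "I = (\<integral>x. exp (- (x\<^sup>2)) \<partial>M)"
  define J where "J = (\<integral>x. exp (- (2 * x\<^sup>2)) \<partial>M)"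
  have Ii: "integrable M (\<lambda>x. exp (- (x\<^sup>2)))" and Ji: "integrable M (\<lambda>x. exp (- (2 * x\<^sup>2)))"
    using integrable_power_gaussian[OF s, of 1 0] integrable_power_gaussian[OF s, of 2 0] by (auto simp: M_def)
  have I0: "I \<ge> 0" "J \<ge> 0" unfolding I_def J_def by (auto intro!: integral_nonneg_AE)
  \<comment> \<open>One constant for both norms: \<open>\<eta> \<le> 1\<close> reduces the square in
    the L2 error to \<open>\<eta>\<close>, and the summand 1 keeps the denominator positive. The
    target \<open>e / 4\<close> leaves room for the factor 2 in the quadratic triangle
    inequality.\<close>
  define \<eta> where "\<eta> = min 1 (e / (4 * (I + J + 1)))"
  have \<eta>: "\<eta> > 0" "\<eta> \<le> 1" using e I0 by (auto simp: \<eta>_def)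
  have \<eta>e: "\<eta> * (I + J + 1) \<le> e / 4"
  proof -
    have "\<eta> * (I + J + 1) \<le> e / (4 * (I + J + 1)) * (I + J + 1)"
      using I0 by (intro mult_right_mono) (auto simp: \<eta>_def)
    also have "\<dots> = e / 4" using I0 by (simp add: field_simps)
    finally show ?thesis .
  qed
  have "\<exists>g. gspan g \<and> (\<forall>y>0. norm (h n y - g y) \<le> \<eta> * exp (- (y\<^sup>2)))"
  proof (rule gspan_uniform_approx[OF hcont, of "real n"])
    show "h n y = 0" if "y \<ge> real n" for y using that by (simp add: h_def cut_def)
  qed (use n \<eta> in auto)
  then obtain g where g: "gspan g" "\<And>y. y > 0 \<Longrightarrow> norm (h n y - g y) \<le> \<eta> * exp (- (y\<^sup>2))" by auto
  have [measurable]: "g \<in> borel_measurable borel" by (rule gspan_measurable[OF g(1)])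
  have hgAE: "AE y in M. norm (h n y - g y) \<le> \<eta> * exp (- (y\<^sup>2))"
    using AEpos by eventually_elim (rule g(2))
  have hg1: "integrable M (\<lambda>x. h n x - g x)"
    by (rule Bochner_Integration.integrable_bound[OF integrable_mult_right[OF Ii, of \<eta>]])
       (use hgAE \<eta> in auto)
  have sq: "(norm (h n y - g y))\<^sup>2 \<le> \<eta>\<^sup>2 * exp (- (2 * y\<^sup>2))" if "y > 0" for y
  proof -
    have "(norm (h n y - g y))\<^sup>2 \<le> (\<eta> * exp (- (y\<^sup>2)))\<^sup>2"
      by (intro power_mono g that) auto
    also have "\<dots> = \<eta>\<^sup>2 * exp (- (2 * y\<^sup>2))" by (simp add: power_mult_distrib exp_double[symmetric])
    finally show ?thesis .
  qed
  have sqAE: "AE y in M. (norm (h n y - g y))\<^sup>2 \<le> \<eta>\<^sup>2 * exp (- (2 * y\<^sup>2))"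
    using AEpos by eventually_elim (rule sq)
  have hg2: "integrable M (\<lambda>x. (norm (h n x - g x))\<^sup>2)"
    by (rule Bochner_Integration.integrable_bound[OF integrable_mult_right[OF Ji, of "\<eta>\<^sup>2"]])
       (use sqAE in auto)
  have "(\<integral>x. norm (h n x - g x) \<partial>M) \<le> (\<integral>x. \<eta> * exp (- (x\<^sup>2)) \<partial>M)"
    using hgAE by (intro integral_mono_AE integrable_norm hg1 integrable_mult_right Ii)
  hence b1: "(\<integral>x. norm (h n x - g x) \<partial>M) \<le> \<eta> * I" by (simp add: I_def)
  have "(\<integral>x. (norm (h n x - g x))\<^sup>2 \<partial>M) \<le> (\<integral>x. \<eta>\<^sup>2 * exp (- (2 * x\<^sup>2)) \<partial>M)"
    using sqAE by (intro integral_mono_AE hg2 integrable_mult_right Ji)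
  hence "(\<integral>x. (norm (h n x - g x))\<^sup>2 \<partial>M) \<le> \<eta>\<^sup>2 * J" by (simp add: J_def)
  also have "\<dots> \<le> \<eta> * J" using \<eta> I0 by (intro mult_right_mono) (auto simp: power2_eq_square mult_left_le_one_le)
  finally have b2: "(\<integral>x. (norm (h n x - g x))\<^sup>2 \<partial>M) \<le> \<eta> * J" .
  have \<eta>IJ: "\<eta> * I \<le> e / 4" "\<eta> * J \<le> e / 4"
  proof -
    have "\<eta> * I \<le> \<eta> * (I + J + 1)" "\<eta> * J \<le> \<eta> * (I + J + 1)"
      using \<eta> I0 by (auto intro!: mult_left_mono)
    thus "\<eta> * I \<le> e / 4" "\<eta> * J \<le> e / 4" using \<eta>e by linarith+
  qed
  have fh1: "integrable M (\<lambda>x. f x - h n x)"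
    by (rule Bochner_Integration.integrable_bound[OF integrable_norm[OF f1]]) (use diff_le in auto)
  have fh2: "integrable M (\<lambda>x. (norm (f x - h n x))\<^sup>2)"
    by (rule Bochner_Integration.integrable_bound[OF f2]) (use diff_le in \<open>auto intro!: power_mono\<close>)
  have "(\<integral>x. norm (f x - g x) \<partial>M) \<le> (\<integral>x. norm (f x - h n x) + norm (h n x - g x) \<partial>M)"
  proof (rule integral_mono)
    have "integrable M (\<lambda>x. (f x - h n x) + (h n x - g x))" by (intro Bochner_Integration.integrable_add fh1 hg1)
    thus "integrable M (\<lambda>x. norm (f x - g x))" by (intro integrable_norm) simp
    show "norm (f x - g x) \<le> norm (f x - h n x) + norm (h n x - g x)" for x
      using norm_triangle_ineq[of "f x - h n x" "h n x - g x"] by simp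
  qed (intro Bochner_Integration.integrable_add integrable_norm fh1 hg1)
  also have "\<dots> = (\<integral>x. norm (f x - h n x) \<partial>M) + (\<integral>x. norm (h n x - g x) \<partial>M)"
    by (intro Bochner_Integration.integral_add integrable_norm fh1 hg1)
  also have "\<dots> < e" using n1 b1 \<eta>IJ e by linarith
  finally have A: "(\<integral>x. norm (f x - g x) \<partial>M) < e" .
  have "(\<integral>x. (norm (f x - g x))\<^sup>2 \<partial>M) \<le> 2 * (\<integral>x. (norm (f x - h n x))\<^sup>2 \<partial>M) + 2 * (\<integral>x. (norm (h n x - g x))\<^sup>2 \<partial>M)"
    using integrable_norm_power2_add(2)[OF _ _ fh2 hg2] by simp
  also have "\<dots> < e" using n2 b2 \<eta>IJ e by linarith
  finally show ?thesis using A g(1) by (auto simp: M_def)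
qed

section \<open>Cauchy--Schwarz and passage to the limit in pairings\<close>

lemma borel_measurable_cnj [measurable (raw)]:
  "f \<in> borel_measurable M \<Longrightarrow> (\<lambda>x. cnj (f x)) \<in> borel_measurable M"
  by (rule borel_measurable_continuous_on[OF continuous_on_cnj[OF continuous_on_id]])

lemma
  fixes f g :: "'a \<Rightarrow> complex"
  assumes [measurable]: "f \<in> borel_measurable M" "g \<in> borel_measurable M"
    and f: "integrable M (\<lambda>x. (norm (f x))\<^sup>2)" and g: "integrable M (\<lambda>x. (norm (g x))\<^sup>2)"
  shows integrable_norm_mult: "integrable M (\<lambda>x. norm (f x) * norm (g x))"
    and Cauchy_Schwarz_norm: "(\<integral>x. norm (f x) * norm (g x) \<partial>M)
          \<le> sqrt (\<integral>x. (norm (f x))\<^sup>2 \<partial>M) * sqrt (\<integral>x. (norm (g x))\<^sup>2 \<partial>M)"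
proof -
  show 1: "integrable M (\<lambda>x. norm (f x) * norm (g x))"
  proof (rule Bochner_Integration.integrable_bound[OF Bochner_Integration.integrable_add[OF f g]])
    have "norm (f x) * norm (g x) \<le> (norm (f x))\<^sup>2 + (norm (g x))\<^sup>2" for x
      using sum_squares_bound[of "norm (f x)" "norm (g x)"] mult_nonneg_nonneg[OF norm_ge_zero norm_ge_zero, of "f x" "g x"]
      by linarith
    thus "AE x in M. norm (norm (f x) * norm (g x)) \<le> norm ((norm (f x))\<^sup>2 + (norm (g x))\<^sup>2)"
      by (simp add: abs_mult)
  qed auto
  let ?F = "\<integral>x. (norm (f x))\<^sup>2 \<partial>M" and ?G = "\<integral>x. (norm (g x))\<^sup>2 \<partial>M"
  have nn: "?F \<ge> 0" "?G \<ge> 0" "(\<integral>x. norm (f x) * norm (g x) \<partial>M) \<ge> 0" by (auto intro!: integral_nonneg_AE)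
  have "(\<integral>\<^sup>+x. ennreal (norm (f x)) * ennreal (norm (g x)) \<partial>M)\<^sup>2
      \<le> (\<integral>\<^sup>+x. ennreal (norm (f x)) ^ 2 \<partial>M) * (\<integral>\<^sup>+x. ennreal (norm (g x)) ^ 2 \<partial>M)"
    by (rule Cauchy_Schwarz_nn_integral) auto
  hence "(\<integral>\<^sup>+x. ennreal (norm (f x) * norm (g x)) \<partial>M)\<^sup>2
      \<le> (\<integral>\<^sup>+x. ennreal ((norm (f x))\<^sup>2) \<partial>M) * (\<integral>\<^sup>+x. ennreal ((norm (g x))\<^sup>2) \<partial>M)"
    by (simp add: ennreal_mult ennreal_power)
  hence "ennreal (\<integral>x. norm (f x) * norm (g x) \<partial>M) ^ 2 \<le> ennreal ?F * ennreal ?G"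
    using 1 f g by (subst (asm) (1 2 3) nn_integral_eq_integral) auto
  hence "(\<integral>x. norm (f x) * norm (g x) \<partial>M)\<^sup>2 \<le> ?F * ?G"
    using nn by (simp add: ennreal_power flip: ennreal_mult)
  hence "sqrt ((\<integral>x. norm (f x) * norm (g x) \<partial>M)\<^sup>2) \<le> sqrt (?F * ?G)"
    by (rule real_sqrt_le_mono)
  thus "(\<integral>x. norm (f x) * norm (g x) \<partial>M) \<le> sqrt ?F * sqrt ?G"
    using nn by (simp add: real_sqrt_mult)
qed

lemma
  fixes f g :: "'a \<Rightarrow> complex"
  assumes [measurable]: "f \<in> borel_measurable M" "g \<in> borel_measurable M"
    and f: "integrable M (\<lambda>x. (norm (f x))\<^sup>2)" and g: "integrable M (\<lambda>x. (norm (g x))\<^sup>2)"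
  shows integrable_mult_cnj: "integrable M (\<lambda>x. f x * cnj (g x))"
    and Cauchy_Schwarz_cnj: "norm (\<integral>x. f x * cnj (g x) \<partial>M)
          \<le> sqrt (\<integral>x. (norm (f x))\<^sup>2 \<partial>M) * sqrt (\<integral>x. (norm (g x))\<^sup>2 \<partial>M)"
proof -
  show "integrable M (\<lambda>x. f x * cnj (g x))"
    by (rule Bochner_Integration.integrable_bound[OF integrable_norm_mult[OF assms]]) (auto simp: norm_mult)
  have "norm (\<integral>x. f x * cnj (g x) \<partial>M) \<le> (\<integral>x. norm (f x * cnj (g x)) \<partial>M)" by (rule integral_norm_bound)
  also have "\<dots> = (\<integral>x. norm (f x) * norm (g x) \<partial>M)" by (simp add: norm_mult)
  also note Cauchy_Schwarz_norm[OF assms]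
  finally show "norm (\<integral>x. f x * cnj (g x) \<partial>M)
          \<le> sqrt (\<integral>x. (norm (f x))\<^sup>2 \<partial>M) * sqrt (\<integral>x. (norm (g x))\<^sup>2 \<partial>M)" .
qed

lemma tendsto_integral_cnj:
  fixes f g :: "'a \<Rightarrow> complex" and fs gs :: "nat \<Rightarrow> 'a \<Rightarrow> complex"
  assumes [measurable]: "f \<in> borel_measurable M" "g \<in> borel_measurable M"
      "\<And>n. fs n \<in> borel_measurable M" "\<And>n. gs n \<in> borel_measurable M"
    and f: "integrable M (\<lambda>x. (norm (f x))\<^sup>2)" and g: "integrable M (\<lambda>x. (norm (g x))\<^sup>2)"
    and df: "\<And>n. integrable M (\<lambda>x. (norm (fs n x - f x))\<^sup>2)" and dg: "\<And>n. integrable M (\<lambda>x. (norm (gs n x - g x))\<^sup>2)"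
    and lf: "(\<lambda>n. \<integral>x. (norm (fs n x - f x))\<^sup>2 \<partial>M) \<longlonglongrightarrow> 0"
    and lg: "(\<lambda>n. \<integral>x. (norm (gs n x - g x))\<^sup>2 \<partial>M) \<longlonglongrightarrow> 0"
  shows "(\<lambda>n. \<integral>x. fs n x * cnj (gs n x) \<partial>M) \<longlonglongrightarrow> (\<integral>x. f x * cnj (g x) \<partial>M)"
proof -
  let ?a = "\<lambda>n. sqrt (\<integral>x. (norm (fs n x - f x))\<^sup>2 \<partial>M)" and ?b = "\<lambda>n. sqrt (\<integral>x. (norm (gs n x - g x))\<^sup>2 \<partial>M)"
  let ?F = "sqrt (\<integral>x. (norm (f x))\<^sup>2 \<partial>M)" and ?G = "sqrt (\<integral>x. (norm (g x))\<^sup>2 \<partial>M)"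
  have m: "(\<lambda>x. fs n x - f x) \<in> borel_measurable M" "(\<lambda>x. gs n x - g x) \<in> borel_measurable M" for n
    by measurable
  have eq: "(\<integral>x. fs n x * cnj (gs n x) \<partial>M) = (\<integral>x. f x * cnj (g x) \<partial>M) +
     ((\<integral>x. (fs n x - f x) * cnj (gs n x - g x) \<partial>M) + (\<integral>x. (fs n x - f x) * cnj (g x) \<partial>M) + (\<integral>x. f x * cnj (gs n x - g x) \<partial>M))" for n
  proof -
    have "(\<integral>x. fs n x * cnj (gs n x) \<partial>M) = (\<integral>x. f x * cnj (g x) + 
       ((fs n x - f x) * cnj (gs n x - g x) + (fs n x - f x) * cnj (g x) + f x * cnj (gs n x - g x)) \<partial>M)"
      by (intro Bochner_Integration.integral_cong) (auto simp: algebra_simps)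
    also have "\<dots> = (\<integral>x. f x * cnj (g x) \<partial>M) +
     ((\<integral>x. (fs n x - f x) * cnj (gs n x - g x) \<partial>M) + (\<integral>x. (fs n x - f x) * cnj (g x) \<partial>M) + (\<integral>x. f x * cnj (gs n x - g x) \<partial>M))"
      using integrable_mult_cnj[OF assms(1,2) f g] integrable_mult_cnj[OF m(1) m(2) df dg, of n n]
        integrable_mult_cnj[OF m(1) assms(2) df g, of n] integrable_mult_cnj[OF assms(1) m(2) f dg, of n]
      by (simp only: Bochner_Integration.integral_add Bochner_Integration.integrable_add)
    finally show ?thesis .
  qed
  have bound: "norm ((\<integral>x. fs n x * cnj (gs n x) \<partial>M) - (\<integral>x. f x * cnj (g x) \<partial>M)) \<le> ?a n * ?b n + ?a n * ?G + ?F * ?b n" for n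
  proof -
    have "norm ((\<integral>x. fs n x * cnj (gs n x) \<partial>M) - (\<integral>x. f x * cnj (g x) \<partial>M))
      \<le> norm (\<integral>x. (fs n x - f x) * cnj (gs n x - g x) \<partial>M) + norm (\<integral>x. (fs n x - f x) * cnj (g x) \<partial>M) + norm (\<integral>x. f x * cnj (gs n x - g x) \<partial>M)"
      unfolding eq by (simp only: add_diff_cancel_left') (intro order.trans[OF norm_triangle_ineq] add_mono norm_triangle_ineq order.refl)
    also have "\<dots> \<le> ?a n * ?b n + ?a n * ?G + ?F * ?b n"
      by (intro add_mono Cauchy_Schwarz_cnj f g df dg borel_measurable_diff assms(1-4))
    finally show ?thesis .
  qed
  have lim: "(\<lambda>n. ?a n * ?b n + ?a n * ?G + ?F * ?b n) \<longlonglongrightarrow> 0"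
  proof -
    have "?a \<longlonglongrightarrow> 0" "?b \<longlonglongrightarrow> 0" using tendsto_real_sqrt[OF lf] tendsto_real_sqrt[OF lg] by simp_all
    hence "(\<lambda>n. ?a n * ?b n + ?a n * ?G + ?F * ?b n) \<longlonglongrightarrow> 0 * 0 + 0 * ?G + ?F * 0"
      by (intro tendsto_add tendsto_mult tendsto_const)
    thus ?thesis by simp
  qed
  have "(\<lambda>n. (\<integral>x. fs n x * cnj (gs n x) \<partial>M) - (\<integral>x. f x * cnj (g x) \<partial>M)) \<longlonglongrightarrow> 0"
    by (rule Lim_null_comparison[OF _ lim], rule always_eventually, rule allI, rule bound)
  thus ?thesis by (simp add: LIM_zero_iff)
qed

text \<open>One sequence serves both norms: through the kernel bound, L1 convergence gives pointwise
  convergence of the propagated functions, while L2 convergence controls their energies.\<close>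

lemma gspan_sequence:
  assumes s: "s > 0" and f: "bclass s f"
  obtains g where "\<And>n. gspan (g n)" 
    "(\<lambda>n. \<integral>x. norm (g n x - f x) \<partial>halfline_measure (2 * s - 1)) \<longlonglongrightarrow> 0"
    "(\<lambda>n. \<integral>x. (norm (g n x - f x))\<^sup>2 \<partial>halfline_measure (2 * s - 1)) \<longlonglongrightarrow> 0"
proof -
  let ?M = "halfline_measure (2 * s - 1)"
  have "\<forall>n. \<exists>g. gspan g \<and> (\<integral>x. norm (f x - g x) \<partial>?M) < inverse (real (Suc n))
     \<and> (\<integral>x. (norm (f x - g x))\<^sup>2 \<partial>?M) < inverse (real (Suc n))"
    by (intro allI gspan_dense s f) simp
  hence "\<exists>g. \<forall>n. gspan (g n) \<and> (\<integral>x. norm (f x - g n x) \<partial>?M) < inverse (real (Suc n))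
     \<and> (\<integral>x. (norm (f x - g n x))\<^sup>2 \<partial>?M) < inverse (real (Suc n))"
    by (rule choice)
  then obtain g where g: "\<And>n. gspan (g n)" "\<And>n. (\<integral>x. norm (f x - g n x) \<partial>?M) < inverse (real (Suc n))"
     "\<And>n. (\<integral>x. (norm (f x - g n x))\<^sup>2 \<partial>?M) < inverse (real (Suc n))" by blast
  show ?thesis
  proof (rule that[of g])
    have lim0: "X \<longlonglongrightarrow> 0" if "\<And>n. 0 \<le> X n" "\<And>n. X n < inverse (real (Suc n))" for X
    proof (rule Lim_null_comparison[OF always_eventually LIMSEQ_inverse_real_of_nat], rule allI)
      fix n
      have "norm (X n) = X n" using that(1)[of n] by simp
      thus "norm (X n) \<le> inverse (real (Suc n))" using that(2)[of n] by (simp only: less_imp_le)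
    qed
    have "(\<lambda>n. \<integral>x. norm (f x - g n x) \<partial>?M) \<longlonglongrightarrow> 0"
      by (rule lim0) (rule integral_nonneg_AE, simp, rule g(2))
    thus "(\<lambda>n. \<integral>x. norm (g n x - f x) \<partial>?M) \<longlonglongrightarrow> 0" by (simp only: norm_minus_commute)
    have "(\<lambda>n. \<integral>x. (norm (f x - g n x))\<^sup>2 \<partial>?M) \<longlonglongrightarrow> 0"
      by (rule lim0) (rule integral_nonneg_AE, simp, rule g(3))
    thus "(\<lambda>n. \<integral>x. (norm (g n x - f x))\<^sup>2 \<partial>?M) \<longlonglongrightarrow> 0" by (simp only: norm_minus_commute)
  qed (rule g)
qed

text \<open>The pairing identity at equal times: the second integral then involves propagation by
  time 0, and the common value is both energies.\<close>

lemma bprop_gspan_L2: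
  assumes s: "s \<ge> 1/2" and f: "gspan f"
  shows "(\<integral>\<^sup>+x. ennreal ((norm (bprop s t f x))\<^sup>2) \<partial>halfline_measure (2 * s - 1))
      = ennreal (\<integral>x. (norm (f x))\<^sup>2 \<partial>halfline_measure (2 * s - 1))"
proof -
  let ?M = "halfline_measure (2 * s - 1)"
  from bprop_gspan_inner[OF s f f, of "- t" "- t"] obtain I
    where I: "has_bochner_integral ?M (\<lambda>x. bprop s t f x * cnj (bprop s t f x)) I"
      "has_bochner_integral ?M (\<lambda>x. f x * cnj (f x)) I" by (auto simp: bprop_def[of s 0])
  have "has_bochner_integral ?M (\<lambda>x. (norm (bprop s t f x))\<^sup>2) (Re I)"
    using has_bochner_integral_Re[OF I(1)] by (simp add: complex_mult_cnj cmod_power2 mult.commute flip: power2_eq_square)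
  moreover have "has_bochner_integral ?M (\<lambda>x. (norm (f x))\<^sup>2) (Re I)"
    using has_bochner_integral_Re[OF I(2)] by (simp add: complex_mult_cnj cmod_power2 flip: power2_eq_square)
  ultimately show ?thesis
    by (subst nn_integral_eq_integral) (auto simp: has_bochner_integral_iff)
qed

text \<open>Fatou's lemma along approximating combinations of Gaussians: for
  \<open>t \<noteq> 0\<close> the images converge pointwise, and their energies equal those of the
  approximants, which converge to the energy of \<open>f\<close>.\<close>

lemma
  assumes s: "s \<ge> 1/2" and f: "bclass s f"
  shows integrable_bprop_power2: "integrable (halfline_measure (2 * s - 1)) (\<lambda>x. (norm (bprop s t f x))\<^sup>2)"
    and bprop_L2: "(\<integral>x. (norm (bprop s t f x))\<^sup>2 \<partial>halfline_measure (2 * s - 1))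
      \<le> (\<integral>x. (norm (f x))\<^sup>2 \<partial>halfline_measure (2 * s - 1))"
proof -
  let ?M = "halfline_measure (2 * s - 1)"
  have s0: "s > 0" using s by simp
  have fm [measurable]: "f \<in> borel_measurable borel" and f1: "integrable ?M f" and f2: "integrable ?M (\<lambda>x. (norm (f x))\<^sup>2)"
    using f by (auto simp: bclass_def)
  obtain g where g: "\<And>n. gspan (g n)" 
    "(\<lambda>n. \<integral>x. norm (g n x - f x) \<partial>?M) \<longlonglongrightarrow> 0" "(\<lambda>n. \<integral>x. (norm (g n x - f x))\<^sup>2 \<partial>?M) \<longlonglongrightarrow> 0"
    using gspan_sequence[OF s0 f] by blast
  have gm [measurable]: "g n \<in> borel_measurable borel" for n by (rule gspan_measurable[OF g(1)])
  have lim: "(\<lambda>n. bprop s t (g n) x) \<longlonglongrightarrow> bprop s t f x" if t: "t \<noteq> 0" for x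
  proof -
    have "(\<lambda>n. bprop s t (g n) x - bprop s t f x) \<longlonglongrightarrow> 0"
    proof (rule Lim_null_comparison)
      show "eventually (\<lambda>n. norm (bprop s t (g n) x - bprop s t f x) \<le> bconst s * \<bar>t\<bar> powr (- s) * (\<integral>y. norm (g n y - f y) \<partial>?M)) sequentially"
        using norm_bprop_le[OF s t] gspan_integrable(1)[OF s0 g(1)] f1 
        by (intro always_eventually allI, subst bprop_diff[OF s, symmetric]) auto
      show "(\<lambda>n. bconst s * \<bar>t\<bar> powr (- s) * (\<integral>y. norm (g n y - f y) \<partial>?M)) \<longlonglongrightarrow> 0"
        using tendsto_mult_right_zero[OF g(2)] by blast
    qed
    thus ?thesis by (simp add: LIM_zero_iff)
  qed
  have l2: "(\<lambda>n. \<integral>x. (norm (g n x))\<^sup>2 \<partial>?M) \<longlonglongrightarrow> (\<integral>x. (norm (f x))\<^sup>2 \<partial>?M)"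
  proof -
    have d: "integrable ?M (\<lambda>x. (norm (g n x - f x))\<^sup>2)" for n
      using bclass_diff[OF gspan_imp_bclass[OF s0 g(1)] f] by (auto simp: bclass_def)
    have "(\<lambda>n. \<integral>x. g n x * cnj (g n x) \<partial>?M) \<longlonglongrightarrow> (\<integral>x. f x * cnj (f x) \<partial>?M)"
      by (rule tendsto_integral_cnj) (auto intro: f2 d g)
    hence "(\<lambda>n. \<integral>x. complex_of_real ((norm (g n x))\<^sup>2) \<partial>?M) \<longlonglongrightarrow> (\<integral>x. complex_of_real ((norm (f x))\<^sup>2) \<partial>?M)"
      by (simp only: complex_norm_square)
    thus ?thesis by (simp only: integral_complex_of_real tendsto_of_real_iff)
  qed
  have nn: "(\<integral>\<^sup>+x. ennreal ((norm (bprop s t f x))\<^sup>2) \<partial>?M) \<le> ennreal (\<integral>x. (norm (f x))\<^sup>2 \<partial>?M)"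
  proof (cases "t = 0")
    case True
    thus ?thesis using f2 by (simp add: bprop_def nn_integral_eq_integral)
  next
    case t: False
    have "(\<integral>\<^sup>+x. ennreal ((norm (bprop s t f x))\<^sup>2) \<partial>?M) = (\<integral>\<^sup>+x. liminf (\<lambda>n. ennreal ((norm (bprop s t (g n) x))\<^sup>2)) \<partial>?M)"
      by (intro nn_integral_cong lim_imp_Liminf[symmetric] tendsto_ennrealI tendsto_power tendsto_norm lim t) auto
    also have "\<dots> \<le> liminf (\<lambda>n. \<integral>\<^sup>+x. ennreal ((norm (bprop s t (g n) x))\<^sup>2) \<partial>?M)"
      by (rule nn_integral_liminf) auto
    also have "\<dots> = liminf (\<lambda>n. ennreal (\<integral>x. (norm (g n x))\<^sup>2 \<partial>?M))"
      by (simp only: bprop_gspan_L2[OF s g(1)])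
    also have "\<dots> = ennreal (\<integral>x. (norm (f x))\<^sup>2 \<partial>?M)"
      by (intro lim_imp_Liminf tendsto_ennrealI l2) auto
    finally show ?thesis .
  qed
  show 1: "integrable ?M (\<lambda>x. (norm (bprop s t f x))\<^sup>2)"
    by (rule integrableI_bounded) (use nn in \<open>auto intro: le_less_trans\<close>)
  show "(\<integral>x. (norm (bprop s t f x))\<^sup>2 \<partial>?M) \<le> (\<integral>x. (norm (f x))\<^sup>2 \<partial>?M)"
    using nn 1 by (subst (asm) nn_integral_eq_integral) (auto simp: ennreal_le_iff)
qed

text \<open>Both sides are limits of the identity for combinations of Gaussians. The L2 bound
  applied to differences, which stay in \<open>bclass\<close>, makes the propagated approximants
  converge in L2, and the pairings then converge by Cauchy--Schwarz.\<close>

lemma bprop_inner: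
  assumes s: "s \<ge> 1/2" and f: "bclass s f" and g: "bclass s g"
  shows "(\<integral>x. bprop s (- t) f x * cnj (bprop s (- \<tau>) g x) \<partial>halfline_measure (2 * s - 1))
       = (\<integral>x. f x * cnj (bprop s (t - \<tau>) g x) \<partial>halfline_measure (2 * s - 1))"
proof -
  let ?M = "halfline_measure (2 * s - 1)"
  have s0: "s > 0" using s by simp
  have fm [measurable]: "f \<in> borel_measurable borel" and f1: "integrable ?M f" and f2: "integrable ?M (\<lambda>x. (norm (f x))\<^sup>2)"
    using f by (auto simp: bclass_def)
  have gm [measurable]: "g \<in> borel_measurable borel" and g1: "integrable ?M g" and g2: "integrable ?M (\<lambda>x. (norm (g x))\<^sup>2)"
    using g by (auto simp: bclass_def)
  obtain F where F: "\<And>n. gspan (F n)" 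
    "(\<lambda>n. \<integral>x. norm (F n x - f x) \<partial>?M) \<longlonglongrightarrow> 0" "(\<lambda>n. \<integral>x. (norm (F n x - f x))\<^sup>2 \<partial>?M) \<longlonglongrightarrow> 0"
    using gspan_sequence[OF s0 f] by blast
  obtain G where G: "\<And>n. gspan (G n)" 
    "(\<lambda>n. \<integral>x. norm (G n x - g x) \<partial>?M) \<longlonglongrightarrow> 0" "(\<lambda>n. \<integral>x. (norm (G n x - g x))\<^sup>2 \<partial>?M) \<longlonglongrightarrow> 0"
    using gspan_sequence[OF s0 g] by blast
  have [measurable]: "F n \<in> borel_measurable borel" "G n \<in> borel_measurable borel" for n 
    by (rule gspan_measurable, rule F G)+
  have Fd: "bclass s (\<lambda>x. F n x - f x)" and Gd: "bclass s (\<lambda>x. G n x - g x)" for n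
    by (intro bclass_diff gspan_imp_bclass s0 F(1) G(1) f g)+
  have P: "integrable ?M (\<lambda>x. (norm (bprop s r (H n) x - bprop s r h x))\<^sup>2)"
        "(\<lambda>n. \<integral>x. (norm (bprop s r (H n) x - bprop s r h x))\<^sup>2 \<partial>?M) \<longlonglongrightarrow> 0"
    if h: "bclass s h" and H: "\<And>n. gspan (H n)" "(\<lambda>n. \<integral>x. (norm (H n x - h x))\<^sup>2 \<partial>?M) \<longlonglongrightarrow> 0" for r h H n
  proof -
    have d: "bclass s (\<lambda>x. H n x - h x)" for n by (intro bclass_diff gspan_imp_bclass s0 H h)
    have h1: "integrable ?M h" using h by (simp add: bclass_def)
    have eq: "bprop s r (H n) x - bprop s r h x = bprop s r (\<lambda>x. H n x - h x) x" for n x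
      by (rule bprop_diff[OF s gspan_integrable(1)[OF s0 H(1)] h1, symmetric])
    show "integrable ?M (\<lambda>x. (norm (bprop s r (H n) x - bprop s r h x))\<^sup>2)"
      unfolding eq by (rule integrable_bprop_power2[OF s d])
    show "(\<lambda>n. \<integral>x. (norm (bprop s r (H n) x - bprop s r h x))\<^sup>2 \<partial>?M) \<longlonglongrightarrow> 0"
      unfolding eq
      by (rule tendsto_sandwich[OF _ _ tendsto_const H(2)])
         (auto intro!: always_eventually integral_nonneg_AE bprop_L2[OF s d])
  qed
  have "(\<lambda>n. \<integral>x. bprop s (- t) (F n) x * cnj (bprop s (- \<tau>) (G n) x) \<partial>?M)
     \<longlonglongrightarrow> (\<integral>x. bprop s (- t) f x * cnj (bprop s (- \<tau>) g x) \<partial>?M)"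
    by (rule tendsto_integral_cnj)
       (auto intro: P[OF f F(1,3)] P[OF g G(1,3)] integrable_bprop_power2[OF s f] integrable_bprop_power2[OF s g])
  moreover have "(\<lambda>n. \<integral>x. F n x * cnj (bprop s (t - \<tau>) (G n) x) \<partial>?M)
     \<longlonglongrightarrow> (\<integral>x. f x * cnj (bprop s (t - \<tau>) g x) \<partial>?M)"
    using Fd
    by (intro tendsto_integral_cnj)
       (auto intro: f2 F P[OF g G(1,3)] integrable_bprop_power2[OF s g] simp: bclass_def)
  moreover have "(\<integral>x. bprop s (- t) (F n) x * cnj (bprop s (- \<tau>) (G n) x) \<partial>?M) = (\<integral>x. F n x * cnj (bprop s (t - \<tau>) (G n) x) \<partial>?M)" for n
    using bprop_gspan_inner[OF s F(1)[of n] G(1)[of n], of t \<tau>] by (auto simp: has_bochner_integral_iff)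
  ultimately show ?thesis by (simp add: LIMSEQ_unique)
qed

section \<open>Hardy--Littlewood--Sobolev and Marcinkiewicz\<close>

lemma nn_integral_powr_from_0:
  fixes e c :: real
  assumes "e > -1" "c \<ge> 0"
  shows "(\<integral>\<^sup>+x\<in>{0..c}. ennreal (x powr e) \<partial>lborel) = ennreal (c powr (e + 1) / (e + 1))"
proof -
  have "((\<lambda>x. if x \<in> {0..c} then x powr e else 0) has_integral (c powr (e + 1) / (e + 1))) UNIV"
    using has_integral_powr_from_0[OF assms] by (subst has_integral_restrict_UNIV)
  hence "(\<integral>\<^sup>+x. ennreal (if x \<in> {0..c} then x powr e else 0) \<partial>lborel) = ennreal (c powr (e + 1) / (e + 1))"
    by (intro nn_integral_has_integral_lborel) auto
  also have "(\<integral>\<^sup>+x. ennreal (if x \<in> {0..c} then x powr e else 0) \<partial>lborel) = (\<integral>\<^sup>+x\<in>{0..c}. ennreal (x powr e) \<partial>lborel)"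
    by (intro nn_integral_cong) (auto simp: indicator_def)
  finally show ?thesis .
qed

lemma nn_integral_powr_to_inf:
  fixes e c :: real
  assumes "e < -1" "c > 0"
  shows "(\<integral>\<^sup>+x\<in>{c..}. ennreal (x powr e) \<partial>lborel) = ennreal (- (c powr (e + 1)) / (e + 1))"
proof -
  have "((\<lambda>x. if x \<in> {c..} then x powr e else 0) has_integral (- (c powr (e + 1)) / (e + 1))) UNIV"
    using has_integral_powr_to_inf[OF assms] by (subst has_integral_restrict_UNIV)
  hence "(\<integral>\<^sup>+x. ennreal (if x \<in> {c..} then x powr e else 0) \<partial>lborel) = ennreal (- (c powr (e + 1)) / (e + 1))"
    by (intro nn_integral_has_integral_lborel) auto
  also have "(\<integral>\<^sup>+x. ennreal (if x \<in> {c..} then x powr e else 0) \<partial>lborel) = (\<integral>\<^sup>+x\<in>{c..}. ennreal (x powr e) \<partial>lborel)"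
    by (intro nn_integral_cong) (auto simp: indicator_def)
  finally show ?thesis .
qed

lemma nn_integral_layer_power:
  fixes y r :: real
  assumes "r > 0" "y \<ge> 0"
  shows "(\<integral>\<^sup>+l. ennreal (r * l powr (r - 1)) * indicator {0<..<y} l \<partial>lborel) = ennreal (y powr r)"
proof -
  have "(\<integral>\<^sup>+l. ennreal (r * l powr (r - 1)) * indicator {0<..<y} l \<partial>lborel)
      = (\<integral>\<^sup>+l. ennreal r * (ennreal (l powr (r - 1)) * indicator {0..y} l) \<partial>lborel)"
    using assms
    by (intro nn_integral_cong_AE AE_mp[OF AE_lborel_singleton[of 0] AE_mp[OF AE_lborel_singleton[of y] AE_I2]])
       (auto simp: indicator_def ennreal_mult)
  also have "\<dots> = ennreal r * ennreal (y powr (r - 1 + 1) / (r - 1 + 1))"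
    using assms by (subst nn_integral_cmult) (auto simp: nn_integral_powr_from_0)
  also have "\<dots> = ennreal (y powr r)"
    using assms by (simp flip: ennreal_mult)
  finally show ?thesis .
qed

text \<open>Split at distance \<open>V\<close> from \<open>t\<close>. The near part is at most the
  full integral of the kernel over that neighbourhood; on the far part the kernel is at most
  \<open>V powr (- \<gamma>)\<close> and the set has measure at most \<open>V\<close>. With this
  radius both parts scale as \<open>V powr (1 - \<gamma>)\<close>.\<close>

lemma nn_integral_riesz_kernel_le:
  fixes \<gamma> V t :: real
  assumes \<gamma>: "0 < \<gamma>" "\<gamma> < 1" and [measurable]: "E \<in> sets borel" and E: "emeasure lborel E \<le> ennreal V" and V: "V \<ge> 0"
  shows "(\<integral>\<^sup>+s\<in>E. ennreal (\<bar>t - s\<bar> powr (- \<gamma>)) \<partial>lborel) \<le> ennreal ((2 / (1 - \<gamma>) + 1) * V powr (1 - \<gamma>))"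
proof (cases "V = 0")
  case True
  hence "emeasure lborel E = 0" using E by simp
  hence "AE s in lborel. s \<notin> E" by (intro AE_not_in null_setsI) auto
  hence "AE s in lborel. ennreal (\<bar>t - s\<bar> powr (- \<gamma>)) * indicator E s = 0"
    by eventually_elim simp
  hence "(\<integral>\<^sup>+s\<in>E. ennreal (\<bar>t - s\<bar> powr (- \<gamma>)) \<partial>lborel) = (\<integral>\<^sup>+(s::real). 0 \<partial>lborel)"
    by (rule nn_integral_cong_AE)
  thus ?thesis by simp
next
  case False
  hence V: "V > 0" using V by simp
  define k where "k = (\<lambda>u::real. ennreal (\<bar>u\<bar> powr (- \<gamma>)) * indicator {0..V} u)"
  have [measurable]: "k \<in> borel_measurable borel" unfolding k_def by measurable
  have kint: "(\<integral>\<^sup>+u. k u \<partial>lborel) = ennreal (V powr (1 - \<gamma>) / (1 - \<gamma>))"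
  proof -
    have "(\<integral>\<^sup>+u. k u \<partial>lborel) = (\<integral>\<^sup>+u\<in>{0..V}. ennreal (u powr (- \<gamma>)) \<partial>lborel)"
      by (intro nn_integral_cong) (auto simp: k_def indicator_def)
    thus ?thesis using nn_integral_powr_from_0[of "-\<gamma>" V] \<gamma> V by simp
  qed
  have k1: "(\<integral>\<^sup>+s. k (s - t) \<partial>lborel) = (\<integral>\<^sup>+u. k u \<partial>lborel)"
    using nn_integral_real_affine[of "\<lambda>s. k (s - t)" 1 t] by simp
  have k2: "(\<integral>\<^sup>+s. k (t - s) \<partial>lborel) = (\<integral>\<^sup>+u. k u \<partial>lborel)"
    using nn_integral_real_affine[of "\<lambda>s. k (t - s)" "-1" t] by simp
  have "ennreal (\<bar>t - s\<bar> powr (- \<gamma>)) * indicator E s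
      \<le> k (s - t) + k (t - s) + ennreal (V powr (- \<gamma>)) * indicator E s" for s
  proof (cases "\<bar>t - s\<bar> \<le> V")
    case True
    hence "ennreal (\<bar>t - s\<bar> powr (- \<gamma>)) \<le> k (s - t) + k (t - s)"
      by (cases "t \<le> s") (auto simp: k_def abs_minus_commute)
    moreover have "ennreal (\<bar>t - s\<bar> powr (- \<gamma>)) * indicator E s \<le> ennreal (\<bar>t - s\<bar> powr (- \<gamma>))"
      by (auto simp: indicator_def)
    ultimately show ?thesis by (meson add_increasing2 order_trans zero_le)
  next
    case False
    hence "\<bar>t - s\<bar> powr (- \<gamma>) \<le> V powr (- \<gamma>)" using V \<gamma> by (intro powr_mono2') auto
    hence "ennreal (\<bar>t - s\<bar> powr (- \<gamma>)) * indicator E s \<le> ennreal (V powr (- \<gamma>)) * indicator E s"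
      by (intro mult_right_mono ennreal_leI) auto
    thus ?thesis by (meson add_increasing order_trans zero_le)
  qed
  hence "(\<integral>\<^sup>+s\<in>E. ennreal (\<bar>t - s\<bar> powr (- \<gamma>)) \<partial>lborel)
      \<le> (\<integral>\<^sup>+s. k (s - t) + k (t - s) + ennreal (V powr (- \<gamma>)) * indicator E s \<partial>lborel)"
    by (intro nn_integral_mono)
  also have "\<dots> = (\<integral>\<^sup>+s. k (s - t) \<partial>lborel) + (\<integral>\<^sup>+s. k (t - s) \<partial>lborel) + ennreal (V powr (- \<gamma>)) * emeasure lborel E"
    by (simp add: nn_integral_add nn_integral_cmult_indicator)
  also have "\<dots> \<le> ennreal (V powr (1 - \<gamma>) / (1 - \<gamma>)) + ennreal (V powr (1 - \<gamma>) / (1 - \<gamma>)) + ennreal (V powr (- \<gamma>)) * ennreal V"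
    unfolding k1 k2 kint by (intro add_left_mono mult_left_mono E) auto
  also have "\<dots> = ennreal (V powr (1 - \<gamma>) / (1 - \<gamma>) + V powr (1 - \<gamma>) / (1 - \<gamma>) + V powr (- \<gamma>) * V)"
    using V \<gamma> by (simp add: ennreal_mult'[symmetric] flip: ennreal_plus)
  also have "V powr (1 - \<gamma>) / (1 - \<gamma>) + V powr (1 - \<gamma>) / (1 - \<gamma>) + V powr (- \<gamma>) * V = (2 / (1 - \<gamma>) + 1) * V powr (1 - \<gamma>)"
  proof -
    have "V powr (- \<gamma>) * V = V powr (1 - \<gamma>)" using V by (simp add: powr_diff powr_minus divide_inverse mult.commute)
    thus ?thesis by (simp add: distrib_right)
  qed
  finally show ?thesis .
qed

text \<open>By symmetry only the region \<open>N s \<le> N t\<close> matters; there the layers \<open>{N > b}\<close>, \<open>b < N t\<close>, are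
  controlled by Chebyshev's inequality alone, and the resulting power \<open>N(t)\<^sup>p\<^sup>-\<^sup>1\<close> recombines with \<open>N(t)\<close>.\<close>
lemma hardy_littlewood_sobolev:
  fixes \<gamma> p P :: real and N :: "real \<Rightarrow> real"
  assumes \<gamma>: "0 < \<gamma>" "\<gamma> < 1" and p: "p = 2 / (2 - \<gamma>)" and [measurable]: "N \<in> borel_measurable borel"
    and N: "\<And>t. N t \<ge> 0" and P: "P \<ge> 0" "(\<integral>\<^sup>+t. ennreal (N t powr p) \<partial>lborel) = ennreal P"
  shows "(\<integral>\<^sup>+t. \<integral>\<^sup>+s. ennreal (N t * N s * \<bar>t - s\<bar> powr (- \<gamma>)) \<partial>lborel \<partial>lborel)
     \<le> ennreal (2 * (2 / (1 - \<gamma>) + 1) / (p - 1) * P powr (2 / p))"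
proof -
  define C where "C = 2 / (1 - \<gamma>) + 1"
  have C: "C > 0" using \<gamma> by (simp add: C_def add_pos_pos)
  have p1: "p > 1" using \<gamma> by (simp add: p)
  \<comment> \<open>These identities fix \<open>p\<close>. The first makes the integral over layers
    converge at 0 and produces the power \<open>p - 1\<close>; the second turns the total power of
    \<open>P\<close> into \<open>2 / p\<close>.\<close>
  have pg: "1 - p * (1 - \<gamma>) = p - 1" "2 / p = 2 - \<gamma>" using \<gamma> by (simp_all add: p field_simps)
  have cheb: "emeasure lborel {s. b < N s} \<le> ennreal (P * b powr (- p))" if b: "b > 0" for b
  proof -
    have "emeasure lborel {s. b < N s} = (\<integral>\<^sup>+s. indicator {s. b < N s} s \<partial>lborel)"
      by (subst nn_integral_indicator) auto
    also have "\<dots> \<le> (\<integral>\<^sup>+s. ennreal (b powr (- p)) * ennreal (N s powr p) \<partial>lborel)"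
    proof (intro nn_integral_mono)
      fix s show "indicator {s. b < N s} s \<le> ennreal (b powr (- p)) * ennreal (N s powr p)"
      proof (cases "b < N s")
        case True
        hence "b powr p \<le> N s powr p" using b p1 by (intro powr_mono2) auto
        hence "1 \<le> b powr (- p) * N s powr p" using b by (simp add: powr_minus field_simps)
        thus ?thesis using True by (simp flip: ennreal_mult)
      qed simp
    qed
    also have "\<dots> = ennreal (P * b powr (- p))"
      using P by (simp add: nn_integral_cmult ennreal_mult mult.commute)
    finally show ?thesis .
  qed
  have inner: "(\<integral>\<^sup>+s. ennreal (N s * \<bar>t - s\<bar> powr (- \<gamma>)) * indicator {s. N s \<le> A} s \<partial>lborel)
       \<le> ennreal (C * P powr (1 - \<gamma>) / (p - 1) * A powr (p - 1))" if A: "A \<ge> 0" for A t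
  proof -
    \<comment> \<open>Where \<open>N s \<le> A\<close>, the value \<open>N s\<close> is the length
      of the set of heights \<open>b < N s\<close>, all of which lie below \<open>A\<close>.\<close>
    have layer: "ennreal (N s) * indicator {s. N s \<le> A} s \<le> (\<integral>\<^sup>+b. indicator {0<..A} b * indicator {s. b < N s} s \<partial>lborel)" for s
    proof (cases "N s \<le> A")
      case True
      have "ennreal (N s) = (\<integral>\<^sup>+b. indicator {0<..<N s} b \<partial>lborel)"
        using N[of s] by simp
      also have "\<dots> \<le> (\<integral>\<^sup>+b. indicator {0<..A} b * indicator {s. b < N s} s \<partial>lborel)"
        using True by (intro nn_integral_mono) (auto simp: indicator_def)
      finally show ?thesis using True by simp
    qed simp
    have "(\<integral>\<^sup>+s. ennreal (N s * \<bar>t - s\<bar> powr (- \<gamma>)) * indicator {s. N s \<le> A} s \<partial>lborel)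
       \<le> (\<integral>\<^sup>+s. \<integral>\<^sup>+b. ennreal (\<bar>t - s\<bar> powr (- \<gamma>)) * (indicator {0<..A} b * indicator {s. b < N s} s) \<partial>lborel \<partial>lborel)"
    proof (intro nn_integral_mono)
      fix s
      have "ennreal (N s * \<bar>t - s\<bar> powr (- \<gamma>)) * indicator {s. N s \<le> A} s
          = ennreal (\<bar>t - s\<bar> powr (- \<gamma>)) * (ennreal (N s) * indicator {s. N s \<le> A} s)"
        using N[of s] by (simp add: ennreal_mult mult_ac)
      also have "\<dots> \<le> ennreal (\<bar>t - s\<bar> powr (- \<gamma>)) * (\<integral>\<^sup>+b. indicator {0<..A} b * indicator {s. b < N s} s \<partial>lborel)"
        by (intro mult_left_mono layer) auto
      also have "\<dots> = (\<integral>\<^sup>+b. ennreal (\<bar>t - s\<bar> powr (- \<gamma>)) * (indicator {0<..A} b * indicator {s. b < N s} s) \<partial>lborel)"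
        by (subst nn_integral_cmult) (auto simp: indicator_def)
      finally show "ennreal (N s * \<bar>t - s\<bar> powr (- \<gamma>)) * indicator {s. N s \<le> A} s
        \<le> (\<integral>\<^sup>+b. ennreal (\<bar>t - s\<bar> powr (- \<gamma>)) * (indicator {0<..A} b * indicator {s. b < N s} s) \<partial>lborel)" .
    qed
    also have "\<dots> = (\<integral>\<^sup>+b. \<integral>\<^sup>+s. ennreal (\<bar>t - s\<bar> powr (- \<gamma>)) * (indicator {0<..A} b * indicator {s. b < N s} s) \<partial>lborel \<partial>lborel)"
      by (rule lborel_pair.Fubini') (simp add: indicator_def split_beta)
    also have "\<dots> \<le> (\<integral>\<^sup>+b. ennreal (C * P powr (1 - \<gamma>)) * (ennreal (b powr (- p * (1 - \<gamma>))) * indicator {0..A} b) \<partial>lborel)"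
    proof (intro nn_integral_mono)
      fix b :: real
      show "(\<integral>\<^sup>+s. ennreal (\<bar>t - s\<bar> powr (- \<gamma>)) * (indicator {0<..A} b * indicator {s. b < N s} s) \<partial>lborel)
         \<le> ennreal (C * P powr (1 - \<gamma>)) * (ennreal (b powr (- p * (1 - \<gamma>))) * indicator {0..A} b)"
      proof (cases "b \<in> {0<..A}")
        case True
        hence b: "b > 0" by simp
        \<comment> \<open>The rearrangement-type kernel bound on a superlevel set, whose measure
          Chebyshev's inequality controls.\<close>
        have "(\<integral>\<^sup>+s\<in>{s. b < N s}. ennreal (\<bar>t - s\<bar> powr (- \<gamma>)) \<partial>lborel) \<le> ennreal (C * (P * b powr (- p)) powr (1 - \<gamma>))"
          unfolding C_def by (rule nn_integral_riesz_kernel_le) (use \<gamma> P b cheb in auto)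
        also have "C * (P * b powr (- p)) powr (1 - \<gamma>) = C * P powr (1 - \<gamma>) * b powr (- p * (1 - \<gamma>))"
          using P b by (simp add: powr_mult powr_powr)
        finally show ?thesis using True C P by (simp add: ennreal_mult)
      qed auto
    qed
    also have "\<dots> = ennreal (C * P powr (1 - \<gamma>)) * ennreal (A powr (- p * (1 - \<gamma>) + 1) / (- p * (1 - \<gamma>) + 1))"
    proof -
      have "- p * (1 - \<gamma>) > -1" using pg p1 by simp
      thus ?thesis using A by (subst nn_integral_cmult) (auto simp: nn_integral_powr_from_0)
    qed
    also have "- p * (1 - \<gamma>) + 1 = p - 1" using pg by simp
    also have "ennreal (C * P powr (1 - \<gamma>)) * ennreal (A powr (p - 1) / (p - 1)) = ennreal (C * P powr (1 - \<gamma>) / (p - 1) * A powr (p - 1))"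
      using C p1 by (simp flip: ennreal_mult)
    finally show ?thesis .
  qed
  define D where "D = C * P powr (1 - \<gamma>) / (p - 1)"
  have D: "D \<ge> 0" using C p1 by (simp add: D_def)
  let ?K = "\<lambda>t s. ennreal (N t * N s * \<bar>t - s\<bar> powr (- \<gamma>))"
  have half: "(\<integral>\<^sup>+t. \<integral>\<^sup>+s. ?K t s * indicator {s. N s \<le> N t} s \<partial>lborel \<partial>lborel) \<le> ennreal (D * P)"
  proof -
    have "(\<integral>\<^sup>+t. \<integral>\<^sup>+s. ?K t s * indicator {s. N s \<le> N t} s \<partial>lborel \<partial>lborel) \<le> (\<integral>\<^sup>+t. ennreal D * ennreal (N t powr p) \<partial>lborel)"
    proof (intro nn_integral_mono)
      fix t
      have "(\<integral>\<^sup>+s. ?K t s * indicator {s. N s \<le> N t} s \<partial>lborel)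
          = ennreal (N t) * (\<integral>\<^sup>+s. ennreal (N s * \<bar>t - s\<bar> powr (- \<gamma>)) * indicator {s. N s \<le> N t} s \<partial>lborel)"
        using N by (subst nn_integral_cmult[symmetric]) (auto simp: ennreal_mult mult_ac)
      also have "\<dots> \<le> ennreal (N t) * ennreal (D * N t powr (p - 1))"
        unfolding D_def by (intro mult_left_mono inner N) auto
      also have "\<dots> = ennreal D * ennreal (N t powr p)"
      proof -
        have "N t * N t powr (p - 1) = N t powr p"
          using N[of t] by (cases "N t = 0") (auto simp: powr_diff)
        thus ?thesis using N[of t] D
          by (simp add: ennreal_mult[symmetric] mult.left_commute[of "N t"])
      qed
      finally show "(\<integral>\<^sup>+s. ?K t s * indicator {s. N s \<le> N t} s \<partial>lborel) \<le> ennreal D * ennreal (N t powr p)" .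
    qed
    also have "\<dots> = ennreal (D * P)"
      using P D by (simp add: nn_integral_cmult ennreal_mult)
    finally show ?thesis .
  qed
  have "(\<integral>\<^sup>+t. \<integral>\<^sup>+s. ?K t s \<partial>lborel \<partial>lborel)
     \<le> (\<integral>\<^sup>+t. \<integral>\<^sup>+s. ?K t s * indicator {s. N s \<le> N t} s + ?K s t * indicator {t. N t \<le> N s} t \<partial>lborel \<partial>lborel)"
    by (intro nn_integral_mono) (auto simp: indicator_def abs_minus_commute mult_ac)
  also have "\<dots> = (\<integral>\<^sup>+t. \<integral>\<^sup>+s. ?K t s * indicator {s. N s \<le> N t} s \<partial>lborel \<partial>lborel)
      + (\<integral>\<^sup>+t. \<integral>\<^sup>+s. ?K s t * indicator {t. N t \<le> N s} t \<partial>lborel \<partial>lborel)"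
    by (simp add: nn_integral_add indicator_def)
  also have "(\<integral>\<^sup>+t. \<integral>\<^sup>+s. ?K s t * indicator {t. N t \<le> N s} t \<partial>lborel \<partial>lborel)
     = (\<integral>\<^sup>+s. \<integral>\<^sup>+t. ?K s t * indicator {t. N t \<le> N s} t \<partial>lborel \<partial>lborel)"
    by (rule lborel_pair.Fubini') (simp add: indicator_def split_beta)
  also have "(\<integral>\<^sup>+t. \<integral>\<^sup>+s. ?K t s * indicator {s. N s \<le> N t} s \<partial>lborel \<partial>lborel) + \<dots> \<le> ennreal (D * P) + ennreal (D * P)"
    by (intro add_mono half)
  also have "\<dots> = ennreal (2 * C / (p - 1) * P powr (2 / p))"
  proof -
    have "P powr (1 - \<gamma>) * P = P powr (2 / p)"
      using P(1) unfolding pg(2) by (cases "P = 0") (auto simp: powr_diff power2_eq_square)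
    hence "D * P = C / (p - 1) * P powr (2 / p)" by (simp add: D_def)
    thus ?thesis using C p1 by (simp flip: ennreal_plus)
  qed
  finally show ?thesis by (simp add: C_def)
qed

text \<open>The integral over heights at one point, with \<open>A\<close> the value of the function
  there. Below the crossover height the integrand is \<open>A^2 * l powr (r - 3)\<close>, integrable
  at 0 because r > 2; above it the integrand decays as \<open>l powr (- r - 1)\<close>.\<close>

lemma nn_integral_marcinkiewicz_weight:
  fixes r c A :: real
  assumes r: "r > 2" and c: "c > 0" and A: "A \<ge> 0"
  shows "(\<integral>\<^sup>+l\<in>{0<..}. ennreal (l powr (r - 3) * (min A ((c / l) powr (r - 1)))\<^sup>2) \<partial>lborel)
     \<le> ennreal ((1 / (r - 2) + 1 / r) * c powr (r - 2) * A powr (r / (r - 1)))"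
proof (cases "A = 0")
  case True
  thus ?thesis by (simp add: min_def)
next
  case False
  hence A: "A > 0" using A by simp
  \<comment> \<open>The height at which \<open>(c / l) powr (r - 1)\<close> equals \<open>A\<close>.
    With this value both pieces scale as
    \<open>c powr (r - 2) * A powr (r / (r - 1))\<close>.\<close>
  define d where "d = c * A powr (- 1 / (r - 1))"
  have d: "d > 0" using c A by (simp add: d_def)
  define p where "p = r / (r - 1)"
  have p: "2 + - (r - 2) / (r - 1) = p" "r / (r - 1) = p" using r by (simp_all add: p_def field_simps)
  have "ennreal (l powr (r - 3) * (min A ((c / l) powr (r - 1)))\<^sup>2) * indicator {0<..} l
      \<le> ennreal (A\<^sup>2) * (ennreal (l powr (r - 3)) * indicator {0..d} l)
        + ennreal (c powr (2 * (r - 1))) * (ennreal (l powr (- r - 1)) * indicator {d..} l)" for l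
  proof (cases "l > 0")
    case l: True
    show ?thesis
    proof (cases "l \<le> d")
      case True
      have "(min A ((c / l) powr (r - 1)))\<^sup>2 \<le> A\<^sup>2" using A by (intro power_mono) auto
      hence "l powr (r - 3) * (min A ((c / l) powr (r - 1)))\<^sup>2 \<le> l powr (r - 3) * A\<^sup>2"
        by (rule mult_left_mono) simp
      hence "ennreal (l powr (r - 3) * (min A ((c / l) powr (r - 1)))\<^sup>2) \<le> ennreal (A\<^sup>2) * ennreal (l powr (r - 3))"
        by (simp add: mult.commute[of "A\<^sup>2"] flip: ennreal_mult)
      from add_mono[OF this zero_le[of "ennreal (c powr (2 * (r - 1))) * (ennreal (l powr (- r - 1)) * indicator {d..} l)"]]
      show ?thesis using True l by (simp add: indicator_def)
    next
      case False
      have "(min A ((c / l) powr (r - 1)))\<^sup>2 \<le> ((c / l) powr (r - 1))\<^sup>2" using A by (intro power_mono) auto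
      also have "\<dots> = (c / l) powr (2 * (r - 1))" by (simp add: power2_eq_square flip: powr_add)
      also have "\<dots> = c powr (2 * (r - 1)) * l powr (- (2 * (r - 1)))"
        by (simp only: powr_divide powr_minus_divide times_divide_eq_right mult_1_right)
      finally have "l powr (r - 3) * (min A ((c / l) powr (r - 1)))\<^sup>2 \<le> l powr (r - 3) * (c powr (2 * (r - 1)) * l powr (- (2 * (r - 1))))"
        by (rule mult_left_mono) simp
      also have "\<dots> = c powr (2 * (r - 1)) * l powr (- r - 1)"
      proof -
        have "l powr (r - 3) * l powr (- (2 * (r - 1))) = l powr (r - 3 + - (2 * (r - 1)))"
          by (simp only: powr_add)
        also have "r - 3 + - (2 * (r - 1)) = - r - 1" by simp
        finally show ?thesis by (simp only: mult.left_commute[of "l powr (r - 3)"])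
      qed
      finally have "ennreal (l powr (r - 3) * (min A ((c / l) powr (r - 1)))\<^sup>2) \<le> ennreal (c powr (2 * (r - 1))) * ennreal (l powr (- r - 1))"
        by (simp flip: ennreal_mult)
      from add_mono[OF zero_le[of "ennreal (A\<^sup>2) * (ennreal (l powr (r - 3)) * indicator {0..d} l)"] this]
      show ?thesis using False l by (simp add: indicator_def)
    qed
  qed simp
  hence "(\<integral>\<^sup>+l\<in>{0<..}. ennreal (l powr (r - 3) * (min A ((c / l) powr (r - 1)))\<^sup>2) \<partial>lborel)
     \<le> (\<integral>\<^sup>+l. ennreal (A\<^sup>2) * (ennreal (l powr (r - 3)) * indicator {0..d} l)
        + ennreal (c powr (2 * (r - 1))) * (ennreal (l powr (- r - 1)) * indicator {d..} l) \<partial>lborel)"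
    by (intro nn_integral_mono)
  also have "\<dots> = ennreal (A\<^sup>2) * (\<integral>\<^sup>+l\<in>{0..d}. ennreal (l powr (r - 3)) \<partial>lborel)
        + ennreal (c powr (2 * (r - 1))) * (\<integral>\<^sup>+l\<in>{d..}. ennreal (l powr (- r - 1)) \<partial>lborel)"
    by (simp add: nn_integral_add nn_integral_cmult)
  also have "(\<integral>\<^sup>+l\<in>{0..d}. ennreal (l powr (r - 3)) \<partial>lborel) = ennreal (d powr (r - 2) / (r - 2))"
    using nn_integral_powr_from_0[of "r - 3" d] r d by simp
  also have "(\<integral>\<^sup>+l\<in>{d..}. ennreal (l powr (- r - 1)) \<partial>lborel) = ennreal (d powr (- r) / r)"
    using nn_integral_powr_to_inf[of "- r - 1" d] r d by simp
  also have "ennreal (A\<^sup>2) * ennreal (d powr (r - 2) / (r - 2)) + ennreal (c powr (2 * (r - 1))) * ennreal (d powr (- r) / r)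
     = ennreal (A\<^sup>2 * (d powr (r - 2) / (r - 2)) + c powr (2 * (r - 1)) * (d powr (- r) / r))"
    using r by (simp add: ennreal_mult'[symmetric] flip: ennreal_plus)
  also have "A\<^sup>2 * (d powr (r - 2) / (r - 2)) + c powr (2 * (r - 1)) * (d powr (- r) / r)
      = (1 / (r - 2) + 1 / r) * c powr (r - 2) * A powr (r / (r - 1))"
  proof -
    have dp: "d powr e = c powr e * A powr (- e / (r - 1))" for e
      using c A by (simp add: d_def powr_mult powr_powr)
    have "A\<^sup>2 * d powr (r - 2) = c powr (r - 2) * A powr p"
    proof -
      have "A\<^sup>2 = A powr 2" using A by simp
      hence "A\<^sup>2 * A powr (- (r - 2) / (r - 1)) = A powr (2 + - (r - 2) / (r - 1))" by (simp only: powr_add)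
      also have "2 + - (r - 2) / (r - 1) = p" by (rule p(1))
      finally show ?thesis unfolding dp by simp
    qed
    moreover have "c powr (2 * (r - 1)) * d powr (- r) = c powr (r - 2) * A powr p"
    proof -
      have "c powr (2 * (r - 1)) * c powr (- r) = c powr (r - 2)" by (simp flip: powr_add)
      thus ?thesis unfolding dp p(2)[symmetric] by simp
    qed
    ultimately show ?thesis unfolding p(2) by (simp add: algebra_simps flip: add_divide_distrib)
  qed
  finally show ?thesis .
qed

text \<open>The abstract core of Marcinkiewicz interpolation between \<open>L\<^sup>1 \<rightarrow> L\<^sup>\<infinity>\<close> and \<open>L\<^sup>2 \<rightarrow> L\<^sup>2\<close>: \<open>h\<close> plays the role of
  \<open>|T f|\<close>, and at height \<open>l\<close> the function \<open>f\<close> is cut at \<open>(c / l)\<^sup>r\<^sup>-\<^sup>1\<close>, which makes the \<open>L\<^sup>1\<close> part of \<open>T f\<close> at most \<open>l / 2\<close>.\<close>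
lemma marcinkiewicz:
  fixes f h :: "'a \<Rightarrow> real" and r c :: real
  assumes M: "sigma_finite_measure M" and [measurable]: "f \<in> borel_measurable M" "h \<in> borel_measurable M"
    and f: "\<And>x. f x \<ge> 0" and h: "\<And>x. h x \<ge> 0"
    and r: "r > 2" and c: "c > 0"
    and weak: "\<And>l. l > 0 \<Longrightarrow> emeasure M {x\<in>space M. l < h x}
        \<le> ennreal (4 / l\<^sup>2) * (\<integral>\<^sup>+x. ennreal ((min (f x) ((c / l) powr (r - 1)))\<^sup>2) \<partial>M)"
  shows "(\<integral>\<^sup>+x. ennreal (h x powr r) \<partial>M)
     \<le> ennreal (4 * r * (1 / (r - 2) + 1 / r) * c powr (r - 2)) * (\<integral>\<^sup>+x. ennreal (f x powr (r / (r - 1))) \<partial>M)"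
proof -
  interpret sigma_finite_measure M by fact
  interpret pair_sigma_finite M lborel
    by (intro pair_sigma_finite.intro M lborel.sigma_finite_measure_axioms)
  have "(\<integral>\<^sup>+x. ennreal (h x powr r) \<partial>M)
      = (\<integral>\<^sup>+x. \<integral>\<^sup>+l. ennreal (r * l powr (r - 1)) * indicator {0<..} l * indicator {x\<in>space M. l < h x} x \<partial>lborel \<partial>M)"
  proof (intro nn_integral_cong)
    fix x assume x: "x \<in> space M"
    have "ennreal (h x powr r) = (\<integral>\<^sup>+l. ennreal (r * l powr (r - 1)) * indicator {0<..<h x} l \<partial>lborel)"
      using r h[of x] by (subst nn_integral_layer_power) auto
    also have "\<dots> = (\<integral>\<^sup>+l. ennreal (r * l powr (r - 1)) * indicator {0<..} l * indicator {x\<in>space M. l < h x} x \<partial>lborel)"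
      using x by (intro nn_integral_cong) (auto simp: indicator_def)
    finally show "ennreal (h x powr r) = (\<integral>\<^sup>+l. ennreal (r * l powr (r - 1)) * indicator {0<..} l * indicator {x\<in>space M. l < h x} x \<partial>lborel)" .
  qed
  also have "\<dots> = (\<integral>\<^sup>+l. \<integral>\<^sup>+x. ennreal (r * l powr (r - 1)) * indicator {0<..} l * indicator {x\<in>space M. l < h x} x \<partial>M \<partial>lborel)"
    by (rule Fubini'[symmetric]) (simp add: indicator_def split_beta)
  also have "\<dots> = (\<integral>\<^sup>+l. ennreal (r * l powr (r - 1)) * indicator {0<..} l * emeasure M {x\<in>space M. l < h x} \<partial>lborel)"
    by (intro nn_integral_cong) (simp add: nn_integral_cmult)
  also have "\<dots> \<le> (\<integral>\<^sup>+l. \<integral>\<^sup>+x. ennreal (4 * r) * (ennreal (l powr (r - 3) * (min (f x) ((c / l) powr (r - 1)))\<^sup>2) * indicator {0<..} l) \<partial>M \<partial>lborel)"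
  proof (intro nn_integral_mono)
    fix l :: real
    show "ennreal (r * l powr (r - 1)) * indicator {0<..} l * emeasure M {x\<in>space M. l < h x}
      \<le> (\<integral>\<^sup>+x. ennreal (4 * r) * (ennreal (l powr (r - 3) * (min (f x) ((c / l) powr (r - 1)))\<^sup>2) * indicator {0<..} l) \<partial>M)"
    proof (cases "l > 0")
      case l: True
      have "ennreal (r * l powr (r - 1)) * emeasure M {x\<in>space M. l < h x}
          \<le> ennreal (r * l powr (r - 1)) * (ennreal (4 / l\<^sup>2) * (\<integral>\<^sup>+x. ennreal ((min (f x) ((c / l) powr (r - 1)))\<^sup>2) \<partial>M))"
        by (intro mult_left_mono weak l) auto
      also have "\<dots> = ennreal (4 * r * l powr (r - 3)) * (\<integral>\<^sup>+x. ennreal ((min (f x) ((c / l) powr (r - 1)))\<^sup>2) \<partial>M)"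
      proof -
        have "r * l powr (r - 1) * (4 / l\<^sup>2) = 4 * r * l powr (r - 3)"
          using l by (simp add: powr_diff field_simps power2_eq_square power3_eq_cube)
        hence "ennreal (r * l powr (r - 1)) * ennreal (4 / l\<^sup>2) = ennreal (4 * r * l powr (r - 3))"
          using r l by (simp flip: ennreal_mult)
        thus ?thesis by (simp flip: mult.assoc)
      qed
      also have "\<dots> = (\<integral>\<^sup>+x. ennreal (4 * r) * (ennreal (l powr (r - 3) * (min (f x) ((c / l) powr (r - 1)))\<^sup>2) * indicator {0<..} l) \<partial>M)"
        using l r by (subst nn_integral_cmult[symmetric]) (auto simp: ennreal_mult mult.assoc)
      finally show ?thesis using l by simp
    qed simp
  qed
  \<comment> \<open>Exchanging back puts the integral over heights inside, where the value of
    \<open>f\<close> is fixed and the one-point estimate applies.\<close>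
  also have "\<dots> = (\<integral>\<^sup>+x. \<integral>\<^sup>+l. ennreal (4 * r) * (ennreal (l powr (r - 3) * (min (f x) ((c / l) powr (r - 1)))\<^sup>2) * indicator {0<..} l) \<partial>lborel \<partial>M)"
    by (rule Fubini') (simp add: split_beta)
  also have "\<dots> \<le> (\<integral>\<^sup>+x. ennreal (4 * r * (1 / (r - 2) + 1 / r) * c powr (r - 2)) * ennreal (f x powr (r / (r - 1))) \<partial>M)"
  proof (intro nn_integral_mono)
    fix x
    have "(\<integral>\<^sup>+l. ennreal (4 * r) * (ennreal (l powr (r - 3) * (min (f x) ((c / l) powr (r - 1)))\<^sup>2) * indicator {0<..} l) \<partial>lborel)
       = ennreal (4 * r) * (\<integral>\<^sup>+l\<in>{0<..}. ennreal (l powr (r - 3) * (min (f x) ((c / l) powr (r - 1)))\<^sup>2) \<partial>lborel)"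
      by (rule nn_integral_cmult) simp
    also have "\<dots> \<le> ennreal (4 * r) * ennreal ((1 / (r - 2) + 1 / r) * c powr (r - 2) * f x powr (r / (r - 1)))"
      by (intro mult_left_mono nn_integral_marcinkiewicz_weight r c f) auto
    also have "\<dots> = ennreal (4 * r * (1 / (r - 2) + 1 / r) * c powr (r - 2)) * ennreal (f x powr (r / (r - 1)))"
      using r by (simp add: ennreal_mult'[symmetric] mult.assoc)
    finally show "(\<integral>\<^sup>+l. ennreal (4 * r) * (ennreal (l powr (r - 3) * (min (f x) ((c / l) powr (r - 1)))\<^sup>2) * indicator {0<..} l) \<partial>lborel)
      \<le> ennreal (4 * r * (1 / (r - 2) + 1 / r) * c powr (r - 2)) * ennreal (f x powr (r / (r - 1)))" .
  qed
  also have "\<dots> = ennreal (4 * r * (1 / (r - 2) + 1 / r) * c powr (r - 2)) * (\<integral>\<^sup>+x. ennreal (f x powr (r / (r - 1))) \<partial>M)"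
    by (rule nn_integral_cmult) simp
  finally show ?thesis .
qed

text \<open>Hoelder's inequality from upper bounds on the two integrals instead of the norms
  themselves, so that infinite norms never arise. Young's inequality is applied after normalising by
  the bounds; a zero bound forces a zero product almost everywhere.\<close>

lemma holder_ennreal:
  fixes f g :: "'a \<Rightarrow> real" and p r A B :: real
  assumes [measurable]: "f \<in> borel_measurable M" "g \<in> borel_measurable M"
    and f: "\<And>x. f x \<ge> 0" and g: "\<And>x. g x \<ge> 0"
    and p: "p > 1" "r > 1" "1 / p + 1 / r = 1"
    and A: "A \<ge> 0" "(\<integral>\<^sup>+x. ennreal (f x powr p) \<partial>M) \<le> ennreal A"
    and B: "B \<ge> 0" "(\<integral>\<^sup>+x. ennreal (g x powr r) \<partial>M) \<le> ennreal B"
  shows "(\<integral>\<^sup>+x. ennreal (f x * g x) \<partial>M) \<le> ennreal (A powr (1 / p) * B powr (1 / r))"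
proof -
  have zero: "(\<integral>\<^sup>+x. ennreal (f x * g x) \<partial>M) = 0" if "A = 0 \<or> B = 0"
  proof -
    have "AE x in M. f x = 0 \<or> g x = 0"
    proof (cases "A = 0")
      case True
      hence "(\<integral>\<^sup>+x. ennreal (f x powr p) \<partial>M) = 0" using A by simp
      hence "AE x in M. ennreal (f x powr p) = 0" by (subst (asm) nn_integral_0_iff_AE) auto
      thus ?thesis by eventually_elim (auto simp: ennreal_eq_0_iff powr_eq_0_iff order_antisym)
    next
      case False
      hence "(\<integral>\<^sup>+x. ennreal (g x powr r) \<partial>M) = 0" using B that by simp
      hence "AE x in M. ennreal (g x powr r) = 0" by (subst (asm) nn_integral_0_iff_AE) auto
      thus ?thesis by eventually_elim (auto simp: ennreal_eq_0_iff powr_eq_0_iff order_antisym)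
    qed
    hence "AE x in M. ennreal (f x * g x) = 0" by eventually_elim auto
    thus ?thesis by (subst nn_integral_0_iff_AE) auto
  qed
  show ?thesis
  proof (cases "A = 0 \<or> B = 0")
    case True
    thus ?thesis using zero by simp
  next
    case False
    hence AB: "A > 0" "B > 0" using A B by auto
    define a where "a = A powr (1 / p)"
    define b where "b = B powr (1 / r)"
    have ab: "a > 0" "b > 0" "a powr p = A" "b powr r = B" using AB p by (auto simp: a_def b_def powr_powr)
    have "f x * g x \<le> (a * b / (p * A)) * (f x powr p) + (a * b / (r * B)) * (g x powr r)" for x
    proof -
      have "(f x / a) * (g x / b) \<le> (f x / a) powr p / p + (g x / b) powr r / r"
        by (rule Youngs_inequality) (use p f g ab in auto)
      hence "(a * b) * ((f x / a) * (g x / b)) \<le> (a * b) * ((f x / a) powr p / p + (g x / b) powr r / r)"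
        using ab by (intro mult_left_mono) auto
      also have "(a * b) * ((f x / a) * (g x / b)) = f x * g x" using ab by simp
      also have "(f x / a) powr p = f x powr p / A" using f ab by (simp add: powr_divide)
      also have "(g x / b) powr r = g x powr r / B" using g ab by (simp add: powr_divide)
      finally show ?thesis by (simp add: distrib_left mult_ac)
    qed
    hence "(\<integral>\<^sup>+x. ennreal (f x * g x) \<partial>M) \<le>
       (\<integral>\<^sup>+x. ennreal (a * b / (p * A)) * ennreal (f x powr p) + ennreal (a * b / (r * B)) * ennreal (g x powr r) \<partial>M)"
      using ab AB p by (intro nn_integral_mono) (simp add: ennreal_mult'[symmetric] flip: ennreal_plus)
    also have "\<dots> = ennreal (a * b / (p * A)) * (\<integral>\<^sup>+x. ennreal (f x powr p) \<partial>M) + ennreal (a * b / (r * B)) * (\<integral>\<^sup>+x. ennreal (g x powr r) \<partial>M)"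
      by (simp add: nn_integral_add nn_integral_cmult)
    also have "\<dots> \<le> ennreal (a * b / (p * A)) * ennreal A + ennreal (a * b / (r * B)) * ennreal B"
      by (intro add_mono mult_left_mono A B) auto
    also have "\<dots> = ennreal (a * b / (p * A) * A + a * b / (r * B) * B)"
      using ab AB p by (simp add: ennreal_mult'[symmetric] flip: ennreal_plus)
    also have "a * b / (p * A) * A + a * b / (r * B) * B = a * b * (1 / p + 1 / r)"
      using AB by (simp add: field_simps)
    finally show ?thesis by (simp add: p a_def b_def)
  qed
qed

section \<open>Interpolated pairing bound\<close>

text \<open>This puts functions in L1 and L2 into every Lp with
  \<open>1 \<le> p \<le> 2\<close>.\<close>

lemma powr_le_self_plus_square:
  fixes x p :: real
  assumes "x \<ge> 0" "1 \<le> p" "p \<le> 2"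
  shows "x powr p \<le> x + x\<^sup>2"
proof (cases "x \<le> 1")
  case True
  hence "x powr p \<le> x powr 1" if "x > 0" using that assms by (intro powr_mono') auto
  hence "x powr p \<le> x" using assms by (cases "x = 0") auto
  thus ?thesis using zero_le_power2[of x] by linarith
next
  case False
  hence "x powr p \<le> x powr 2" using assms by (intro powr_mono) auto
  thus ?thesis using False by simp
qed

lemma bclass_integrable_powr:
  assumes f: "bclass s f" and p: "1 \<le> p" "p \<le> 2"
  shows "integrable (halfline_measure (2 * s - 1)) (\<lambda>x. norm (f x) powr p)"
proof -
  have [measurable]: "f \<in> borel_measurable borel" using f by (simp add: bclass_def)
  have "integrable (halfline_measure (2 * s - 1)) (\<lambda>x. norm (f x) + (norm (f x))\<^sup>2)"
    using f by (intro Bochner_Integration.integrable_add integrable_norm) (auto simp: bclass_def)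
  thus ?thesis
    by (rule Bochner_Integration.integrable_bound) (use powr_le_self_plus_square[OF norm_ge_zero p] in auto)
qed

text \<open>The level-set hypothesis of the interpolation lemma is verified by cutting
  \<open>f\<close> in height: the kernel bound handles the excess and the L2 bound the truncated
  part. The power \<open>r - 1\<close> of \<open>P\<close> arises as \<open>r - 2\<close> from the
  constant \<open>c\<close> and 1 from the integral of the function.\<close>

lemma bprop_Lr_bound:
  fixes s r \<tau> :: real
  assumes s: "s \<ge> 1/2" and r: "r > 2" and f: "bclass s f" and \<tau>: "\<tau> \<noteq> 0"
  defines "P \<equiv> (\<integral>x. norm (f x) powr (r / (r - 1)) \<partial>halfline_measure (2 * s - 1))"
  shows "(\<integral>\<^sup>+x. ennreal (norm (bprop s \<tau> f x) powr r) \<partial>halfline_measure (2 * s - 1))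
     \<le> ennreal (4 * r * (1 / (r - 2) + 1 / r) * (2 * bconst s * \<bar>\<tau>\<bar> powr (- s)) powr (r - 2) * P powr (r - 1))"
proof -
  define p where "p = r / (r - 1)"
  have p: "1 \<le> p" "p \<le> 2" "p - 1 = 1 / (r - 1)" "p > 1" using r by (auto simp: p_def field_simps)
  let ?M = "halfline_measure (2 * s - 1)"
  have fm [measurable]: "f \<in> borel_measurable borel" and f1: "integrable ?M f" and f2: "integrable ?M (\<lambda>x. (norm (f x))\<^sup>2)"
    and fc: "continuous_on {0<..} f"
    using f by (auto simp: bclass_def)
  have fp: "integrable ?M (\<lambda>x. norm (f x) powr p)" by (rule bclass_integrable_powr[OF f p(1,2)])
  have P0: "P \<ge> 0" unfolding P_def by (intro integral_nonneg_AE) auto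
  have fP: "(\<integral>\<^sup>+x. ennreal (norm (f x) powr p) \<partial>?M) = ennreal P"
    using fp unfolding P_def p_def[symmetric] by (intro nn_integral_eq_integral) auto
  show ?thesis
  proof (cases "P = 0")
    case True
    have "AE x in ?M. ennreal (norm (f x) powr p) = 0"
      using fP True by (subst nn_integral_0_iff_AE[symmetric]) auto
    hence "AE x in ?M. f x = 0" by eventually_elim (auto simp: ennreal_eq_0_iff powr_eq_0_iff order_antisym)
    hence "bprop s \<tau> f x = 0" for x
      unfolding bprop_def using \<tau>
      by (auto intro!: integral_eq_zero_AE elim!: eventually_mono)
    thus ?thesis by simp
  next
    case False
    hence P: "P > 0" using P0 by simp
    define K where "K = bconst s * \<bar>\<tau>\<bar> powr (- s)"
    have K: "K > 0" using bconst_pos[of s] s \<tau> by (simp add: K_def)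
    \<comment> \<open>Calibrated so that the excess above the cut, of L1 norm at most
      \<open>l / c * P = l / (2 * K)\<close>, is mapped below \<open>l / 2\<close>. Positivity of
      \<open>c\<close> is why \<open>P = 0\<close> is a separate case.\<close>
    define c where "c = 2 * K * P"
    have c: "c > 0" using K P by (simp add: c_def)
    have "(\<integral>\<^sup>+x. ennreal (norm (bprop s \<tau> f x) powr r) \<partial>?M)
       \<le> ennreal (4 * r * (1 / (r - 2) + 1 / r) * c powr (r - 2)) * (\<integral>\<^sup>+x. ennreal (norm (f x) powr (r / (r - 1))) \<partial>?M)"
    proof (rule marcinkiewicz[OF sigma_finite_halfline _ _ _ _ r c])
      fix l :: real assume l: "l > 0"
      define \<mu> where "\<mu> = (c / l) powr (r - 1)"
      have \<mu>: "\<mu> > 0" using c l by (simp add: \<mu>_def)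
      have mx: "max \<mu> (norm z) > 0" for z :: complex using \<mu> by auto
      \<comment> \<open>a continuous truncation, since the \<open>L\<^sup>2\<close> bound is available on \<open>bclass\<close> only\<close>
      define g where "g = (\<lambda>y. of_real (\<mu> / max \<mu> (norm (f y))) * f y)"
      have gm [measurable]: "g \<in> borel_measurable borel" unfolding g_def by measurable
      have ng: "norm (g y) = min (norm (f y)) \<mu>" for y
        using \<mu> by (auto simp: g_def norm_mult norm_divide max_def min_def)
      have gc: "continuous_on {0<..} g"
        unfolding g_def using mx by (intro continuous_intros fc) (auto simp: less_imp_neq[symmetric])
      have g1: "integrable ?M g"
        by (rule Bochner_Integration.integrable_bound[OF f1]) (auto simp: ng)
      have g2: "integrable ?M (\<lambda>x. (norm (g x))\<^sup>2)"
        by (rule Bochner_Integration.integrable_bound[OF f2]) (use \<mu> in \<open>auto simp: ng intro!: power_mono\<close>)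
      have g: "bclass s g" using gm gc g1 g2 by (simp add: bclass_def)
      \<comment> \<open>Only values above \<open>\<mu>\<close> are altered, and there
        \<open>|f|\<close> is at most \<open>\<mu> powr (1 - p)\<close> times
        \<open>|f| powr p\<close>, as p > 1.\<close>
      have nfg: "norm (f y - g y) \<le> \<mu> powr (1 - p) * norm (f y) powr p" for y
      proof (cases "norm (f y) \<le> \<mu>")
        case True
        hence "g y = f y" using \<mu> by (simp add: g_def max_absorb1)
        thus ?thesis by simp
      next
        case False
        hence fy: "norm (f y) > \<mu>" "norm (f y) > 0" using \<mu> by auto
        have "f y - g y = of_real (1 - \<mu> / norm (f y)) * f y"
          using fy by (simp add: g_def algebra_simps max_absorb2)
        hence "norm (f y - g y) = \<bar>1 - \<mu> / norm (f y)\<bar> * norm (f y)" by (simp only: norm_mult norm_of_real)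
        also have "\<dots> \<le> 1 * norm (f y)" using fy \<mu> by (intro mult_right_mono) (auto simp: abs_le_iff)
        also have "\<dots> = norm (f y) powr (1 - p) * norm (f y) powr p" using fy by (simp flip: powr_add)
        also have "\<dots> \<le> \<mu> powr (1 - p) * norm (f y) powr p"
          using fy \<mu> p by (intro mult_right_mono powr_mono2') auto
        finally show ?thesis .
      qed
      have "(\<integral>y. norm (f y - g y) \<partial>?M) \<le> (\<integral>y. \<mu> powr (1 - p) * norm (f y) powr p \<partial>?M)"
        by (intro integral_mono integrable_norm Bochner_Integration.integrable_diff f1 g1 integrable_mult_right fp nfg)
      also have "\<dots> = \<mu> powr (1 - p) * P" by (simp add: P_def p_def)
      \<comment> \<open>Conjugate exponents satisfy \<open>(r - 1) * (p - 1) = 1\<close>, which is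
        why the cut is made at a power \<open>r - 1\<close>.\<close>
      also have "\<mu> powr (1 - p) = l / c"
      proof -
        have "(r - 1) * (1 - p) = - ((r - 1) * (p - 1))" by (simp add: algebra_simps)
        also have "\<dots> = -1" unfolding p(3) using r by simp
        finally have "\<mu> powr (1 - p) = (c / l) powr (-1)" by (simp add: \<mu>_def powr_powr)
        thus ?thesis using c l by (simp add: powr_minus_divide)
      qed
      also have "l / c * P = l / (2 * K)" using P by (simp add: c_def)
      finally have L1: "(\<integral>y. norm (f y - g y) \<partial>?M) \<le> l / (2 * K)" .
      have small: "norm (bprop s \<tau> f x - bprop s \<tau> g x) \<le> l / 2" for x
      proof -
        have "norm (bprop s \<tau> f x - bprop s \<tau> g x) = norm (bprop s \<tau> (\<lambda>y. f y - g y) x)"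
          by (simp add: bprop_diff[OF s f1 g1])
        also have "\<dots> \<le> K * (\<integral>y. norm (f y - g y) \<partial>?M)"
          unfolding K_def by (intro norm_bprop_le s \<tau> Bochner_Integration.integrable_diff f1 g1)
        also have "\<dots> \<le> K * (l / (2 * K))" using K by (intro mult_left_mono L1) auto
        finally show ?thesis using K by simp
      qed
      \<comment> \<open>Where the image of \<open>f\<close> exceeds \<open>l\<close>, that of
        \<open>g\<close> is at least \<open>l / 2\<close>, so Chebyshev's inequality for its square
        gives the factor \<open>4 / l^2\<close>.\<close>
      have "emeasure ?M {x \<in> space ?M. l < norm (bprop s \<tau> f x)}
         = (\<integral>\<^sup>+x. indicator {x. l < norm (bprop s \<tau> f x)} x \<partial>?M)"
        by (subst nn_integral_indicator) auto
      also have "\<dots> \<le> (\<integral>\<^sup>+x. ennreal (4 / l\<^sup>2) * ennreal ((norm (bprop s \<tau> g x))\<^sup>2) \<partial>?M)"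
      proof (intro nn_integral_mono)
        fix x
        show "indicator {x. l < norm (bprop s \<tau> f x)} x \<le> ennreal (4 / l\<^sup>2) * ennreal ((norm (bprop s \<tau> g x))\<^sup>2)"
        proof (cases "l < norm (bprop s \<tau> f x)")
          case True
          hence "l / 2 \<le> norm (bprop s \<tau> g x)"
            using small[of x] norm_triangle_ineq2[of "bprop s \<tau> f x" "bprop s \<tau> g x"] by linarith
          hence "(l / 2)\<^sup>2 \<le> (norm (bprop s \<tau> g x))\<^sup>2" using l by (intro power_mono) auto
          hence "1 \<le> 4 / l\<^sup>2 * (norm (bprop s \<tau> g x))\<^sup>2" using l by (simp add: field_simps)
          hence "ennreal 1 \<le> ennreal (4 / l\<^sup>2 * (norm (bprop s \<tau> g x))\<^sup>2)" by (rule ennreal_leI)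
          also have "\<dots> = ennreal (4 / l\<^sup>2) * ennreal ((norm (bprop s \<tau> g x))\<^sup>2)" by (rule ennreal_mult) auto
          finally show ?thesis using True by simp
        qed simp
      qed
      also have "\<dots> = ennreal (4 / l\<^sup>2) * (\<integral>\<^sup>+x. ennreal ((norm (bprop s \<tau> g x))\<^sup>2) \<partial>?M)"
        by (rule nn_integral_cmult) auto
      also have "(\<integral>\<^sup>+x. ennreal ((norm (bprop s \<tau> g x))\<^sup>2) \<partial>?M) = ennreal (\<integral>x. (norm (bprop s \<tau> g x))\<^sup>2 \<partial>?M)"
        by (rule nn_integral_eq_integral[OF integrable_bprop_power2[OF s g]]) auto
      also have "\<dots> \<le> ennreal (\<integral>x. (norm (g x))\<^sup>2 \<partial>?M)"
        by (intro ennreal_leI bprop_L2 s g)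
      also have "\<dots> = (\<integral>\<^sup>+x. ennreal ((min (norm (f x)) ((c / l) powr (r - 1)))\<^sup>2) \<partial>?M)"
        using nn_integral_eq_integral[OF g2] by (simp add: ng \<mu>_def)
      finally show "emeasure ?M {x \<in> space ?M. l < norm (bprop s \<tau> f x)}
        \<le> ennreal (4 / l\<^sup>2) * (\<integral>\<^sup>+x. ennreal ((min (norm (f x)) ((c / l) powr (r - 1)))\<^sup>2) \<partial>?M)"
        by (simp add: mult_left_mono)
    qed auto
    also have "(\<integral>\<^sup>+x. ennreal (norm (f x) powr (r / (r - 1))) \<partial>?M) = ennreal P"
      using fP by (simp add: p_def)
    also have "ennreal (4 * r * (1 / (r - 2) + 1 / r) * c powr (r - 2)) * ennreal P
       = ennreal (4 * r * (1 / (r - 2) + 1 / r) * (2 * K) powr (r - 2) * P powr (r - 1))"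
    proof -
      have "P powr (r - 2) * P = P powr (r - 1)" using P by (simp add: powr_diff power2_eq_square)
      moreover have "c powr (r - 2) = (2 * K) powr (r - 2) * P powr (r - 2)"
        unfolding c_def by (rule powr_mult)
      ultimately have "4 * r * (1 / (r - 2) + 1 / r) * c powr (r - 2) * P = 4 * r * (1 / (r - 2) + 1 / r) * (2 * K) powr (r - 2) * P powr (r - 1)"
        by (simp only: mult.assoc)
      thus ?thesis using P0 by (simp only: ennreal_mult''[symmetric])
    qed
    finally show ?thesis by (simp only: K_def mult.assoc)
  qed
qed

definition pairing_const :: "real \<Rightarrow> real \<Rightarrow> real" where
  "pairing_const s r = (4 * r * (1 / (r - 2) + 1 / r) * (2 * bconst s) powr (r - 2)) powr (1 / r)"

text \<open>Hoelder's inequality against the L^r bound. Taking the r-th root turns the time factor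
  into the power \<open>- s * (1 - 2/r)\<close> and \<open>P powr (r - 1)\<close> into
  \<open>P powr (1 / p)\<close>, so both functions enter through their Lp norms.\<close>

lemma bprop_pairing:
  fixes s r \<tau> :: real
  assumes s: "s \<ge> 1/2" and r: "r > 2" and f: "bclass s f" and g: "bclass s g" and \<tau>: "\<tau> \<noteq> 0"
  defines "p \<equiv> r / (r - 1)"
  shows "norm (\<integral>x. f x * cnj (bprop s \<tau> g x) \<partial>halfline_measure (2 * s - 1))
     \<le> pairing_const s r * \<bar>\<tau>\<bar> powr (- (s * (1 - 2 / r)))
        * (\<integral>x. norm (f x) powr p \<partial>halfline_measure (2 * s - 1)) powr (1 / p)
        * (\<integral>x. norm (g x) powr p \<partial>halfline_measure (2 * s - 1)) powr (1 / p)"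
proof -
  let ?M = "halfline_measure (2 * s - 1)"
  define A where "A = (\<integral>x. norm (f x) powr p \<partial>?M)"
  define P where "P = (\<integral>x. norm (g x) powr p \<partial>?M)"
  define B where "B = 4 * r * (1 / (r - 2) + 1 / r) * (2 * bconst s * \<bar>\<tau>\<bar> powr (- s)) powr (r - 2) * P powr (r - 1)"
  have p: "1 \<le> p" "p \<le> 2" "p > 1" "1 / p + 1 / r = 1" "1 / p = (r - 1) / r" using r by (auto simp: p_def field_simps)
  have [measurable]: "f \<in> borel_measurable borel" "g \<in> borel_measurable borel" using f g by (auto simp: bclass_def)
  have A0: "A \<ge> 0" "P \<ge> 0" unfolding A_def P_def by (auto intro!: integral_nonneg_AE)
  have B0: "B \<ge> 0" using r by (simp add: B_def)
  have "ennreal (norm (\<integral>x. f x * cnj (bprop s \<tau> g x) \<partial>?M)) \<le> (\<integral>\<^sup>+x. ennreal (norm (f x * cnj (bprop s \<tau> g x))) \<partial>?M)"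
    by (rule integral_norm_bound_ennreal[OF integrable_mult_cnj]) 
       (use f integrable_bprop_power2[OF s g] in \<open>auto simp: bclass_def\<close>)
  also have "\<dots> = (\<integral>\<^sup>+x. ennreal (norm (f x) * norm (bprop s \<tau> g x)) \<partial>?M)" by (simp add: norm_mult)
  also have "\<dots> \<le> ennreal (A powr (1 / p) * B powr (1 / r))"
  proof (rule holder_ennreal)
    show "(\<integral>\<^sup>+x. ennreal (norm (f x) powr p) \<partial>?M) \<le> ennreal A"
      using nn_integral_eq_integral[OF bclass_integrable_powr[OF f p(1,2)]] by (simp add: A_def)
    show "(\<integral>\<^sup>+x. ennreal (norm (bprop s \<tau> g x) powr r) \<partial>?M) \<le> ennreal B"
      unfolding B_def P_def p_def by (rule bprop_Lr_bound[OF s r g \<tau>])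
  qed (use r p A0 B0 in auto)
  finally have "norm (\<integral>x. f x * cnj (bprop s \<tau> g x) \<partial>?M) \<le> A powr (1 / p) * B powr (1 / r)"
    by (simp add: ennreal_le_iff)
  also have "B powr (1 / r) = pairing_const s r * \<bar>\<tau>\<bar> powr (- (s * (1 - 2 / r))) * P powr (1 / p)"
  proof -
    have "B = (4 * r * (1 / (r - 2) + 1 / r) * (2 * bconst s) powr (r - 2)) * (\<bar>\<tau>\<bar> powr (- (s * (r - 2))) * P powr (r - 1))"
      unfolding B_def by (simp add: powr_mult powr_powr)
    hence "B powr (1 / r) = pairing_const s r * ((\<bar>\<tau>\<bar> powr (- (s * (r - 2)))) powr (1 / r) * (P powr (r - 1)) powr (1 / r))"
      unfolding pairing_const_def by (simp only: powr_mult)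
    also have "(\<bar>\<tau>\<bar> powr (- (s * (r - 2)))) powr (1 / r) = \<bar>\<tau>\<bar> powr (- (s * (1 - 2 / r)))"
    proof -
      have "- (s * (r - 2)) * (1 / r) = - (s * (1 - 2 / r))" using r by (simp add: field_simps)
      thus ?thesis by (simp only: powr_powr)
    qed
    also have "(P powr (r - 1)) powr (1 / r) = P powr (1 / p)" by (simp add: powr_powr p(5))
    finally show ?thesis by (simp only: mult.assoc)
  qed
  finally show ?thesis by (simp add: A_def P_def mult_ac)
qed

section \<open>The dual estimate\<close>

text \<open>The \<open>TT\<^sup>*\<close> step: Fubini after expanding the square of the time integral. The bound \<open>G\<close> only makes Fubini
  applicable and does not enter the estimate.\<close>
lemma nn_integral_time_integral_power2_le:
  fixes u :: "real \<Rightarrow> 'a \<Rightarrow> complex" and G :: "real \<Rightarrow> real" and W :: "real \<Rightarrow> real \<Rightarrow> real"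
  assumes M: "sigma_finite_measure M"
    and um [measurable]: "(\<lambda>z. u (fst z) (snd z)) \<in> borel_measurable (borel \<Otimes>\<^sub>M M)"
    and u2: "\<And>t. integrable M (\<lambda>x. (norm (u t x))\<^sup>2)"
    and uG: "\<And>t. (\<integral>x. (norm (u t x))\<^sup>2 \<partial>M) \<le> (G t)\<^sup>2" and G0: "\<And>t. G t \<ge> 0"
    and Gm [measurable]: "G \<in> borel_measurable borel" and G: "(\<integral>\<^sup>+t. ennreal (G t) \<partial>lborel) < \<infinity>"
    and W: "\<And>t \<tau>. t \<noteq> \<tau> \<Longrightarrow> norm (\<integral>x. u t x * cnj (u \<tau> x) \<partial>M) \<le> W t \<tau>"
  shows "(\<integral>\<^sup>+x. ennreal ((norm (\<integral>t. u t x \<partial>lborel))\<^sup>2) \<partial>M) \<le> (\<integral>\<^sup>+t. \<integral>\<^sup>+\<tau>. ennreal (W t \<tau>) \<partial>lborel \<partial>lborel)"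
proof -
  define Q where "Q = (lborel :: real measure) \<Otimes>\<^sub>M (lborel :: real measure)"
  interpret M: sigma_finite_measure M by fact
  interpret Q: sigma_finite_measure Q unfolding Q_def by (rule lborel_pair.sigma_finite_measure_axioms)
  interpret MQ: pair_sigma_finite M Q by (intro pair_sigma_finite.intro M Q.sigma_finite_measure_axioms)
  have [measurable_cong]: "sets Q = sets ((borel :: real measure) \<Otimes>\<^sub>M (borel :: real measure))"
    unfolding Q_def by (intro sets_pair_measure_cong) auto
  have um1 [measurable]: "(\<lambda>x. u (f x) (g x)) \<in> borel_measurable N" if "f \<in> borel_measurable N" "g \<in> N \<rightarrow>\<^sub>M M" for f g and N :: "'b measure"
    using measurable_compose[OF measurable_Pair[OF that] um] by simp
  have ut: "u t \<in> borel_measurable M" for t by simp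
  have ux: "(\<lambda>t. u t x) \<in> borel_measurable borel" if "x \<in> space M" for x using that by simp
  define k where "k = (\<lambda>x z. u (fst z) x * cnj (u (snd z) x))"
  have km [measurable]: "(\<lambda>(x, z). k x z) \<in> borel_measurable (M \<Otimes>\<^sub>M Q)"
    unfolding k_def split_beta by measurable
  \<comment> \<open>A majorant that is a product in the two times, hence integrable over the plane;
    this yields joint integrability in space and both times.\<close>
  have CS: "(\<integral>\<^sup>+x. ennreal (norm (u t x * cnj (u \<tau> x))) \<partial>M) \<le> ennreal (G t) * ennreal (G \<tau>)" for t \<tau>
  proof -
    have "(\<integral>\<^sup>+x. ennreal (norm (u t x * cnj (u \<tau> x))) \<partial>M) = ennreal (\<integral>x. norm (u t x) * norm (u \<tau> x) \<partial>M)"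
      using integrable_norm_mult[OF ut ut u2 u2, of t \<tau>] by (simp add: norm_mult nn_integral_eq_integral)
    also have "\<dots> \<le> ennreal (sqrt (\<integral>x. (norm (u t x))\<^sup>2 \<partial>M) * sqrt (\<integral>x. (norm (u \<tau> x))\<^sup>2 \<partial>M))"
      by (intro ennreal_leI Cauchy_Schwarz_norm ut u2)
    also have "\<dots> \<le> ennreal (sqrt ((G t)\<^sup>2) * sqrt ((G \<tau>)\<^sup>2))"
      by (intro ennreal_leI mult_mono real_sqrt_le_mono uG) (auto intro!: integral_nonneg_AE)
    also have "\<dots> = ennreal (G t) * ennreal (G \<tau>)" using G0 by (simp add: ennreal_mult)
    finally show ?thesis .
  qed
  have k_int: "integrable (M \<Otimes>\<^sub>M Q) (\<lambda>(x, z). k x z)"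
  proof (rule integrableI_bounded)
    have "(\<integral>\<^sup>+p. ennreal (norm (case p of (x, z) \<Rightarrow> k x z)) \<partial>(M \<Otimes>\<^sub>M Q)) = (\<integral>\<^sup>+z. \<integral>\<^sup>+x. ennreal (norm (k x z)) \<partial>M \<partial>Q)"
      by (subst MQ.nn_integral_snd[symmetric]) auto
    also have "\<dots> = (\<integral>\<^sup>+t. \<integral>\<^sup>+\<tau>. \<integral>\<^sup>+x. ennreal (norm (k x (t, \<tau>))) \<partial>M \<partial>lborel \<partial>lborel)"
      unfolding Q_def by (subst lborel.nn_integral_fst[symmetric]) (auto simp: k_def)
    also have "\<dots> \<le> (\<integral>\<^sup>+t. \<integral>\<^sup>+\<tau>. ennreal (G t) * ennreal (G \<tau>) \<partial>lborel \<partial>lborel)"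
      unfolding k_def fst_conv snd_conv by (intro nn_integral_mono CS)
    also have "\<dots> = (\<integral>\<^sup>+t. ennreal (G t) \<partial>lborel) * (\<integral>\<^sup>+\<tau>. ennreal (G \<tau>) \<partial>lborel)"
      by (simp add: nn_integral_cmult nn_integral_multc)
    also have "\<dots> < \<infinity>" using G by (simp add: ennreal_mult_less_top)
    finally show "(\<integral>\<^sup>+p. ennreal (norm (case p of (x, z) \<Rightarrow> k x z)) \<partial>(M \<Otimes>\<^sub>M Q)) < \<infinity>" .
  qed measurable
  \<comment> \<open>For almost every \<open>x\<close> the integrand is integrable over both times,
    and its double integral factors into the time integral times its own conjugate.\<close>
  have sq: "AE x in M. (\<integral>z. k x z \<partial>Q) = of_real ((norm (\<integral>t. u t x \<partial>lborel))\<^sup>2)"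
    using MQ.AE_integrable_fst'[OF k_int] AE_space
  proof eventually_elim
    case (elim x)
    hence kx: "integrable Q (k x)" and x: "x \<in> space M" by auto
    have [measurable]: "(\<lambda>t. u t x) \<in> borel_measurable borel" by (rule ux[OF x])
    have "(\<integral>\<^sup>+z. ennreal (norm (k x z)) \<partial>Q) = (\<integral>\<^sup>+t. \<integral>\<^sup>+\<tau>. ennreal (norm (u t x)) * ennreal (norm (u \<tau> x)) \<partial>lborel \<partial>lborel)"
      unfolding Q_def by (subst lborel.nn_integral_fst[symmetric]) (auto simp: k_def norm_mult ennreal_mult)
    also have "\<dots> = (\<integral>\<^sup>+t. ennreal (norm (u t x)) \<partial>lborel) * (\<integral>\<^sup>+t. ennreal (norm (u t x)) \<partial>lborel)"
      by (simp add: nn_integral_cmult nn_integral_multc)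
    finally have "(\<integral>\<^sup>+t. ennreal (norm (u t x)) \<partial>lborel) * (\<integral>\<^sup>+t. ennreal (norm (u t x)) \<partial>lborel) < \<infinity>"
      using kx by (simp add: integrable_iff_bounded)
    hence "(\<integral>\<^sup>+t. ennreal (norm (u t x)) \<partial>lborel) < \<infinity>"
      by (auto simp: ennreal_mult_less_top less_top[symmetric] top_unique)
    hence "integrable lborel (\<lambda>t. u t x)" by (intro integrableI_bounded) auto
    have "(\<integral>z. k x z \<partial>Q) = (\<integral>t. \<integral>\<tau>. k x (t, \<tau>) \<partial>lborel \<partial>lborel)"
      using kx unfolding Q_def by (rule lborel_pair.integral_fst'[symmetric])
    also have "\<dots> = (\<integral>t. u t x \<partial>lborel) * cnj (\<integral>\<tau>. u \<tau> x \<partial>lborel)"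
      unfolding k_def by simp
    also have "\<dots> = of_real ((norm (\<integral>t. u t x \<partial>lborel))\<^sup>2)" by (simp only: complex_norm_square)
    finally show ?case .
  qed
  have vm [measurable]: "(\<lambda>x. \<integral>t. u t x \<partial>lborel) \<in> borel_measurable M" by measurable
  have cint: "integrable M (\<lambda>x. of_real ((norm (\<integral>t. u t x \<partial>lborel))\<^sup>2) :: complex)"
    using MQ.integrable_fst'[OF k_int] sq by (subst integrable_cong_AE[of _ _ "\<lambda>x. \<integral>z. k x z \<partial>Q"]) auto
  hence rint: "integrable M (\<lambda>x. (norm (\<integral>t. u t x \<partial>lborel))\<^sup>2)" by (simp only: complex_of_real_integrable_eq)
  define I where "I = (\<integral>x. (norm (\<integral>t. u t x \<partial>lborel))\<^sup>2 \<partial>M)"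
  have "of_real I = (\<integral>x. of_real ((norm (\<integral>t. u t x \<partial>lborel))\<^sup>2) \<partial>M :: complex)"
    unfolding I_def by (simp only: integral_complex_of_real)
  also have "\<dots> = (\<integral>x. \<integral>z. k x z \<partial>Q \<partial>M)"
    using sq by (intro integral_cong_AE) auto
  also have "\<dots> = (\<integral>z. \<integral>x. k x z \<partial>M \<partial>Q)"
    using k_int by (rule MQ.Fubini_integral[symmetric])
  finally have I: "of_real I = (\<integral>z. \<integral>x. k x z \<partial>M \<partial>Q)" .
  have I0: "I \<ge> 0" unfolding I_def by (intro integral_nonneg_AE) auto
  have "(\<integral>\<^sup>+x. ennreal ((norm (\<integral>t. u t x \<partial>lborel))\<^sup>2) \<partial>M) = ennreal I"
    unfolding I_def by (rule nn_integral_eq_integral[OF rint]) auto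
  also have "\<dots> = ennreal (norm (complex_of_real I))" using I0 by simp
  also have "\<dots> \<le> (\<integral>\<^sup>+z. ennreal (norm (\<integral>x. k x z \<partial>M)) \<partial>Q)"
    unfolding I by (rule integral_norm_bound_ennreal[OF MQ.integrable_snd[OF k_int]])
  also have "\<dots> = (\<integral>\<^sup>+t. \<integral>\<^sup>+\<tau>. ennreal (norm (\<integral>x. k x (t, \<tau>) \<partial>M)) \<partial>lborel \<partial>lborel)"
  proof -
    have "(\<lambda>z. ennreal (norm (\<integral>x. k x z \<partial>M))) \<in> borel_measurable (lborel \<Otimes>\<^sub>M lborel)"
      unfolding k_def by measurable
    thus ?thesis unfolding Q_def by (rule lborel.nn_integral_fst[symmetric])
  qed
  also have "\<dots> \<le> (\<integral>\<^sup>+t. \<integral>\<^sup>+\<tau>. ennreal (W t \<tau>) \<partial>lborel \<partial>lborel)"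
  proof (rule nn_integral_mono, rule nn_integral_mono_AE)
    fix t :: real
    \<comment> \<open>The bound \<open>W\<close> is available only for distinct times; the diagonal
      is a null set.\<close>
    show "AE \<tau> in lborel. ennreal (norm (\<integral>x. k x (t, \<tau>) \<partial>M)) \<le> ennreal (W t \<tau>)"
      using AE_lborel_singleton[of t]
    proof eventually_elim
      case (elim \<tau>)
      thus ?case using W[of t \<tau>] by (simp add: k_def ennreal_leI)
    qed
  qed
  finally show ?thesis .
qed

section \<open>Decay of the data and their time slices\<close>

lemma nn_integral_inverse_1_plus_square: "(\<integral>\<^sup>+x. ennreal (1 / (1 + x\<^sup>2)) \<partial>lborel) < \<infinity>"
proof -
  let ?g = "\<lambda>x::real. ennreal (1 / (1 + x\<^sup>2)) * indicator {0..} x"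
  have pos: "1 + x\<^sup>2 > 0" for x :: real by (simp add: add_pos_nonneg)
  have half: "(\<integral>\<^sup>+x. ?g x \<partial>lborel) = ennreal (pi / 2 - arctan 0)"
  proof (rule nn_integral_FTC_atLeast)
    show "(arctan has_real_derivative 1 / (1 + x\<^sup>2)) (at x)" for x
      using DERIV_arctan[of x] by (simp add: inverse_eq_divide)
    show "(arctan \<longlongrightarrow> pi / 2) at_top" by (rule tendsto_arctan_at_top)
  qed (use pos in \<open>auto simp: less_imp_le\<close>)
  have "(\<integral>\<^sup>+x. ennreal (1 / (1 + x\<^sup>2)) \<partial>lborel) \<le> (\<integral>\<^sup>+x. ?g x + ?g (- x) \<partial>lborel)"
    by (intro nn_integral_mono) (auto simp: indicator_def)
  also have "\<dots> = (\<integral>\<^sup>+x. ?g x \<partial>lborel) + (\<integral>\<^sup>+x. ?g (- x) \<partial>lborel)"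
    by (rule nn_integral_add) auto
  also have "(\<integral>\<^sup>+x. ?g (- x) \<partial>lborel) = (\<integral>\<^sup>+x. ?g x \<partial>lborel)"
    using nn_integral_real_affine[of ?g "-1" 0] by simp
  also have "(\<integral>\<^sup>+x. ?g x \<partial>lborel) + (\<integral>\<^sup>+x. ?g x \<partial>lborel) < \<infinity>" unfolding half by simp
  finally show ?thesis .
qed

text \<open>The exponent spends \<open>a / 2\<close> on dominating the weight
  \<open>x powr a\<close> and leaves \<open>1 / (1 + x^2)\<close>.\<close>

lemma integrable_japanese_bracket:
  assumes a: "a \<ge> 0"
  shows "integrable (halfline_measure a) (\<lambda>x. (1 + x\<^sup>2) powr (- (a / 2 + 1)))"
proof (rule integrableI_bounded)
  have pos: "1 + x\<^sup>2 > 0" for x :: real by (simp add: add_pos_nonneg)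
  have "(\<integral>\<^sup>+x. ennreal (norm ((1 + x\<^sup>2) powr (- (a / 2 + 1)))) \<partial>halfline_measure a)
     \<le> (\<integral>\<^sup>+x. ennreal (1 / (1 + x\<^sup>2)) \<partial>lborel)"
  proof (subst nn_integral_halfline, measurable, intro nn_integral_mono)
    fix x :: real
    show "ennreal (norm ((1 + x\<^sup>2) powr (- (a / 2 + 1)))) * ennreal (x powr a) * indicator {0<..} x \<le> ennreal (1 / (1 + x\<^sup>2))"
    proof (cases "x > 0")
      case True
      have "x powr a = (x\<^sup>2) powr (a / 2)"
      proof -
        have "x\<^sup>2 = x powr 2" using True by simp
        thus ?thesis by (simp add: powr_powr del: powr_numeral)
      qed
      also have "\<dots> \<le> (1 + x\<^sup>2) powr (a / 2)" using a by (intro powr_mono2) auto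
      finally have "(1 + x\<^sup>2) powr (- (a / 2 + 1)) * x powr a \<le> (1 + x\<^sup>2) powr (- (a / 2 + 1)) * (1 + x\<^sup>2) powr (a / 2)"
        by (rule mult_left_mono) simp
      also have "\<dots> = (1 + x\<^sup>2) powr (-1)" by (simp flip: powr_add)
      also have "\<dots> = 1 / (1 + x\<^sup>2)" using pos[of x] by (simp add: powr_minus_divide)
      finally show ?thesis using True by (simp add: ennreal_leI flip: ennreal_mult)
    qed simp
  qed
  also have "\<dots> < \<infinity>" by (rule nn_integral_inverse_1_plus_square)
  finally show "(\<integral>\<^sup>+x. ennreal (norm ((1 + x\<^sup>2) powr (- (a / 2 + 1)))) \<partial>halfline_measure a) < \<infinity>" .
qed auto

lemma Splus_continuous: "F \<in> Splus \<Longrightarrow> continuous_on ({0<..} \<times> UNIV) (case_prod F)"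
  unfolding Splus_def C_infty_on_def by (auto dest!: spec[of _ "[]"])

lemma Splus_decay:
  assumes "F \<in> Splus" and m: "m \<ge> 0"
  obtains D where "D \<ge> 0" "\<And>x t. x > 0 \<Longrightarrow> norm (F x t) \<le> D * (1 + x\<^sup>2) powr (- m) / (1 + t\<^sup>2)"
proof -
  \<comment> \<open>Both factors are at most powers of \<open>1 + x^2 + t^2\<close>, of total
    exponent \<open>m + 1\<close>; the seminorm of index \<open>p\<close> supplies the exponent
    \<open>p / 2\<close>.\<close>
  obtain p :: nat where p: "real p \<ge> 2 * (m + 1)" using real_arch_simple by blast
  from assms have "\<exists>M. \<forall>k l. k + l \<le> p \<longrightarrow> (\<forall>x>0. \<forall>t.
        (1 + x\<^sup>2 + t\<^sup>2) powr (real p / 2) * norm ((Dxw ^^ k) ((pd False ^^ l) (case_prod F)) (x, t)) \<le> M)"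
    unfolding Splus_def by blast
  then obtain M where M: "\<And>k l x t. k + l \<le> p \<Longrightarrow> x > 0 \<Longrightarrow> 
        (1 + x\<^sup>2 + t\<^sup>2) powr (real p / 2) * norm ((Dxw ^^ k) ((pd False ^^ l) (case_prod F)) (x, t)) \<le> M" by blast
  have "norm (F x t) \<le> \<bar>M\<bar> * (1 + x\<^sup>2) powr (- m) / (1 + t\<^sup>2)" if x: "x > 0" for x t
  proof -
    have pos: "1 + x\<^sup>2 > 0" "1 + t\<^sup>2 > 0" by (simp_all add: add_pos_nonneg)
    have "(1 + x\<^sup>2) powr m * (1 + t\<^sup>2) = (1 + x\<^sup>2) powr m * (1 + t\<^sup>2) powr 1" using pos by simp
    also have "\<dots> \<le> (1 + x\<^sup>2 + t\<^sup>2) powr m * (1 + x\<^sup>2 + t\<^sup>2) powr 1"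
      using m by (intro mult_mono powr_mono2) auto
    also have "\<dots> = (1 + x\<^sup>2 + t\<^sup>2) powr (m + 1)" by (simp add: powr_add)
    also have "\<dots> \<le> (1 + x\<^sup>2 + t\<^sup>2) powr (real p / 2)" using p by (intro powr_mono) auto
    finally have "(1 + x\<^sup>2) powr m * (1 + t\<^sup>2) * norm (F x t) \<le> (1 + x\<^sup>2 + t\<^sup>2) powr (real p / 2) * norm (F x t)"
      by (rule mult_right_mono) simp
    also have "\<dots> \<le> \<bar>M\<bar>" using M[of 0 0 x t] x by simp
    finally have "norm (F x t) * ((1 + x\<^sup>2) powr m * (1 + t\<^sup>2)) \<le> \<bar>M\<bar>" by (simp only: mult.commute)
    moreover have "(1 + x\<^sup>2) powr m * (1 + t\<^sup>2) > 0" using pos by (intro mult_pos_pos) auto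
    ultimately have "norm (F x t) \<le> \<bar>M\<bar> / ((1 + x\<^sup>2) powr m * (1 + t\<^sup>2))" by (simp only: pos_le_divide_eq)
    thus ?thesis by (simp add: powr_minus_divide)
  qed
  thus ?thesis by (intro that[of "\<bar>M\<bar>"]) auto
qed

text \<open>Time comes first, so that \<open>F\<close> becomes a curve of functions of
  \<open>y\<close>; values at \<open>y \<le> 0\<close>, where \<open>F\<close> is unconstrained, are
  replaced by 0.\<close>

definition time_slice :: "(real \<Rightarrow> real \<Rightarrow> complex) \<Rightarrow> real \<Rightarrow> real \<Rightarrow> complex" where
  "time_slice F t y = indicator {0<..} y *\<^sub>R F y t"

lemma time_slice_measurable:
  assumes "F \<in> Splus"
  shows "(\<lambda>z. time_slice F (fst z) (snd z)) \<in> borel_measurable (borel \<Otimes>\<^sub>M borel)"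
proof -
  have "(\<lambda>z. indicator ({0<..} \<times> UNIV) z *\<^sub>R case_prod F z) \<in> borel_measurable borel"
    by (rule borel_measurable_continuous_on_indicator[OF _ Splus_continuous[OF assms]])
       (auto intro!: borel_open open_Times)
  hence "(\<lambda>z. indicator ({0<..} \<times> UNIV) z *\<^sub>R case_prod F z) \<in> borel_measurable (borel \<Otimes>\<^sub>M borel)"
    by (simp only: borel_prod)
  from measurable_compose[OF _ this, of "\<lambda>z. (snd z, fst z)" "borel \<Otimes>\<^sub>M borel"]
  have "(\<lambda>z. indicator ({0<..} \<times> UNIV) (snd z, fst z) *\<^sub>R F (snd z) (fst z)) \<in> borel_measurable (borel \<Otimes>\<^sub>M borel)"
    by simp
  also have "(\<lambda>z. indicator ({0<..} \<times> UNIV) (snd z, fst z) *\<^sub>R F (snd z) (fst z)) = (\<lambda>z. time_slice F (fst z) (snd z))"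
    by (auto simp: time_slice_def indicator_def fun_eq_iff)
  finally show ?thesis .
qed

text \<open>The factor \<open>1 / (1 + t^2)\<close> in the L2 bound is integrable in time, which is
  what the exchange of the time integrals requires.\<close>

lemma time_slice_bclass:
  assumes a: "a \<ge> 0" and F: "F \<in> Splus"
  obtains D where "D \<ge> 0" "\<And>t. bclass ((a + 1) / 2) (time_slice F t)"
    "\<And>t. (\<integral>x. (norm (time_slice F t x))\<^sup>2 \<partial>halfline_measure a) \<le> (D / (1 + t\<^sup>2))\<^sup>2"
proof -
  let ?w = "\<lambda>x::real. (1 + x\<^sup>2) powr (- (a / 2 + 1))"
  obtain D where D: "D \<ge> 0" "\<And>x t. x > 0 \<Longrightarrow> norm (F x t) \<le> D * ?w x / (1 + t\<^sup>2)"
    using Splus_decay[OF F, of "a / 2 + 1"] a by auto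
  define I where "I = (\<integral>x. ?w x \<partial>halfline_measure a)"
  have I0: "I \<ge> 0" unfolding I_def by (intro integral_nonneg_AE) auto
  have wint: "integrable (halfline_measure a) ?w" by (rule integrable_japanese_bracket[OF a])
  have pos: "1 + x\<^sup>2 > 0" for x :: real by (simp add: add_pos_nonneg)
  have w1: "?w x \<le> 1" for x
    using a powr_mono2'[of "- (a / 2 + 1)" 1 "1 + x\<^sup>2"] by simp
  have bnd: "norm (time_slice F t x) \<le> D / (1 + t\<^sup>2) * ?w x" for t x
    using D(2)[of x t] D(1) pos[of t] by (auto simp: time_slice_def indicator_def)
  have bnd2: "(norm (time_slice F t x))\<^sup>2 \<le> (D / (1 + t\<^sup>2))\<^sup>2 * ?w x" for t x
  proof -
    have "(norm (time_slice F t x))\<^sup>2 \<le> (D / (1 + t\<^sup>2) * ?w x)\<^sup>2" by (intro power_mono bnd) auto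
    also have "\<dots> = (D / (1 + t\<^sup>2))\<^sup>2 * (?w x * ?w x)" by (simp only: power_mult_distrib power2_eq_square[of "?w x"])
    also have "\<dots> \<le> (D / (1 + t\<^sup>2))\<^sup>2 * (?w x * 1)" by (intro mult_left_mono w1) auto
    finally show ?thesis by simp
  qed
  have m [measurable]: "time_slice F t \<in> borel_measurable borel" for t
    using measurable_compose[OF _ time_slice_measurable[OF F], of "\<lambda>y. (t, y)" borel] by simp
  have i1: "integrable (halfline_measure a) (time_slice F t)" for t
    by (rule Bochner_Integration.integrable_bound[OF integrable_mult_right[OF wint, of "D / (1 + t\<^sup>2)"]])
       (use bnd D(1) pos[of t] in \<open>auto intro!: AE_I2 simp: abs_mult\<close>)
  have i2: "integrable (halfline_measure a) (\<lambda>x. (norm (time_slice F t x))\<^sup>2)" for t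
    by (rule Bochner_Integration.integrable_bound[OF integrable_mult_right[OF wint, of "(D / (1 + t\<^sup>2))\<^sup>2"]])
       (use bnd2 in \<open>auto intro!: AE_I2\<close>)
  have c: "continuous_on {0<..} (time_slice F t)" for t
  proof -
    have "continuous_on {0<..} (\<lambda>y. case_prod F (y, t))"
      by (rule continuous_on_compose2[OF Splus_continuous[OF F]]) (auto intro!: continuous_intros)
    thus ?thesis by (rule continuous_on_eq) (auto simp: time_slice_def)
  qed
  have a_eq: "2 * ((a + 1) / 2) - 1 = a" by (simp add: field_simps)
  show ?thesis
  proof (rule that[of "D * sqrt I"])
    show "D * sqrt I \<ge> 0" using D I0 by simp
    show "bclass ((a + 1) / 2) (time_slice F t)" for t
      unfolding bclass_def a_eq using m i1 i2 c by auto
    fix t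
    have "(\<integral>x. (norm (time_slice F t x))\<^sup>2 \<partial>halfline_measure a) \<le> (\<integral>x. (D / (1 + t\<^sup>2))\<^sup>2 * ?w x \<partial>halfline_measure a)"
      by (intro integral_mono i2 integrable_mult_right wint bnd2)
    also have "\<dots> = (D / (1 + t\<^sup>2))\<^sup>2 * I" by (simp add: I_def)
    also have "\<dots> = (D * sqrt I / (1 + t\<^sup>2))\<^sup>2" using I0 by (simp add: power_mult_distrib power_divide)
    finally show "(\<integral>x. (norm (time_slice F t x))\<^sup>2 \<partial>halfline_measure a) \<le> (D * sqrt I / (1 + t\<^sup>2))\<^sup>2" .
  qed
qed

section \<open>The norms of the theorem in terms of time slices\<close>

lemma enn_powr_ennreal: "v \<ge> 0 \<Longrightarrow> enn_powr (ennreal v) e = ennreal (v powr e)"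
  by (simp add: enn_powr_def)

lemma enn_powr_mono:
  assumes "u \<le> v" "e > 0"
  shows "enn_powr u e \<le> enn_powr v e"
proof (cases "v = \<infinity>")
  case False
  hence "v < \<infinity>" "u < \<infinity>" using assms(1) by (auto simp: less_top intro: le_less_trans)
  thus ?thesis using assms
    by (auto simp: enn_powr_def intro!: ennreal_leI powr_mono2 enn2real_mono)
qed (simp add: enn_powr_def)

lemma wLnorm_time_slice:
  assumes a: "a \<ge> 0" and p: "1 \<le> p" "p \<le> 2" and f: "bclass ((a + 1) / 2) (time_slice F t)"
  shows "wLnorm a p (\<lambda>x. F x t) = ennreal ((\<integral>x. norm (time_slice F t x) powr p \<partial>halfline_measure a) powr (1 / p))"
proof -
  have a_eq: "2 * ((a + 1) / 2) - 1 = a" by (simp add: field_simps)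
  have [measurable]: "time_slice F t \<in> borel_measurable borel" using f by (simp add: bclass_def)
  have "(\<integral>\<^sup>+x\<in>{0<..}. ennreal (norm (F x t) powr p * x powr a) \<partial>lborel)
      = (\<integral>\<^sup>+x. ennreal (norm (time_slice F t x) powr p) \<partial>halfline_measure a)"
    by (subst nn_integral_halfline, measurable, intro nn_integral_cong)
       (auto simp: time_slice_def indicator_def ennreal_mult)
  also have "\<dots> = ennreal (\<integral>x. norm (time_slice F t x) powr p \<partial>halfline_measure a)"
    using bclass_integrable_powr[OF f p] unfolding a_eq by (intro nn_integral_eq_integral) auto
  finally show ?thesis unfolding wLnorm_def
    by (simp add: enn_powr_ennreal integral_nonneg_AE)
qed

lemma wLnorm_Top:
  assumes a: "a \<ge> 0" and F: "F \<in> Splus"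
  shows "wLnorm a 2 (Top a F)
      = enn_powr (\<integral>\<^sup>+x. ennreal ((norm (\<integral>t. bprop ((a + 1) / 2) (- t) (time_slice F t) x \<partial>lborel))\<^sup>2) \<partial>halfline_measure a) (1 / 2)"
proof -
  have [measurable]: "time_slice F t \<in> borel_measurable borel" for t
    using measurable_compose[OF _ time_slice_measurable[OF F], of "\<lambda>y. (t, y)" borel] by simp
  have Sop: "Sop a (- t) (\<lambda>y. F y t) x = bprop ((a + 1) / 2) (- t) (time_slice F t) x" if "x > 0" for x t
    using Sop_eq_bprop[OF a that, of "\<lambda>y. F y t" "- t"] \<open>time_slice F t \<in> borel_measurable borel\<close>
    unfolding time_slice_def[abs_def] .
  have [measurable]: "(\<lambda>x. \<integral>t. bprop ((a + 1) / 2) (- t) (time_slice F t) x \<partial>lborel) \<in> borel_measurable borel"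
  proof (rule lborel.borel_measurable_lebesgue_integral)
    have "(\<lambda>z. bprop ((a + 1) / 2) (- fst z) (time_slice F (fst z)) (snd z)) \<in> borel_measurable (borel \<Otimes>\<^sub>M borel)"
      by (rule bprop_measurable_pair[OF time_slice_measurable[OF F]]) auto
    from measurable_compose[OF _ this, of "\<lambda>z. (snd z, fst z)" "borel \<Otimes>\<^sub>M lborel"]
    show "(\<lambda>(x, t). bprop ((a + 1) / 2) (- t) (time_slice F t) x) \<in> borel_measurable (borel \<Otimes>\<^sub>M lborel)"
      by (simp add: split_beta)
  qed
  have "(\<integral>\<^sup>+x\<in>{0<..}. ennreal (norm (Top a F x) powr 2 * x powr a) \<partial>lborel)
    = (\<integral>\<^sup>+x. ennreal ((norm (\<integral>t. bprop ((a + 1) / 2) (- t) (time_slice F t) x \<partial>lborel))\<^sup>2) \<partial>halfline_measure a)"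
    by (subst nn_integral_halfline, measurable, intro nn_integral_cong)
       (auto simp: Top_def Sop indicator_def ennreal_mult)
  thus ?thesis by (simp add: wLnorm_def)
qed

theorem theoremT:
  fixes a q r :: real
  assumes "a \<ge> 0" and "admissible a q r"
  shows "\<exists>C>0. \<forall>F\<in>Splus.
           wLnorm a 2 (Top a F) \<le> ennreal C * mixnorm a (conj_exp q) (conj_exp r) F"
proof -
  note a = \<open>a \<ge> 0\<close>
  define s where "s = (a + 1) / 2"
  define \<gamma> where "\<gamma> = 2 / q"
  define p where "p = conj_exp r"
  have s: "s \<ge> 1/2" using a by (simp add: s_def)
  have a_eq: "2 * s - 1 = a" by (simp add: s_def field_simps)
  have r: "r > 2" using assms(2) by (simp add: admissible_def)
  have \<gamma>_eq: "\<gamma> = (a + 1) * (1 / 2 - 1 / r)" using assms(2) by (simp add: admissible_def \<gamma>_def)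
  have \<gamma>_s: "s * (1 - 2 / r) = \<gamma>" unfolding \<gamma>_eq s_def using r by (simp add: field_simps)
  have \<gamma>0: "\<gamma> > 0" unfolding \<gamma>_eq using a r by (intro mult_pos_pos) (auto simp: field_simps)
  \<comment> \<open>For a > 1 this is equivalent to the upper bound on \<open>r\<close>; for a at
    most 1 it follows from the finiteness of \<open>r\<close>.\<close>
  have \<gamma>1: "\<gamma> < 1"
  proof (cases "a > 1")
    case True
    hence "r < 2 * (a + 1) / (a - 1)" using assms(2) by (simp add: admissible_def)
    hence "r * (a - 1) < 2 * (a + 1)" using True by (simp add: field_simps)
    thus ?thesis unfolding \<gamma>_eq using r by (simp add: field_simps)
  next
    case False
    have "(a + 1) * (1 / 2 - 1 / r) < (a + 1) * (1 / 2)" using a r by (intro mult_strict_left_mono) auto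
    also have "\<dots> \<le> 1" using False by simp
    finally show ?thesis unfolding \<gamma>_eq .
  qed
  have q: "q > 2" using \<gamma>0 \<gamma>1 unfolding \<gamma>_def by (cases "q > 0") (auto simp: field_simps zero_less_divide_iff)
  define q' where "q' = conj_exp q"
  \<comment> \<open>The conjugate of \<open>q\<close> is exactly the exponent on which the
    Hardy--Littlewood--Sobolev form with kernel exponent \<open>2 / q\<close> is bounded in both
    arguments.\<close>
  have q': "q' = 2 / (2 - \<gamma>)" using q by (simp add: q'_def conj_exp_def \<gamma>_def field_simps)
  have q'1: "q' > 1" using \<gamma>0 \<gamma>1 by (simp add: q')
  have p_eq: "p = r / (r - 1)" by (simp add: p_def conj_exp_def)
  have p: "1 \<le> p" "p \<le> 2" using r by (auto simp: p_eq field_simps)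
  \<comment> \<open>The constant of the squared estimate, a product of the pairing constant and the
    constant of the double time integral. It is shown to be nonnegative; adding 1 to its root makes
    the final constant positive.\<close>
  define C0 where "C0 = pairing_const s r * (2 * (2 / (1 - \<gamma>) + 1) / (q' - 1))"
  have pc0: "pairing_const s r \<ge> 0" by (simp add: pairing_const_def)
  have C0: "C0 \<ge> 0" unfolding C0_def using pc0 \<gamma>1 q'1 by (intro mult_nonneg_nonneg divide_nonneg_nonneg) auto
  have main: "wLnorm a 2 (Top a F) \<le> ennreal (sqrt C0 + 1) * mixnorm a (conj_exp q) (conj_exp r) F"
    if F: "F \<in> Splus" for F
  proof -
    let ?M = "halfline_measure a"
    obtain D where D: "D \<ge> 0" and bc: "\<And>t. bclass s (time_slice F t)"
      and L2: "\<And>t. (\<integral>x. (norm (time_slice F t x))\<^sup>2 \<partial>?M) \<le> (D / (1 + t\<^sup>2))\<^sup>2"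
      using time_slice_bclass[OF a F] unfolding s_def by blast
    define N where "N = (\<lambda>t. (\<integral>x. norm (time_slice F t x) powr p \<partial>?M) powr (1 / p))"
    have Nm [measurable]: "N \<in> borel_measurable borel"
    proof -
      have [measurable]: "(\<lambda>z. time_slice F (fst z) (snd z)) \<in> borel_measurable (borel \<Otimes>\<^sub>M ?M)"
        using time_slice_measurable[OF F] by (simp cong: measurable_cong_sets sets_pair_measure_cong)
      have "(\<lambda>t. \<integral>x. norm (time_slice F t x) powr p \<partial>?M) \<in> borel_measurable borel"
        by (rule sigma_finite_measure.borel_measurable_lebesgue_integral[OF sigma_finite_halfline])
           (simp add: split_beta)
      thus ?thesis unfolding N_def by measurable
    qed
    have N0: "N t \<ge> 0" for t by (simp add: N_def)
    have wL: "wLnorm a p (\<lambda>x. F x t) = ennreal (N t)" for t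
      unfolding N_def by (rule wLnorm_time_slice[OF a p bc[unfolded s_def]])
    have mix: "mixnorm a (conj_exp q) (conj_exp r) F = enn_powr (\<integral>\<^sup>+t. ennreal (N t powr q') \<partial>lborel) (1 / q')"
      unfolding mixnorm_def p_def[symmetric] q'_def[symmetric]
      by (simp add: wL enn_powr_ennreal N0)
    show ?thesis
    proof (cases "(\<integral>\<^sup>+t. ennreal (N t powr q') \<partial>lborel) = \<infinity>")
      case True
      \<comment> \<open>Positivity of the constant makes the right-hand side infinite when the mixed
        norm is.\<close>
      have "sqrt C0 + 1 > 0" using C0 by (simp add: add_nonneg_pos)
      thus ?thesis using True unfolding mix by (simp add: enn_powr_def ennreal_mult_top)
    next
      case False
      then obtain P where P: "P \<ge> 0" "(\<integral>\<^sup>+t. ennreal (N t powr q') \<partial>lborel) = ennreal P"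
        by (cases "\<integral>\<^sup>+t. ennreal (N t powr q') \<partial>lborel") auto
      define u where "u = (\<lambda>t. bprop s (- t) (time_slice F t))"
      define W where "W = (\<lambda>t \<tau>. pairing_const s r * (N t * N \<tau> * \<bar>t - \<tau>\<bar> powr (- \<gamma>)))"
      have "(\<integral>\<^sup>+x. ennreal ((norm (\<integral>t. u t x \<partial>lborel))\<^sup>2) \<partial>?M) \<le> (\<integral>\<^sup>+t. \<integral>\<^sup>+\<tau>. ennreal (W t \<tau>) \<partial>lborel \<partial>lborel)"
      proof (rule nn_integral_time_integral_power2_le[OF sigma_finite_halfline])
        have "(\<lambda>z. u (fst z) (snd z)) \<in> borel_measurable (borel \<Otimes>\<^sub>M borel)"
          unfolding u_def by (rule bprop_measurable_pair[OF time_slice_measurable[OF F]]) auto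
        thus "(\<lambda>z. u (fst z) (snd z)) \<in> borel_measurable (borel \<Otimes>\<^sub>M ?M)"
          by (simp cong: measurable_cong_sets sets_pair_measure_cong)
        show "integrable ?M (\<lambda>x. (norm (u t x))\<^sup>2)" for t
          unfolding u_def using integrable_bprop_power2[OF s bc] by (simp add: a_eq)
        show "(\<integral>x. (norm (u t x))\<^sup>2 \<partial>?M) \<le> (D / (1 + t\<^sup>2))\<^sup>2" for t
          unfolding u_def using bprop_L2[OF s bc, of "- t" t] L2[of t] by (simp add: a_eq)
        show "0 \<le> D / (1 + t\<^sup>2)" for t :: real using D by simp
        have "(\<integral>\<^sup>+t. ennreal (D / (1 + t\<^sup>2)) \<partial>lborel) = ennreal D * (\<integral>\<^sup>+t. ennreal (1 / (1 + t\<^sup>2)) \<partial>lborel)"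
          using D by (subst nn_integral_cmult[symmetric]) (auto simp flip: ennreal_mult')
        also have "\<dots> < \<infinity>" using nn_integral_inverse_1_plus_square by (simp add: ennreal_mult_less_top)
        finally show "(\<integral>\<^sup>+t. ennreal (D / (1 + t\<^sup>2)) \<partial>lborel) < \<infinity>" .
        \<comment> \<open>The pairing of two propagated slices is moved onto one of them, leaving
          propagation by the nonzero time \<open>t - \<tau>\<close>, to which the interpolated bound
          applies.\<close>
        show "norm (\<integral>x. u t x * cnj (u \<tau> x) \<partial>?M) \<le> W t \<tau>" if "t \<noteq> \<tau>" for t \<tau>
          using bprop_inner[OF s bc bc, of t t \<tau> \<tau>] bprop_pairing[OF s r bc bc, of "t - \<tau>" t \<tau>] that
          unfolding u_def W_def N_def \<gamma>_s p_eq[symmetric] a_eq by (simp add: mult_ac)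
      qed measurable
      also have "\<dots> = ennreal (pairing_const s r) * (\<integral>\<^sup>+t. \<integral>\<^sup>+\<tau>. ennreal (N t * N \<tau> * \<bar>t - \<tau>\<bar> powr (- \<gamma>)) \<partial>lborel \<partial>lborel)"
        unfolding W_def using pc0 by (simp add: ennreal_mult' nn_integral_cmult)
      also have "\<dots> \<le> ennreal (pairing_const s r) * ennreal (2 * (2 / (1 - \<gamma>) + 1) / (q' - 1) * P powr (2 / q'))"
        by (intro mult_left_mono hardy_littlewood_sobolev \<gamma>0 \<gamma>1 q' Nm N0 P) auto
      also have "\<dots> = ennreal (C0 * P powr (2 / q'))"
        using pc0 by (simp add: C0_def mult.assoc flip: ennreal_mult')
      finally have "enn_powr (\<integral>\<^sup>+x. ennreal ((norm (\<integral>t. u t x \<partial>lborel))\<^sup>2) \<partial>?M) (1 / 2)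
          \<le> enn_powr (ennreal (C0 * P powr (2 / q'))) (1 / 2)"
        by (rule enn_powr_mono) simp
      also have "\<dots> = ennreal ((C0 * P powr (2 / q')) powr (1 / 2))" using C0 by (intro enn_powr_ennreal) simp
      also have "(C0 * P powr (2 / q')) powr (1 / 2) = sqrt C0 * P powr (1 / q')"
        using C0 by (simp add: powr_mult powr_powr powr_half_sqrt)
      also have "ennreal (sqrt C0 * P powr (1 / q')) \<le> ennreal ((sqrt C0 + 1) * P powr (1 / q'))"
        by (intro ennreal_leI mult_right_mono) auto
      also have "\<dots> = ennreal (sqrt C0 + 1) * mixnorm a (conj_exp q) (conj_exp r) F"
        unfolding mix P(2) using P(1) C0 by (simp add: enn_powr_ennreal ennreal_mult)
      finally show ?thesis unfolding wLnorm_Top[OF a F] u_def s_def .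
    qed
  qed
  moreover have "sqrt C0 + 1 > 0" using C0 by (simp add: add_nonneg_pos)
  ultimately show ?thesis by blast
qed

end
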